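(* Let $\boldsymbol n=(n_1,n_2)\in\mathbb Z_{\ge0}^2$, $N=n_1+n_2$, and let $P_{\boldsymbol n}$ be a monic polynomial of degree $N$ satisfying $$\int_{\Delta_i}x^jP_{\boldsymbol n}(x)w_i(x)\,dx\begin{cases}=0,&j\le n_i-1,\\ \ne0,&j=n_i,\end{cases}\qquad i=1,2,$$ with electrostatic partners $S_{\boldsymbol n,1},S_{\boldsymbol n,2}$. Let $R_{\boldsymbol n}=(A_1A_2v_1v_2)\,\mathfrak{Wrons}[P_{\boldsymbol n},q_{\boldsymbol n,1},q_{\boldsymbol n,2}]\not\equiv0$, which is a polynomial of degree $\le2\sigma_1+2\sigma_2+3$. If the roots of $P_{\boldsymbol n}$ and of $S_{\boldsymbol n,1}$ are simple (and the vector energy below is well defined at $\vec\nu_1$), then the discrete vector measure $\vec\nu_1:=(\nu(P_{\boldsymbol n}),\nu(S_{\boldsymbol n,1}))$ is a critical vector measure for the energy functional $\mathcal E_{\vec\varphi,a}$, with $a=-1/2$ and $$\vec\varphi=\left(\frac12\log\left|\frac1{v_1}\right|,\ \frac12\log\left|\frac{R_{\boldsymbol n}}{A_1A_2}\right|+\frac12\log\left|\frac{v_1}{v_2}\right|\right).$$ Analogously, if the roots of $P_{\boldsymbol n}$ and of $S_{\boldsymbol n,2}$ are simple (and the vector energy below is well defined at $\vec\nu_2$), then the discrete vector measure $\vec\nu_2:=(\nu(P_{\boldsymbol n}),\nu(S_{\boldsymbol n,2}))$ is a critical vector measure for the energy functional $\mathcal E_{\vec\varphi,a}$, with $a=-1/2$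 and $$\vec\varphi=\left(\frac12\log\left|\frac1{v_2}\right|,\ \frac12\log\left|\frac{R_{\boldsymbol n}}{A_1A_2}\right|+\frac12\log\left|\frac{v_2}{v_1}\right|\right).$$
   Context: Two semiclassical weights. For $i=1,2$: $A_i$ (monic) and $B_i$ are real polynomials; $\Delta_i\subset\mathbb R$ is a finite union of non-overlapping intervals joining real zeros of $A_i$ and possibly $\infty$ (with no zero of $A_i$ in the interior of these intervals); $w_i(z)=\exp\left(\int^z\frac{B_i(t)}{A_i(t)}dt\right)$ is a (multivalued) analytic function, and on each interval of $\Delta_i$ the weight, also denoted $w_i$, is positive and coincides up to a non-zero multiplicative constant with a boundary value $(w_i)_+$ of this function. Thus $w_i'/w_i=B_i/A_i$. Put $v_i=A_iw_i$. All moments are finite: $\int_{\Delta_i}|x|^m|w_i(x)|dx<+\infty$, $m=0,1,2,\dots$; as a consequence $z^mv_i(z)=0$ (in the limit sense) at the endpoints of every subinterval of $\Delta_i$. Put $\sigma_i=\max\{\deg(A_i)-2,\deg(B_i)-1\}$, assumed $\ge0$. When $A_1=A_2=A$ and $B_1=B_2=B$, the analytic functions $w_1,w_2$ are normalized so that $w_1=w_2=\exp\left(\int^zB/A\right)$. Cauchy transform: $\mathfrak C_{w_i}[f](z)=\int_{\Delta_i}\frac{f(t)w_i(t)}{t-z}dt$. Functions of the second kind: $q_{\boldsymbol n,i}=\mathfrak C_{w_i}[P_{\boldsymbol n}]/w_i$. $\mathfrak{Wrons}[f_1,\dots,f_k]=\det\left(f_j^{(i-1)}\right)_{i,j=1}^k$.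 Electrostatic partners (which are polynomials): $S_{\boldsymbol n,i}=v_i\,\mathfrak{Wrons}[P_{\boldsymbol n},q_{\boldsymbol n,i}]$. Standing assumption: $\mathfrak{Wrons}[P_{\boldsymbol n},q_{\boldsymbol n,1},q_{\boldsymbol n,2}]\not\equiv0$. Zero-counting measure: $\nu(y)=\sum_j\delta_{\zeta_j}$ over the zeros $\zeta_j$ of a polynomial $y$ ($\nu(y)=0$ if $y$ is constant). Vector energy: for $\vec\mu=(\mu_1,\mu_2)$ with $\mu_1=\sum_{k=1}^{m_1}\delta_{\zeta_k}$, $\mu_2=\sum_{j=1}^{m_2}\delta_{\xi_j}$ (distinct points, disjoint supports), $a\in(-1,1)$, and $\vec\varphi=(\varphi_1,\varphi_2)$ an external field with $\varphi_i=\Re\Phi_i$, $\Phi_i'$ single-valued, $$\mathcal E_{\vec\varphi,a}(\vec\mu)=\sum_{i\ne k}\log\frac1{|\zeta_i-\zeta_k|}+2a\sum_{k,j}\log\frac1{|\zeta_k-\xi_j|}+\sum_{i\ne j}\log\frac1{|\xi_i-\xi_j|}+2\sum_k\varphi_1(\zeta_k)+2\sum_j\varphi_2(\xi_j).$$ It is well defined at $\vec\mu$ when the supports are disjoint and $\varphi_1$, resp. $\varphi_2$, is finite (has no singularity, i.e. $\Phi_1'$, resp. $\Phi_2'$, has no pole) at the points $\zeta_k$, resp. $\xi_j$. $\vec\mu$ is a critical vector measure for $\mathcal E_{\vec\varphi,a}$ if $\nabla\mathcal E_{\vec\varphi,a}(\zeta_1,\dots,\zeta_{m_1},\xi_1,\dots,\xi_{m_2})=0$;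 explicitly, $$\sum_{i\ne k}\frac1{\zeta_k-\zeta_i}+a\sum_j\frac1{\zeta_k-\xi_j}=\Phi_1'(\zeta_k)\ \ \forall k,\qquad \sum_{i\ne j}\frac1{\xi_j-\xi_i}+a\sum_k\frac1{\xi_j-\zeta_k}=\Phi_2'(\xi_j)\ \ \forall j.$$ *)

theory Defs
  imports
    "HOL-Complex_Analysis.Complex_Analysis"
    "HOL-Library.Extended_Real"
    "Jordan_Normal_Form.Determinant"
begin

section \<open>Semiclassical weights\<close>

text \<open>
  The data of a weight: the real polynomials A and B, the intervals of \<open>\<Delta>\<close> (given by their
  end points, possibly infinite), and the positive weight function on \<open>\<Delta>\<close>.
  The analytic function that goes with it is multivalued, and enters through its branches below.
\<close>

record weight_data =
  polyA :: "real poly"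
  polyB :: "real poly"
  intervals :: "(ereal \<times> ereal) set"
  weight :: "real \<Rightarrow> real"

definition cpolyA :: "weight_data \<Rightarrow> complex poly" where
  "cpolyA W = map_poly of_real (polyA W)"

definition cpolyB :: "weight_data \<Rightarrow> complex poly" where
  "cpolyB W = map_poly of_real (polyB W)"

definition supp :: "weight_data \<Rightarrow> real set" where
  "supp W = {x. \<exists>(a, b) \<in> intervals W. a \<le> ereal x \<and> ereal x \<le> b}"

text \<open>
  \<open>f\<close> is a branch on \<open>U\<close> of the multivalued function \<open>exp (\<integral> B/A)\<close>. The base point of the
  integral is free, so that branches are determined up to non-zero constant factors only (on
  connected sets); in particular every joint normalization of two such functions is allowed.
\<close>

definition weight_branch :: "weight_data \<Rightarrow> complex set \<Rightarrow> (complex \<Rightarrow> complex) \<Rightarrow> bool" where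
  "weight_branch W U f \<longleftrightarrow>
     (\<exists>F. \<forall>z\<in>U. poly (cpolyA W) z \<noteq> 0 \<and>
        (F has_field_derivative (poly (cpolyB W) z / poly (cpolyA W) z)) (at z) \<and>
        f z = exp (F z))"

text \<open>
  On the open interval from \<open>a\<close> to \<open>b\<close> the weight is positive and is a constant multiple of the
  boundary value, from the upper half-plane, of a branch. The branch is taken on a strip
  so thin that it contains no zero of A.
\<close>

definition weight_on_interval :: "weight_data \<Rightarrow> ereal \<Rightarrow> ereal \<Rightarrow> bool" where
  "weight_on_interval W a b \<longleftrightarrow>
     (\<forall>x. a < ereal x \<and> ereal x < b \<longrightarrow> weight W x > 0) \<and>
     (\<exists>\<delta>>0. \<exists>f. \<exists>c::complex. c \<noteq> 0 \<and>
        weight_branch W {z. a < ereal (Re z) \<and> ereal (Re z) < b \<and> 0 < Im z \<and> Im z < \<delta>} f \<and>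
        (\<forall>x. a < ereal x \<and> ereal x < b \<longrightarrow>
           ((\<lambda>y. c * f (Complex x y)) \<longlongrightarrow> complex_of_real (weight W x)) (at_right 0)))"

text \<open>The number \<open>\<sigma>\<close> of the theory of semiclassical weights (their class when A and B are coprime).\<close>

definition weight_class :: "weight_data \<Rightarrow> int" where
  "weight_class W = max (int (degree (polyA W)) - 2) (int (degree (polyB W)) - 1)"

definition semiclassical :: "weight_data \<Rightarrow> bool" where
  "semiclassical W \<longleftrightarrow>
     lead_coeff (polyA W) = 1 \<and>
     finite (intervals W) \<and>
     (\<forall>(a, b) \<in> intervals W.
        a < b \<and>
        (a = -\<infinity> \<or> (\<exists>x. a = ereal x \<and> poly (polyA W) x = 0)) \<and>
        (b = \<infinity> \<or> (\<exists>x. b = ereal x \<and> poly (polyA W) x = 0)) \<and>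
        (\<forall>x. a < ereal x \<and> ereal x < b \<longrightarrow> poly (polyA W) x \<noteq> 0) \<and>
        weight_on_interval W a b) \<and>
     (\<forall>(a, b) \<in> intervals W. \<forall>(c, d) \<in> intervals W.
        (a, b) \<noteq> (c, d) \<longrightarrow> {a<..<b} \<inter> {c<..<d} = {}) \<and>
     (\<forall>m::nat. set_integrable lborel (supp W) (\<lambda>x. \<bar>x\<bar> ^ m * \<bar>weight W x\<bar>)) \<and>
     weight_class W \<ge> 0"


section \<open>Multiple orthogonality, functions of the second kind, electrostatic partners\<close>

definition moment :: "weight_data \<Rightarrow> complex poly \<Rightarrow> nat \<Rightarrow> complex" where
  "moment W P j =
     (LINT x:supp W|lborel. complex_of_real (x ^ j) * poly P (complex_of_real x) *
        complex_of_real (weight W x))"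

definition orthogonal_to_order :: "weight_data \<Rightarrow> complex poly \<Rightarrow> nat \<Rightarrow> bool" where
  "orthogonal_to_order W P n \<longleftrightarrow> (\<forall>j<n. moment W P j = 0) \<and> moment W P n \<noteq> 0"

definition cauchy_transform :: "weight_data \<Rightarrow> (complex \<Rightarrow> complex) \<Rightarrow> complex \<Rightarrow> complex" where
  "cauchy_transform W f z =
     (LINT t:supp W|lborel. f (complex_of_real t) * complex_of_real (weight W t) /
        (complex_of_real t - z))"

text \<open>The function of the second kind and the function \<open>v = A w\<close>, for a branch \<open>f\<close> of \<open>w\<close>.\<close>

definition second_kind ::
  "weight_data \<Rightarrow> (complex \<Rightarrow> complex) \<Rightarrow> complex poly \<Rightarrow> complex \<Rightarrow> complex" where
  "second_kind W f P z = cauchy_transform W (poly P) z / f z"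

definition v_fun :: "weight_data \<Rightarrow> (complex \<Rightarrow> complex) \<Rightarrow> complex \<Rightarrow> complex" where
  "v_fun W f z = poly (cpolyA W) z * f z"

definition wronskian :: "(complex \<Rightarrow> complex) list \<Rightarrow> complex \<Rightarrow> complex" where
  "wronskian fs z =
     Determinant.det (Matrix.mat (length fs) (length fs) (\<lambda>(i, j). (deriv ^^ i) (fs ! j) z))"

text \<open>
  Both products below are single-valued off the supports and do not depend on the choice
  of the branches. Local branches exist near every point off the supports that is not a zero
  of A, hence the polynomials in the next two definitions are unique.
\<close>

definition is_electrostatic_partner ::
  "weight_data \<Rightarrow> complex poly \<Rightarrow> complex poly \<Rightarrow> bool" where
  "is_electrostatic_partner W P S \<longleftrightarrow>
     (\<forall>U f. open U \<and> U \<inter> of_real ` supp W = {} \<and> weight_branch W U f \<longrightarrow>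
        (\<forall>z\<in>U. poly S z = v_fun W f z * wronskian [poly P, second_kind W f P] z))"

definition is_R_polynomial ::
  "weight_data \<Rightarrow> weight_data \<Rightarrow> complex poly \<Rightarrow> complex poly \<Rightarrow> bool" where
  "is_R_polynomial W1 W2 P R \<longleftrightarrow>
     (\<forall>U f1 f2. open U \<and> U \<inter> of_real ` (supp W1 \<union> supp W2) = {} \<and>
        weight_branch W1 U f1 \<and> weight_branch W2 U f2 \<longrightarrow>
        (\<forall>z\<in>U. poly R z =
           (poly (cpolyA W1) z * poly (cpolyA W2) z * v_fun W1 f1 z * v_fun W2 f2 z) *
           wronskian [poly P, second_kind W1 f1 P, second_kind W2 f2 P] z))"

definition wronskian_not_identically_zero ::
  "weight_data \<Rightarrow> weight_data \<Rightarrow> complex poly \<Rightarrow> bool" where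
  "wronskian_not_identically_zero W1 W2 P \<longleftrightarrow>
     (\<exists>U f1 f2. open U \<and> U \<inter> of_real ` (supp W1 \<union> supp W2) = {} \<and>
        weight_branch W1 U f1 \<and> weight_branch W2 U f2 \<and>
        (\<exists>z\<in>U. wronskian [poly P, second_kind W1 f1 P, second_kind W2 f2 P] z \<noteq> 0))"


section \<open>Vector energy and critical vector measures\<close>

text \<open>
  A sum of unit point masses is represented by the multiset of its points; the zero-counting
  measure of \<open>p\<close> is the multiset \<open>proots p\<close>.

  An external field is in general multivalued. It is represented by the predicate \<open>D U \<phi>\<close>
  saying that the values of \<open>\<phi>\<close> on the open set \<open>U\<close> are a determination of the field there.
  The field is finite at \<open>p\<close>, with determination \<open>\<phi>\<close> near \<open>p\<close>, if \<open>\<phi> = Re \<Phi>\<close> for a function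
  \<open>\<Phi>\<close> holomorphic near \<open>p\<close>. The formula defining the field is only required to hold in a
  punctured neighbourhood, so that singularities of its individual terms
  that cancel each other at \<open>p\<close> are admitted.
\<close>

type_synonym field = "complex set \<Rightarrow> (complex \<Rightarrow> real) \<Rightarrow> bool"

definition finite_field_at :: "field \<Rightarrow> complex \<Rightarrow> (complex \<Rightarrow> real) \<Rightarrow> bool" where
  "finite_field_at D p \<phi> \<longleftrightarrow>
     (\<exists>r>0. \<exists>\<Phi>. \<Phi> holomorphic_on ball p r \<and> (\<forall>z\<in>ball p r. \<phi> z = Re (\<Phi> z)) \<and>
        (\<forall>z\<in>ball p r - {p}. \<exists>U. open U \<and> z \<in> U \<and> D U \<phi>))"

definition vector_energy ::
  "real \<Rightarrow> (complex \<Rightarrow> real) \<Rightarrow> (complex \<Rightarrow> real) \<Rightarrow> complex list \<Rightarrow> complex list \<Rightarrow> real" where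
  "vector_energy a \<phi>1 \<phi>2 zs xs =
     (\<Sum>k<length zs. \<Sum>i\<in>{..<length zs} - {k}. ln (1 / cmod (zs ! i - zs ! k))) +
     2 * a * (\<Sum>k<length zs. \<Sum>j<length xs. ln (1 / cmod (zs ! k - xs ! j))) +
     (\<Sum>j<length xs. \<Sum>i\<in>{..<length xs} - {j}. ln (1 / cmod (xs ! i - xs ! j))) +
     2 * (\<Sum>k<length zs. \<phi>1 (zs ! k)) + 2 * (\<Sum>j<length xs. \<phi>2 (xs ! j))"

definition energy_well_defined ::
  "field \<Rightarrow> field \<Rightarrow> complex multiset \<Rightarrow> complex multiset \<Rightarrow> bool" where
  "energy_well_defined D1 D2 \<mu>1 \<mu>2 \<longleftrightarrow>
     set_mset \<mu>1 \<inter> set_mset \<mu>2 = {} \<and>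
     (\<forall>p. count \<mu>1 p \<le> 1 \<and> count \<mu>2 p \<le> 1) \<and>
     (\<forall>p\<in>#\<mu>1. \<exists>\<phi>. finite_field_at D1 p \<phi>) \<and>
     (\<forall>p\<in>#\<mu>2. \<exists>\<phi>. finite_field_at D2 p \<phi>)"

text \<open>
  The gradient of the energy with respect to all points vanishes iff the (real) derivative with
  respect to each single point does. When the energy is well defined, local determinations
  of the fields can be glued to functions \<open>\<phi>1\<close> and \<open>\<phi>2\<close> as below, and any two choices differ
  near each point by a constant.
\<close>

definition critical_vector_measure ::
  "real \<Rightarrow> field \<Rightarrow> field \<Rightarrow> complex multiset \<Rightarrow> complex multiset \<Rightarrow> bool" where
  "critical_vector_measure a D1 D2 \<mu>1 \<mu>2 \<longleftrightarrow>
     energy_well_defined D1 D2 \<mu>1 \<mu>2 \<and>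
     (\<forall>zs xs \<phi>1 \<phi>2. mset zs = \<mu>1 \<and> mset xs = \<mu>2 \<and>
        (\<forall>p\<in>set zs. finite_field_at D1 p \<phi>1) \<and> (\<forall>p\<in>set xs. finite_field_at D2 p \<phi>2) \<longrightarrow>
        (\<forall>k<length zs. ((\<lambda>z. vector_energy a \<phi>1 \<phi>2 (zs[k := z]) xs) has_derivative (\<lambda>_. 0))
           (at (zs ! k))) \<and>
        (\<forall>j<length xs. ((\<lambda>x. vector_energy a \<phi>1 \<phi>2 zs (xs[j := x])) has_derivative (\<lambda>_. 0))
           (at (xs ! j))))"

text \<open>The fields \<open>1/2 log |1/v|\<close> and \<open>1/2 log |R/(A A')| + 1/2 log |v/v'|\<close>.\<close>

definition field_P :: "weight_data \<Rightarrow> field" where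
  "field_P W U \<phi> \<longleftrightarrow>
     (\<exists>f. weight_branch W U f \<and> (\<forall>z\<in>U. \<phi> z = 1/2 * ln (cmod (1 / v_fun W f z))))"

definition field_S :: "weight_data \<Rightarrow> weight_data \<Rightarrow> complex poly \<Rightarrow> field" where
  "field_S W W' R U \<phi> \<longleftrightarrow>
     (\<exists>f f'. weight_branch W U f \<and> weight_branch W' U f' \<and>
        (\<forall>z\<in>U. \<phi> z =
           1/2 * ln (cmod (poly R z / (poly (cpolyA W) z * poly (cpolyA W') z))) +
           1/2 * ln (cmod (v_fun W f z / v_fun W' f' z))))"

end

theory Submission
  imports Defs "HOL-Computational_Algebra.Fundamental_Theorem_Algebra"
begin

text \<open>
  Let \<open>H\<close> be the Cauchy transform of the constant 1 for one of the weights. Since \<open>w' = (B/A) w\<close> and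
  the boundary values of \<open>A w\<close> vanish, an integration by parts gives \<open>A H' = B H + K\<close> with a
  polynomial \<open>K\<close>. Dividing \<open>P(t) - P(z)\<close> by \<open>t - z\<close> under the integral gives
  \<open>C[P] = P H + Q\<close> with a polynomial \<open>Q\<close>. Hence the function of the second kind is
  \<open>q = P h + Q/w\<close>, where \<open>h = H/w\<close> has the elementary derivative \<open>h' = K/(A w)\<close>. In a Wronskian
  whose first column belongs to \<open>P\<close>, the multiples of that column by \<open>h\<close>, which is
  all that is transcendental apart from the factors \<open>1/w\<close>, drop out. What remains are explicit polynomials \<open>S\<^sub>1\<close>, \<open>S\<^sub>2\<close> and \<open>R\<close> in \<open>A\<close>, \<open>B\<close>, \<open>K\<close>, \<open>Q\<close>, \<open>P\<close> and their
  derivatives. Zeros of \<open>P\<close> or of \<open>A\<close> on the supports thus need no separate treatment.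

  The degree of \<open>R\<close> is read off on the imaginary axis, where orthogonality makes the Cauchy
  transform of \<open>P\<close> as small as \<open>|z|\<^bsup>-n-1\<^esup>\<close> and Cauchy's estimates gain one more power per derivative.

  Condensation of the 3 by 3 determinant with pivot \<open>P\<close> yields
  \<open>P R = A\<^sub>1 A\<^sub>2 (S\<^sub>1 S\<^sub>2' - S\<^sub>1' S\<^sub>2) + S\<^sub>1 S\<^sub>2 (E\<^sub>1 A\<^sub>2 - E\<^sub>2 A\<^sub>1)\<close> with \<open>E\<^sub>i = A\<^sub>i' + B\<^sub>i\<close>. The criticality equations
  are consequences of such identities. At a zero of \<open>P\<close> one has
  \<open>P' (A S' - E S) = A P'' S\<close> (\<open>partner_poly_at_zero\<close>), that is \<open>P''/(2P') - S'/(2S) = -v'/(2v)\<close>.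
  At a zero of \<open>S\<^sub>1\<close> where \<open>A\<^sub>1 A\<^sub>2 S\<^sub>2\<close> does not vanish, the equation is the logarithmic derivative of the
  displayed identity. If \<open>A\<^sub>1 A\<^sub>2 S\<^sub>2\<close> vanishes there, then so does \<open>R\<close>, and the energy is well defined
  only because the singularities of the field cancel. In that case the identity forces \<open>R\<close> and
  \<open>A\<^sub>1 A\<^sub>2 S\<^sub>2\<close> to vanish to the same order, and the common factor can be removed
  (\<open>simple_zero_condition\<close>).
\<close>

section \<open>Integrals of derivatives over open intervals\<close>

text \<open>
  The increment of \<open>F\<close> from a fixed point \<open>c\<close> is the integral of \<open>f\<close>, and these integrals converge
  by dominated convergence. The end points are extended reals so that bounded and unbounded
  intervals are treated at once.
\<close>

lemma integrable_deriv_imp_limit_left: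
  fixes F f :: "real \<Rightarrow> complex" and a b :: ereal
  assumes ab: "a < b"
    and F: "\<And>x. a < ereal x \<Longrightarrow> ereal x < b \<Longrightarrow> (F has_vector_derivative f x) (at x)"
    and f: "\<And>x. a < ereal x \<Longrightarrow> ereal x < b \<Longrightarrow> isCont f x"
    and int: "set_integrable lborel (einterval a b) f"
  shows "\<exists>L. ((F \<circ> real_of_ereal) \<longlongrightarrow> L) (at_left b)"
proof -
  obtain c where c: "a < ereal c" "ereal c < b"
    using einterval_nonempty[OF ab] by (auto simp: einterval_iff)
  have intc: "set_integrable lborel (einterval c b) f"
    by (rule set_integrable_subset[OF int]) (use c less_trans[OF c(1)] in \<open>auto simp: einterval_iff\<close>)
  have "((F \<circ> real_of_ereal) \<longlongrightarrow> F c + (LBINT x=c..b. f x)) (at_left b)"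
  proof (rule tendsto_at_left_sequentially[OF c(2)])
    fix S :: "nat \<Rightarrow> ereal"
    assume S: "\<And>n. S n < b" "\<And>n. ereal c < S n" "S \<longlonglongrightarrow> b"
    define s where "s n = real_of_ereal (S n)" for n
    have Ss: "S n = ereal (s n)" for n
      using S(1)[of n] S(2)[of n] unfolding s_def by (cases "S n") auto
    have eq: "(F \<circ> real_of_ereal) (S n) = F c + (LBINT x=c..s n. f x)" for n
    proof -
      have lt: "c < s n" "ereal (s n) < b" using S(1,2)[of n] Ss[of n] by auto
      have "a < ereal x \<and> ereal x < b" if "c \<le> x" "x \<le> s n" for x
        using c that lt by (meson ereal_less_eq(3) less_le_trans le_less_trans)
      then have "(LBINT x=c..s n. f x) = F (s n) - F c"
        using lt by (intro interval_integral_FTC_finite)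
          (auto intro!: continuous_at_imp_continuous_on f has_vector_derivative_at_within[OF F])
      then show ?thesis by (simp add: Ss)
    qed
    have "(\<lambda>n. LBINT x=c..s n. f x) \<longlonglongrightarrow> (LBINT x=c..b. f x)"
    proof -
      have 1: "(LBINT x=c..s n. f x) = (LINT x|lborel. indicator (einterval c (s n)) x *\<^sub>R f x)" for n
        using S(2)[of n] Ss[of n] by (simp add: interval_lebesgue_integral_def set_lebesgue_integral_def)
      have 2: "(LBINT x=c..b. f x) = (LINT x|lborel. indicator (einterval c b) x *\<^sub>R f x)"
        using c by (simp add: interval_lebesgue_integral_def set_lebesgue_integral_def)
      have ind: "indicator (einterval c (s n)) x *\<^sub>R f x =
          indicator (einterval c (s n)) x *\<^sub>R (indicator (einterval c b) x *\<^sub>R f x)" for n x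
        using S(1)[of n] Ss[of n] less_trans[of "ereal x" "ereal (s n)" b] by (auto simp: einterval_iff indicator_def)
      have meas: "(\<lambda>x. indicator (einterval c b) x *\<^sub>R f x) \<in> borel_measurable lborel"
        using intc unfolding set_integrable_def by auto
      show ?thesis unfolding 1 2
      proof (rule integral_dominated_convergence[where w = "\<lambda>x. norm (indicator (einterval c b) x *\<^sub>R f x)"])
        show "(\<lambda>x. indicator (einterval c b) x *\<^sub>R f x) \<in> borel_measurable lborel" by (rule meas)
        show "(\<lambda>x. indicator (einterval c (s n)) x *\<^sub>R f x) \<in> borel_measurable lborel" for n
          by (subst ind) (intro borel_measurable_scaleR meas, simp)
        show "integrable lborel (\<lambda>x. norm (indicator (einterval c b) x *\<^sub>R f x))"
          using intc unfolding set_integrable_def by (rule integrable_norm)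
        show "AE x in lborel. (\<lambda>n. indicator (einterval c (s n)) x *\<^sub>R f x) \<longlonglongrightarrow> indicator (einterval c b) x *\<^sub>R f x"
        proof (rule AE_I2)
          fix x
          show "(\<lambda>n. indicator (einterval c (s n)) x *\<^sub>R f x) \<longlonglongrightarrow> indicator (einterval c b) x *\<^sub>R f x"
          proof (cases "x \<in> einterval c b")
            case True
            then have "\<forall>\<^sub>F n in sequentially. ereal x < S n"
              using order_tendstoD(1)[OF S(3)] by (auto simp: einterval_iff)
            then have "\<forall>\<^sub>F n in sequentially. indicator (einterval c (s n)) x *\<^sub>R f x = indicator (einterval c b) x *\<^sub>R f x"
              by eventually_elim (use True Ss in \<open>auto simp: einterval_iff indicator_def\<close>)
            then show ?thesis by (rule tendsto_eventually)
          next
            case False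
            then show ?thesis by (subst ind) auto
          qed
        qed
        show "AE x in lborel. norm (indicator (einterval c (s n)) x *\<^sub>R f x) \<le> norm (indicator (einterval c b) x *\<^sub>R f x)" for n
          by (subst ind) (auto simp: indicator_def)
      qed
    qed
    then show "(\<lambda>n. (F \<circ> real_of_ereal) (S n)) \<longlonglongrightarrow> F c + (LBINT x=c..b. f x)"
      unfolding eq by (intro tendsto_intros)
  qed
  then show ?thesis by blast
qed

lemma set_integrable_reflect:
  fixes f :: "real \<Rightarrow> complex"
  assumes "set_integrable lborel (einterval a b) f"
  shows "set_integrable lborel (einterval (-b) (-a)) (\<lambda>x. f (-x))"
proof -
  have "integrable lborel (\<lambda>x. indicator (einterval a b) (0 + (-1) * x) *\<^sub>R f (0 + (-1) * x))"
    using assms unfolding set_integrable_def by (subst lborel_integrable_real_affine_iff) auto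
  moreover have "indicator (einterval a b) (0 + (-1) * x) = (indicator (einterval (-b) (-a)) x :: real)" for x
    by (cases a; cases b) (auto simp: einterval_iff indicator_def)
  ultimately show ?thesis unfolding set_integrable_def by simp
qed

text \<open>
  Left end points are reduced to right end points by the reflection \<open>x \<mapsto> -x\<close>.
\<close>

lemma limit_reflect_ereal:
  fixes F :: "real \<Rightarrow> complex" and a :: ereal
  assumes "(((\<lambda>x. F (- x)) \<circ> real_of_ereal) \<longlongrightarrow> L) (at_left (- a))" "a < \<infinity>"
  shows "((F \<circ> real_of_ereal) \<longlongrightarrow> L) (at_right a)"
proof (cases a)
  case (real r)
  then show ?thesis using assms(1)
    by (simp add: at_left_ereal at_right_ereal tendsto_compose_filtermap[symmetric] comp_def
        filterlim_filtermap at_left_minus[of "-r"] )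
next
  case MInf
  then show ?thesis using assms(1)
    by (simp add: at_left_PInf at_right_MInf filterlim_filtermap comp_def at_top_mirror)
qed (use assms in auto)

text \<open>
  A criterion for a boundary value to vanish. The function \<open>\<rho>\<close> is a gauge that tends to infinity at
  the end point, and \<open>F \<rho>'\<close> is dominated by an integrable function. If the limit of \<open>F\<close> were not zero,
  then \<open>\<rho>'\<close> itself would be integrable near the end point, and \<open>\<rho>\<close> would have a finite limit.
\<close>

lemma integrable_deriv_limit_zero:
  fixes F \<phi> \<rho> k :: "real \<Rightarrow> complex" and a b :: ereal
  assumes ab: "a < b"
    and L: "((F \<circ> real_of_ereal) \<longlongrightarrow> L) (at_left b)"
    and int: "set_integrable lborel (einterval a b) \<phi>"
    and \<rho>: "\<And>x. a < ereal x \<Longrightarrow> ereal x < b \<Longrightarrow> (\<rho> has_vector_derivative k x) (at x)"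
    and k: "\<And>x. a < ereal x \<Longrightarrow> ereal x < b \<Longrightarrow> isCont k x"
    and le: "\<And>x. a < ereal x \<Longrightarrow> ereal x < b \<Longrightarrow> norm (F x) * norm (k x) \<le> norm (\<phi> x)"
    and inf: "filterlim (\<rho> \<circ> real_of_ereal) at_infinity (at_left b)"
  shows "L = 0"
proof (rule ccontr)
  assume L0: "L \<noteq> 0"
  have "\<forall>\<^sub>F x in at_left b. norm ((F \<circ> real_of_ereal) x) > norm L / 2"
    using tendsto_norm[OF L] by (rule order_tendstoD) (use L0 in auto)
  then obtain c where c: "c < b" "\<And>y. c < y \<Longrightarrow> y < b \<Longrightarrow> norm (F (real_of_ereal y)) > norm L / 2"
    using eventually_at_left[OF ab] by auto
  define c' where "c' = max a c"
  have c': "c' < b" "a \<le> c'" "c \<le> c'" using ab c by (auto simp: c'_def)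
  have "set_integrable lborel (einterval c' b) k"
    unfolding set_integrable_def
  proof (rule Bochner_Integration.integrable_bound)
    show "integrable lborel (\<lambda>x. indicator (einterval a b) x *\<^sub>R ((2 / norm L) *\<^sub>R \<phi> x))"
      using int unfolding set_integrable_def[symmetric] by (rule set_integrable_scaleR_right)
    show "(\<lambda>x. indicator (einterval c' b) x *\<^sub>R k x) \<in> borel_measurable lborel"
    proof -
      have "continuous_on (einterval c' b) k"
        using k c' by (intro continuous_at_imp_continuous_on) (auto simp: einterval_iff intro: le_less_trans)
      then show ?thesis
        using borel_measurable_continuous_on_indicator[of "einterval c' b" k] by simp
    qed
    show "AE x in lborel. norm (indicator (einterval c' b) x *\<^sub>R k x)
        \<le> norm (indicator (einterval a b) x *\<^sub>R ((2 / norm L) *\<^sub>R \<phi> x))"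
    proof (rule AE_I2)
      fix x
      show "norm (indicator (einterval c' b) x *\<^sub>R k x)
        \<le> norm (indicator (einterval a b) x *\<^sub>R ((2 / norm L) *\<^sub>R \<phi> x))"
      proof (cases "x \<in> einterval c' b")
        case True
        then have x: "a < ereal x" "ereal x < b" "c < ereal x"
          using c' by (auto simp: einterval_iff)
        have "norm L / 2 * norm (k x) \<le> norm (F x) * norm (k x)"
          using c(2)[of "ereal x"] x by (intro mult_right_mono) auto
        also have "\<dots> \<le> norm (\<phi> x)" using le x by simp
        finally have "norm (k x) \<le> 2 / norm L * norm (\<phi> x)"
          using L0 by (simp add: field_simps)
        then show ?thesis using x by (auto simp: einterval_iff indicator_def)
      qed auto
    qed
  qed
  then obtain M where M: "((\<rho> \<circ> real_of_ereal) \<longlongrightarrow> M) (at_left b)"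
    using integrable_deriv_imp_limit_left[of c' b \<rho> k] c' \<rho> k by (meson le_less_trans)
  moreover have "at_left b \<noteq> bot"
    using ab by (cases b) (auto simp: at_left_ereal at_left_PInf filtermap_bot_iff)
  ultimately show False
    using not_tendsto_and_filterlim_at_infinity[OF _ M inf] by blast
qed

text \<open>
  Integrability conditions that, for an \<open>F\<close> with integrable derivative, force the boundary value of
  \<open>F\<close> to be 0: at infinity \<open>F\<close> itself is integrable, and at a finite end point \<open>F\<close> is an integrable
  function times a factor that vanishes there. For \<open>F = A w / (t - z)\<close> this factor comes
  from the zero of \<open>A\<close>.
\<close>

definition vanishing_left :: "ereal \<Rightarrow> ereal \<Rightarrow> (real \<Rightarrow> complex) \<Rightarrow> bool" where
  "vanishing_left a b F \<longleftrightarrow> (a = -\<infinity> \<and> set_integrable lborel (einterval a b) F) \<or>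
     (\<exists>x \<phi>. a = ereal x \<and> set_integrable lborel (einterval a b) \<phi> \<and>
        (\<forall>t. F t = of_real (t - x) * \<phi> t))"

definition vanishing_right :: "ereal \<Rightarrow> ereal \<Rightarrow> (real \<Rightarrow> complex) \<Rightarrow> bool" where
  "vanishing_right a b F \<longleftrightarrow> (b = \<infinity> \<and> set_integrable lborel (einterval a b) F) \<or>
     (\<exists>x \<phi>. b = ereal x \<and> set_integrable lborel (einterval a b) \<phi> \<and>
        (\<forall>t. F t = of_real (t - x) * \<phi> t))"

lemma filterlim_ln_left: "filterlim (\<lambda>t. complex_of_real (ln (x - t))) at_infinity (at_left x)"
proof -
  have "filterlim (\<lambda>t. x - t) (at_right 0) (at_left x)"
    by (auto simp: filterlim_at eventually_at_filter intro!: tendsto_eq_intros)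
  then have "filterlim (\<lambda>t. ln (x - t)) at_bot (at_left x)"
    by (rule filterlim_compose[OF ln_at_0])
  then have "filterlim (\<lambda>t. ln (x - t)) at_infinity (at_left x)"
    using filterlim_mono[OF _ at_bot_le_at_infinity order_refl] by blast
  then show ?thesis
    by (simp add: filterlim_at_infinity_conv_norm_at_top)
qed

text \<open>
  The gauge for \<open>integrable_deriv_limit_zero\<close> is the identity at infinity and a logarithm at a finite
  end point.
\<close>

lemma boundary_value_zero_left:
  assumes ab: "a < b"
    and F: "\<And>x. a < ereal x \<Longrightarrow> ereal x < b \<Longrightarrow> (F has_vector_derivative f x) (at x)"
    and f: "\<And>x. a < ereal x \<Longrightarrow> ereal x < b \<Longrightarrow> isCont f x"
    and int: "set_integrable lborel (einterval a b) f"
    and van: "vanishing_right a b F"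
  shows "((F \<circ> real_of_ereal) \<longlongrightarrow> 0) (at_left b)"
proof -
  obtain L where L: "((F \<circ> real_of_ereal) \<longlongrightarrow> L) (at_left b)"
    using integrable_deriv_imp_limit_left[OF ab F f int] by blast
  consider (inf) "b = \<infinity>" "set_integrable lborel (einterval a b) F" |
    (fin) x \<phi> where "b = ereal x" "set_integrable lborel (einterval a b) \<phi>" "\<And>t. F t = of_real (t - x) * \<phi> t"
    using van unfolding vanishing_right_def by blast
  then have "L = 0"
  proof cases
    case inf
    have "filterlim (complex_of_real \<circ> real_of_ereal) at_infinity (at_left b)"
      using inf filterlim_of_real_at_infinity[where 'a=complex]
      by (simp add: at_left_PInf filterlim_filtermap comp_def)
    then show ?thesis
      by (intro integrable_deriv_limit_zero[OF ab L inf(2), of of_real "\<lambda>_. 1"])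
        (auto intro!: derivative_eq_intros)
  next
    case fin
    have lim: "filterlim ((\<lambda>t. complex_of_real (ln (x - t))) \<circ> real_of_ereal) at_infinity (at_left b)"
      using filterlim_ln_left[of x] fin by (simp add: at_left_ereal filterlim_filtermap comp_def)
    show ?thesis
    proof (rule integrable_deriv_limit_zero[OF ab L fin(2) _ _ _ lim, of "\<lambda>t. of_real (-1 / (x - t))"], goal_cases)
      case (1 t)
      then have "t < x" using fin by simp
      then have "((\<lambda>t. ln (x - t)) has_real_derivative (-1 / (x - t))) (at t)"
        by (auto intro!: derivative_eq_intros simp: divide_inverse)
      then show ?case by (rule has_vector_derivative_of_real[unfolded has_real_derivative_iff_has_vector_derivative[symmetric]])
    next
      case (2 t)
      then show ?case using fin by (auto intro!: continuous_intros)
    next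
      case (3 t)
      then show ?case using fin
        by (auto simp: norm_mult norm_divide abs_minus_commute simp flip: of_real_diff)
    qed
  qed
  with L show ?thesis by simp
qed

lemma boundary_value_zero_right:
  assumes ab: "a < b"
    and F: "\<And>x. a < ereal x \<Longrightarrow> ereal x < b \<Longrightarrow> (F has_vector_derivative f x) (at x)"
    and f: "\<And>x. a < ereal x \<Longrightarrow> ereal x < b \<Longrightarrow> isCont f x"
    and int: "set_integrable lborel (einterval a b) f"
    and van: "vanishing_left a b F"
  shows "((F \<circ> real_of_ereal) \<longlongrightarrow> 0) (at_right a)"
proof (rule limit_reflect_ereal)
  show "a < \<infinity>" using ab by (cases b) auto
  have neg: "a < ereal (- x) \<and> ereal (- x) < b" if "- b < ereal x" "ereal x < - a" for x
    using that by (metis ereal_minus_less_minus ereal_uminus_uminus uminus_ereal.simps(1))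
  show "(((\<lambda>x. F (- x)) \<circ> real_of_ereal) \<longlongrightarrow> 0) (at_left (- a))"
  proof (rule boundary_value_zero_left[of "-b" "-a" _ "\<lambda>x. - f (- x)"])
    show "- b < - a" using ab by simp
    show "((\<lambda>x. F (- x)) has_vector_derivative - f (- x)) (at x)" if "- b < ereal x" "ereal x < - a" for x
      using vector_diff_chain_at[of uminus "-1" x F "f (-x)"] F[of "-x"] neg[OF that]
      by (auto simp: comp_def has_vector_derivative_minus[OF has_vector_derivative_id])
    show "isCont (\<lambda>x. - f (- x)) x" if "- b < ereal x" "ereal x < - a" for x
      using isCont_o2[of x uminus f] f[of "-x"] neg[OF that] by (auto intro!: continuous_intros)
    show "set_integrable lborel (einterval (- b) (- a)) (\<lambda>x. - f (- x))"
      using set_integrable_reflect[OF int] unfolding set_integrable_def by simp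
    show "vanishing_right (- b) (- a) (\<lambda>x. F (- x))"
      using van unfolding vanishing_left_def
    proof (elim disjE exE conjE)
      assume "a = - \<infinity>" "set_integrable lborel (einterval a b) F"
      then show ?thesis using set_integrable_reflect[of a b F] by (simp add: vanishing_right_def)
    next
      fix x \<phi> assume a: "a = ereal x" "set_integrable lborel (einterval a b) \<phi>" "\<forall>t. F t = of_real (t - x) * \<phi> t"
      have "set_integrable lborel (einterval (- b) (- a)) (\<lambda>x. - \<phi> (- x))"
        using set_integrable_reflect[OF a(2)] unfolding set_integrable_def by simp
      then show ?thesis unfolding vanishing_right_def
        using a by (intro disjI2 exI[of _ "-x"] exI[of _ "\<lambda>x. - \<phi> (- x)"]) (auto simp: algebra_simps)
    qed
  qed
qed

lemma integral_deriv_eq_zero: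
  assumes ab: "a < b"
    and F: "\<And>x. a < ereal x \<Longrightarrow> ereal x < b \<Longrightarrow> (F has_vector_derivative f x) (at x)"
    and f: "\<And>x. a < ereal x \<Longrightarrow> ereal x < b \<Longrightarrow> isCont f x"
    and int: "set_integrable lborel (einterval a b) f"
    and van: "vanishing_left a b F" "vanishing_right a b F"
  shows "(LINT x:einterval a b|lborel. f x) = 0"
  using interval_integral_FTC_integrable[OF ab F f int boundary_value_zero_right[OF ab F f int van(1)]
      boundary_value_zero_left[OF ab F f int van(2)]] ab
  by (simp add: interval_lebesgue_integral_def order_less_imp_le)

section \<open>The differential equation of the weight on its support\<close>

lemma poly_map_of_real: "poly (map_poly of_real p) (of_real x :: complex) = of_real (poly p x)"
  by (induction p) (auto simp: map_poly_pCons)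

lemma poly_cpolyA_of_real: "poly (cpolyA W) (of_real x) = of_real (poly (polyA W) x)"
  by (simp add: cpolyA_def poly_map_of_real)

lemma poly_cpolyB_of_real: "poly (cpolyB W) (of_real x) = of_real (poly (polyB W) x)"
  by (simp add: cpolyB_def poly_map_of_real)

lemma open_Re_einterval: "open {z. a < ereal (Re z) \<and> ereal (Re z) < b}"
proof -
  have "{z. a < ereal (Re z) \<and> ereal (Re z) < b} = Re -` einterval a b"
    by (auto simp: einterval_iff)
  moreover have "open (Re -` einterval a b)"
    using continuous_on_open_vimage[OF open_UNIV, of Re] by (auto intro: continuous_intros)
  ultimately show ?thesis by simp
qed

lemma semiclassical_interval:
  assumes "semiclassical W" "(a, b) \<in> intervals W"
  shows "a < b"
    and "a = -\<infinity> \<or> (\<exists>x. a = ereal x \<and> poly (polyA W) x = 0)"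
    and "b = \<infinity> \<or> (\<exists>x. b = ereal x \<and> poly (polyA W) x = 0)"
    and "\<And>x. a < ereal x \<Longrightarrow> ereal x < b \<Longrightarrow> poly (polyA W) x \<noteq> 0"
    and "weight_on_interval W a b"
proof -
  have "\<forall>(a, b) \<in> intervals W.
        a < b \<and>
        (a = -\<infinity> \<or> (\<exists>x. a = ereal x \<and> poly (polyA W) x = 0)) \<and>
        (b = \<infinity> \<or> (\<exists>x. b = ereal x \<and> poly (polyA W) x = 0)) \<and>
        (\<forall>x. a < ereal x \<and> ereal x < b \<longrightarrow> poly (polyA W) x \<noteq> 0) \<and>
        weight_on_interval W a b"
    using assms(1)[unfolded semiclassical_def] by (elim conjE)
  from bspec[OF this assms(2)]
  show "a < b"
    and "a = -\<infinity> \<or> (\<exists>x. a = ereal x \<and> poly (polyA W) x = 0)"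
    and "b = \<infinity> \<or> (\<exists>x. b = ereal x \<and> poly (polyA W) x = 0)"
    and "\<And>x. a < ereal x \<Longrightarrow> ereal x < b \<Longrightarrow> poly (polyA W) x \<noteq> 0"
    and "weight_on_interval W a b" by simp_all
qed

text \<open>
  Only a boundary value from the upper half-plane is given, on a strip that lies above the interval.
  Near a point of the interval \<open>B/A\<close> has a primitive \<open>G\<close> on a full disc; above the interval the
  given branch is a constant multiple of \<open>exp G\<close>, so the boundary value is that multiple of \<open>exp G\<close> too.
\<close>

lemma weight_has_derivative:
  assumes W: "semiclassical W" "(a, b) \<in> intervals W" and x: "a < ereal x" "ereal x < b"
  shows "(weight W has_real_derivative
           poly (polyB W) x / poly (polyA W) x * weight W x) (at x)"
proof -
  have A0: "poly (polyA W) x \<noteq> 0" and wi: "weight_on_interval W a b"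
    using semiclassical_interval[OF W] x by simp_all
  obtain \<delta> f c where \<delta>: "\<delta> > 0" and
    br: "weight_branch W {z. a < ereal (Re z) \<and> ereal (Re z) < b \<and> 0 < Im z \<and> Im z < \<delta>} f" and
    lim: "\<And>x. a < ereal x \<Longrightarrow> ereal x < b \<Longrightarrow>
           ((\<lambda>y. c * f (Complex x y)) \<longlongrightarrow> complex_of_real (weight W x)) (at_right 0)"
    using wi unfolding weight_on_interval_def by blast
  define h where "h z = poly (cpolyB W) z / poly (cpolyA W) z" for z
  obtain F where F: "\<And>z. a < ereal (Re z) \<Longrightarrow> ereal (Re z) < b \<Longrightarrow> 0 < Im z \<Longrightarrow> Im z < \<delta> \<Longrightarrow>
       (F has_field_derivative h z) (at z) \<and> f z = exp (F z)"
    using br unfolding weight_branch_def h_def by blast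
  have "open ({z. a < ereal (Re z) \<and> ereal (Re z) < b} \<inter> {z. poly (cpolyA W) z \<noteq> 0})"
    by (intro open_Int open_Re_einterval open_Collect_neq continuous_intros)
  moreover have "of_real x \<in> {z. a < ereal (Re z) \<and> ereal (Re z) < b} \<inter> {z. poly (cpolyA W) z \<noteq> 0}"
    using x A0 by (simp add: poly_cpolyA_of_real)
  ultimately obtain \<rho>0 where \<rho>0: "\<rho>0 > 0" "ball (of_real x) \<rho>0 \<subseteq>
      {z. a < ereal (Re z) \<and> ereal (Re z) < b} \<inter> {z. poly (cpolyA W) z \<noteq> 0}"
    by (meson openE)
  \<comment> \<open>Small enough for the upper half of the disc to lie in the strip of the given branch.\<close>
  define \<rho> where "\<rho> = min \<rho>0 \<delta>"
  define D where "D = ball (complex_of_real x) \<rho>"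
  have \<rho>: "\<rho> > 0" "\<rho> \<le> \<delta>" using \<rho>0 \<delta> by (auto simp: \<rho>_def)
  have D: "a < ereal (Re z)" "ereal (Re z) < b" "poly (cpolyA W) z \<noteq> 0" if "z \<in> D" for z
    using that \<rho>0(2) by (auto simp: D_def \<rho>_def)
  have Im: "Im z < \<delta>" if "z \<in> D" for z
  proof -
    have "\<bar>Im (z - of_real x)\<bar> \<le> cmod (z - of_real x)" by (rule abs_Im_le_cmod)
    also have "\<dots> < \<rho>" using that by (simp add: D_def dist_norm norm_minus_commute)
    finally show ?thesis using \<rho> by simp
  qed
  have "h holomorphic_on D"
    unfolding h_def by (intro holomorphic_intros) (use D in auto)
  then obtain G where G: "\<And>z. z \<in> D \<Longrightarrow> (G has_field_derivative h z) (at z within D)"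
    using holomorphic_convex_primitive'[of D h] unfolding D_def by auto
  have G: "(G has_field_derivative h z) (at z)" if "z \<in> D" for z
    using G[OF that] that at_within_open[of z D] by (simp add: D_def)
  define H where "H = D \<inter> {z. Im z > 0}"
  have "\<exists>k. \<forall>z\<in>H. F z - G z = k"
  proof (rule has_field_derivative_zero_constant)
    show "convex H" unfolding H_def D_def
      by (intro convex_Int convex_ball convex_halfspace_Im_gt)
    show "((\<lambda>z. F z - G z) has_field_derivative 0) (at z within H)" if "z \<in> H" for z
    proof -
      have "((\<lambda>z. F z - G z) has_field_derivative h z - h z) (at z)"
        using that D Im by (intro DERIV_diff G F[THEN conjunct1]) (auto simp: H_def)
      then show ?thesis by (auto intro: has_field_derivative_at_within)
    qed
  qed
  then obtain k where k: "\<And>z. z \<in> H \<Longrightarrow> F z = G z + k" by (metis diff_add_cancel add.commute)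
  define K where "K = c * exp k"
  have w: "complex_of_real (weight W t) = K * exp (G (of_real t))" if t: "of_real t \<in> D" for t
  proof (rule tendsto_unique[OF trivial_limit_at_right_real[of 0]])
    show "((\<lambda>y. c * f (Complex t y)) \<longlongrightarrow> complex_of_real (weight W t)) (at_right 0)"
      using D[OF t] by (intro lim) auto
    have ct: "((\<lambda>y. Complex t y) \<longlongrightarrow> of_real t) (at_right 0)"
      by (auto intro!: tendsto_eq_intros simp: Complex_eq)
    have "\<forall>\<^sub>F y in at_right 0. Complex t y \<in> D"
      using topological_tendstoD[OF ct _ t] by (simp add: D_def)
    moreover have "\<forall>\<^sub>F y in at_right (0::real). y > 0" by (simp add: eventually_at_right_less)
    ultimately have ev: "\<forall>\<^sub>F y in at_right 0. c * f (Complex t y) = K * exp (G (Complex t y))"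
    proof eventually_elim
      case (elim y)
      then have "Complex t y \<in> H" by (simp add: H_def)
      moreover have "f (Complex t y) = exp (F (Complex t y))"
        using D[OF elim(1)] Im[OF elim(1)] elim(2) by (intro F[THEN conjunct2]) auto
      ultimately show ?case by (simp add: k K_def exp_add)
    qed
    have "isCont G (of_real t)" using G[OF t] by (rule DERIV_isCont)
    then have "((\<lambda>y. K * exp (G (Complex t y))) \<longlongrightarrow> K * exp (G (of_real t))) (at_right 0)"
      by (intro tendsto_intros isCont_tendsto_compose[OF _ ct])
    then show "((\<lambda>y. c * f (Complex t y)) \<longlongrightarrow> K * exp (G (of_real t))) (at_right 0)"
      by (rule tendsto_cong[THEN iffD2, OF ev])
  qed
  have xD: "of_real x \<in> D" using \<rho> by (simp add: D_def)
  have "((\<lambda>z. K * exp (G z)) has_field_derivative K * (exp (G (of_real x)) * h (of_real x))) (at (of_real x))"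
    by (auto intro!: derivative_eq_intros G xD)
  also have "K * (exp (G (of_real x)) * h (of_real x)) =
      of_real (poly (polyB W) x / poly (polyA W) x * weight W x)"
    using w[OF xD] by (simp add: h_def poly_cpolyA_of_real poly_cpolyB_of_real)
  finally have "((\<lambda>t. K * exp (G (of_real t))) has_vector_derivative
      complex_of_real (poly (polyB W) x / poly (polyA W) x * weight W x)) (at x)"
    by (rule has_vector_derivative_real_field)
  from bounded_linear.has_vector_derivative[OF bounded_linear_Re this]
  have "((\<lambda>t. Re (K * exp (G (of_real t)))) has_vector_derivative
      poly (polyB W) x / poly (polyA W) x * weight W x) (at x)"
    by (simp only: Re_complex_of_real)
  then have "((\<lambda>t. Re (K * exp (G (of_real t)))) has_real_derivative
      poly (polyB W) x / poly (polyA W) x * weight W x) (at x)"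
    by (simp add: has_real_derivative_iff_has_vector_derivative)
  moreover have ev: "\<forall>\<^sub>F t in nhds x. Re (K * exp (G (of_real t))) = weight W t"
  proof -
    have "((\<lambda>t. complex_of_real t) \<longlongrightarrow> of_real x) (nhds x)"
      by (intro tendsto_of_real filterlim_ident)
    from topological_tendstoD[OF this, of D] xD
    have "\<forall>\<^sub>F t in nhds x. complex_of_real t \<in> D" by (simp add: D_def)
    then show ?thesis
    proof eventually_elim
      case (elim t)
      show ?case by (simp only: w[OF elim, symmetric] Re_complex_of_real)
    qed
  qed
  ultimately show ?thesis
    by (subst (asm) DERIV_cong_ev[OF refl ev refl])
qed

section \<open>Integrals over the support\<close>

text \<open>
  The closed intervals of the support may share end points, and nothing is known about the sign of
  the weight there. Both are invisible to the Lebesgue measure, since the end points are finitely many;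
  infinite end points contribute the harmless value of \<open>real_of_ereal\<close>.
\<close>

definition endpoints :: "weight_data \<Rightarrow> real set" where
  "endpoints W = (\<Union>p\<in>intervals W. {real_of_ereal (fst p), real_of_ereal (snd p)})"

definition inner_supp :: "weight_data \<Rightarrow> real set" where
  "inner_supp W = (\<Union>p\<in>intervals W. einterval (fst p) (snd p))"

lemma finite_intervals: "semiclassical W \<Longrightarrow> finite (intervals W)"
  by (simp add: semiclassical_def)

lemma finite_endpoints: "semiclassical W \<Longrightarrow> finite (endpoints W)"
  by (auto simp: endpoints_def finite_intervals)

lemma einterval_subset_supp:
  assumes "(a, b) \<in> intervals W"
  shows "einterval a b \<subseteq> supp W"
  unfolding supp_def
proof (intro subsetI CollectI bexI[OF _ assms])
  fix x assume "x \<in> einterval a b"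
  then have "a < ereal x" "ereal x < b" by (simp_all add: einterval_iff)
  then show "case (a, b) of (a, b) \<Rightarrow> a \<le> ereal x \<and> ereal x \<le> b" by (simp add: less_imp_le)
qed

lemma inner_supp_subset: "inner_supp W \<subseteq> supp W"
  unfolding inner_supp_def by (intro UN_least einterval_subset_supp) simp

lemma supp_subset_inner: "supp W - endpoints W \<subseteq> inner_supp W"
proof
  fix x assume x: "x \<in> supp W - endpoints W"
  then obtain a b where ab: "(a, b) \<in> intervals W" "a \<le> ereal x" "ereal x \<le> b"
    by (auto simp: supp_def)
  have "real_of_ereal a \<in> endpoints W" "real_of_ereal b \<in> endpoints W"
    unfolding endpoints_def by (rule UN_I[OF ab(1)], simp)+
  then have "a \<noteq> ereal x" "b \<noteq> ereal x" using x by auto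
  then have "x \<in> einterval a b" using ab by (auto simp: einterval_iff)
  then show "x \<in> inner_supp W" unfolding inner_supp_def by (intro UN_I[OF ab(1)]) simp
qed

lemma closed_supp:
  assumes "semiclassical W"
  shows "closed (supp W)"
proof -
  have "supp W = (\<Union>p\<in>intervals W. {x. fst p \<le> ereal x} \<inter> {x. ereal x \<le> snd p})"
    unfolding supp_def by (auto simp: case_prod_beta)
  also have "closed \<dots>"
    by (intro closed_UN finite_intervals assms ballI closed_Int closed_Collect_le
        continuous_intros continuous_on_ereal)
  finally show ?thesis .
qed

lemma weight_pos:
  assumes "semiclassical W" "x \<in> inner_supp W"
  shows "weight W x > 0"
proof -
  obtain p where p: "p \<in> intervals W" "x \<in> einterval (fst p) (snd p)"
    using assms(2) unfolding inner_supp_def by (rule UN_E)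
  then obtain a b where ab: "(a, b) \<in> intervals W" "a < ereal x" "ereal x < b"
    by (cases p) (simp add: einterval_iff)
  then show ?thesis
    using semiclassical_interval(5)[OF assms(1) ab(1)] unfolding weight_on_interval_def by blast
qed

text \<open>
  The hypothesis is about the absolute value of the weight, which does not determine the
  measurability of the weight itself. Off the end points the weight is positive, however.
\<close>

lemma set_integrable_monom_weight:
  assumes W: "semiclassical W"
  shows "set_integrable lborel (supp W) (\<lambda>t. complex_of_real (t ^ m * weight W t))"
proof -
  have mom: "set_integrable lborel (supp W) (\<lambda>x. \<bar>x\<bar> ^ m * \<bar>weight W x\<bar>)" for m :: nat
    using W unfolding semiclassical_def by simp
  have meas: "(\<lambda>x. indicator (supp W) x * \<bar>weight W x\<bar>) \<in> borel_measurable lborel"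
    using borel_measurable_integrable[OF mom[of 0, unfolded set_integrable_def]] by simp
  have "integrable lborel (\<lambda>x. x ^ m * (indicator (supp W) x * \<bar>weight W x\<bar>))"
  proof (rule Bochner_Integration.integrable_bound[OF mom[of m, unfolded set_integrable_def]])
    show "(\<lambda>x. x ^ m * (indicator (supp W) x * \<bar>weight W x\<bar>)) \<in> borel_measurable lborel"
      by (intro borel_measurable_times meas) simp
  qed (auto simp: indicator_def abs_mult power_abs)
  moreover have "integrable lborel (\<lambda>x. x ^ m * (indicator (supp W) x * \<bar>weight W x\<bar>)) \<longleftrightarrow>
      integrable lborel (\<lambda>x. indicator (supp W) x *\<^sub>R (x ^ m * weight W x))"
  proof (rule integrable_discrete_difference[where X = "endpoints W"])
    show "countable (endpoints W)" using finite_endpoints[OF W] by (rule countable_finite)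
    show "x ^ m * (indicator (supp W) x * \<bar>weight W x\<bar>) = indicator (supp W) x *\<^sub>R (x ^ m * weight W x)"
      if "x \<notin> endpoints W" for x
      using that supp_subset_inner[of W] weight_pos[OF W, of x] by (auto simp: indicator_def)
  qed auto
  ultimately have "integrable lborel (\<lambda>x. complex_of_real (indicator (supp W) x *\<^sub>R (x ^ m * weight W x)))"
    by (intro integrable_of_real) simp
  then show ?thesis
    unfolding set_integrable_def by (rule back_subst[of "integrable lborel"]) (auto simp: scaleR_conv_of_real)
qed

lemma set_integrable_poly_weight:
  assumes W: "semiclassical W"
  shows "set_integrable lborel (supp W) (\<lambda>t. poly p (of_real t) * complex_of_real (weight W t))"
proof -
  have "set_integrable lborel (supp W)
      (\<lambda>t. \<Sum>i\<le>degree p. coeff p i * complex_of_real (t ^ i * weight W t))"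
    unfolding set_integrable_def scaleR_sum_right
    using set_integrable_mult_right[OF set_integrable_monom_weight[OF W], unfolded set_integrable_def]
    by (intro Bochner_Integration.integrable_sum) blast
  then show ?thesis
    by (simp add: poly_altdef sum_distrib_right mult.assoc)
qed

lemma set_integrable_poly_weight_bounded:
  assumes W: "semiclassical W" and r: "r \<in> borel_measurable borel"
    and K: "\<And>t. t \<in> supp W \<Longrightarrow> norm (r t) \<le> K"
  shows "set_integrable lborel (supp W) (\<lambda>t. poly p (of_real t) * complex_of_real (weight W t) * r t)"
  unfolding set_integrable_def
proof (rule Bochner_Integration.integrable_bound)
  let ?g = "\<lambda>t. indicator (supp W) t *\<^sub>R (poly p (of_real t) * complex_of_real (weight W t))"
  have int: "integrable lborel ?g"
    using set_integrable_poly_weight[OF W] unfolding set_integrable_def .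
  then show "integrable lborel (\<lambda>t. norm (?g t) * K)"
    by (intro integrable_mult_left integrable_norm)
  have "(\<lambda>t. ?g t * r t) \<in> borel_measurable lborel"
    using borel_measurable_integrable[OF int] r by (intro borel_measurable_times) simp_all
  then show "(\<lambda>t. indicator (supp W) t *\<^sub>R (poly p (of_real t) * complex_of_real (weight W t) * r t))
      \<in> borel_measurable lborel" by (simp add: mult.assoc)
  show "AE t in lborel. norm (indicator (supp W) t *\<^sub>R (poly p (of_real t) * complex_of_real (weight W t) * r t))
      \<le> norm (norm (?g t) * K)"
  proof (rule AE_I2)
    fix t
    show "norm (indicator (supp W) t *\<^sub>R (poly p (of_real t) * complex_of_real (weight W t) * r t))
      \<le> norm (norm (?g t) * K)"
    proof (cases "t \<in> supp W")
      case True
      have "norm (indicator (supp W) t *\<^sub>R (poly p (of_real t) * complex_of_real (weight W t) * r t))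
          = norm (?g t) * norm (r t)" by (simp add: norm_mult)
      also have "\<dots> \<le> norm (?g t) * K" by (rule mult_left_mono[OF K[OF True] norm_ge_zero])
      finally show ?thesis by simp
    qed simp
  qed
qed

lemma supp_distance:
  assumes W: "semiclassical W" and z: "z \<notin> of_real ` supp W"
  obtains d where "d > 0" "\<And>t. t \<in> supp W \<Longrightarrow> d \<le> cmod (of_real t - z)"
proof (cases "Re z \<in> supp W")
  case True
  have "Im z \<noteq> 0"
  proof
    assume "Im z = 0"
    then have "z = of_real (Re z)" by (simp add: complex_eq_iff)
    then show False using True z by blast
  qed
  moreover have "\<bar>Im z\<bar> \<le> cmod (of_real t - z)" for t
    using abs_Im_le_cmod[of "of_real t - z"] by simp
  ultimately show ?thesis by (intro that[of "\<bar>Im z\<bar>"]) simp_all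
next
  case False
  then obtain d where d: "d > 0" "ball (Re z) d \<subseteq> - supp W"
    using closed_supp[OF W] by (meson ComplI open_Compl openE)
  have "d \<le> cmod (of_real t - z)" if "t \<in> supp W" for t
  proof -
    have "t \<notin> ball (Re z) d" using d that by blast
    then have "d \<le> \<bar>t - Re z\<bar>" by (simp add: dist_real_def abs_minus_commute)
    also have "\<dots> \<le> cmod (of_real t - z)" using abs_Re_le_cmod[of "of_real t - z"] by simp
    finally show ?thesis .
  qed
  with d(1) show ?thesis by (rule that)
qed

lemma set_integrable_cauchy:
  assumes W: "semiclassical W" and z: "z \<notin> of_real ` supp W"
  shows "set_integrable lborel (supp W)
     (\<lambda>t. poly p (of_real t) * complex_of_real (weight W t) / (of_real t - z) ^ k)"
proof -
  obtain d where d: "d > 0" "\<And>t. t \<in> supp W \<Longrightarrow> d \<le> cmod (of_real t - z)"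
    using supp_distance[OF W z] by blast
  have "set_integrable lborel (supp W)
     (\<lambda>t. poly p (of_real t) * complex_of_real (weight W t) * (1 / (of_real t - z) ^ k))"
  proof (rule set_integrable_poly_weight_bounded[OF W, where K = "1 / d ^ k"])
    show "(\<lambda>t. 1 / (complex_of_real t - z) ^ k) \<in> borel_measurable borel" by measurable
    show "norm (1 / (complex_of_real t - z) ^ k) \<le> 1 / d ^ k" if "t \<in> supp W" for t
    proof -
      have "0 < d ^ k" "d ^ k \<le> cmod (of_real t - z) ^ k"
        using d that by (auto intro!: power_mono)
      then show ?thesis by (auto simp: norm_divide norm_power intro!: divide_left_mono)
    qed
  qed
  then show ?thesis by simp
qed

text \<open>
  The integrand is the derivative of \<open>A w / (t - z)\<close>, whose boundary values vanish.
\<close>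

lemma pearson_interval:
  assumes W: "semiclassical W" and ab: "(a, b) \<in> intervals W" and z: "z \<notin> of_real ` supp W"
  shows "(LINT t:einterval a b|lborel.
      poly (pderiv (cpolyA W) + cpolyB W) (of_real t) * of_real (weight W t) / (of_real t - z) ^ 1
      - poly (cpolyA W) (of_real t) * of_real (weight W t) / (of_real t - z) ^ 2) = 0"
proof -
  let ?A = "cpolyA W" and ?B = "cpolyB W" and ?w = "\<lambda>t. complex_of_real (weight W t)"
  have lt: "a < b" by (rule semiclassical_interval(1)[OF W ab])
  have sub: "einterval a b \<subseteq> supp W" using ab by (rule einterval_subset_supp)
  have t: "of_real t \<noteq> z" "poly ?A (of_real t) \<noteq> 0" "(weight W has_real_derivative
           poly (polyB W) t / poly (polyA W) t * weight W t) (at t)" if "a < ereal t" "ereal t < b" for t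
  proof -
    have "t \<in> supp W" using that sub by (auto simp: einterval_iff)
    then show "of_real t \<noteq> z" using z by blast
    show "poly ?A (of_real t) \<noteq> 0"
      using semiclassical_interval(4)[OF W ab that] by (simp add: poly_cpolyA_of_real)
  qed (rule weight_has_derivative[OF W ab that])
  have int: "set_integrable lborel (einterval a b)
     (\<lambda>t. poly p (of_real t) * complex_of_real (weight W t) / (of_real t - z) ^ k)" for p k
    by (rule set_integrable_subset[OF set_integrable_cauchy[OF W z] _ sub]) simp
  define F where "F t = poly ?A (of_real t) * ?w t / (of_real t - z)" for t
  have van: "\<exists>\<phi>. set_integrable lborel (einterval a b) \<phi> \<and> (\<forall>t. F t = of_real (t - x) * \<phi> t)"
    if x: "poly (polyA W) x = 0" for x
  proof -
    have "poly ?A (of_real x) = 0" using x by (simp add: poly_cpolyA_of_real)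
    then obtain A1 where A1: "?A = [:- of_real x, 1:] * A1" by (auto simp: poly_eq_0_iff_dvd dvd_def)
    have "poly ?A (of_real t) = of_real (t - x) * poly A1 (of_real t)" for t
      unfolding A1 by (simp add: algebra_simps)
    then show ?thesis using int[of A1 1]
      by (intro exI[of _ "\<lambda>t. poly A1 (of_real t) * ?w t / (of_real t - z)"])
        (simp_all add: F_def)
  qed
  show ?thesis
  proof (rule integral_deriv_eq_zero[OF lt, of F])
    fix t assume ab': "a < ereal t" "ereal t < b"
    have "(?w has_vector_derivative of_real (poly (polyB W) t / poly (polyA W) t * weight W t)) (at t)"
      using t(3)[OF ab'] by (intro has_vector_derivative_of_real)
        (simp add: has_real_derivative_iff_has_vector_derivative)
    moreover have "((\<lambda>t. poly ?A (of_real t) / (of_real t - z)) has_vector_derivative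
        poly (pderiv ?A) (of_real t) / (of_real t - z) - poly ?A (of_real t) / (of_real t - z) ^ 2) (at t)"
    proof (rule has_vector_derivative_real_field)
      have eq: "(a' * u - a * 1) / (u * u) = a' / u - a / u ^ 2" if "u \<noteq> 0" for a a' u :: complex
        using that by (simp add: diff_divide_distrib power2_eq_square)
      have "((\<lambda>x. poly ?A x / (x - z)) has_field_derivative
          (poly (pderiv ?A) (of_real t) * (of_real t - z) - poly ?A (of_real t) * 1) /
          ((of_real t - z) * (of_real t - z))) (at (of_real t))"
        using t(1)[OF ab'] by (intro DERIV_divide poly_DERIV) (auto intro!: derivative_eq_intros)
      then show "((\<lambda>x. poly ?A x / (x - z)) has_field_derivative
          poly (pderiv ?A) (of_real t) / (of_real t - z) - poly ?A (of_real t) / (of_real t - z) ^ 2) (at (of_real t))"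
        using t(1)[OF ab'] by (subst (asm) eq) auto
    qed
    ultimately have "((\<lambda>t. ?w t * (poly ?A (of_real t) / (of_real t - z))) has_vector_derivative
        ?w t * (poly (pderiv ?A) (of_real t) / (of_real t - z) - poly ?A (of_real t) / (of_real t - z) ^ 2)
        + of_real (poly (polyB W) t / poly (polyA W) t * weight W t) * (poly ?A (of_real t) / (of_real t - z))) (at t)"
      by (rule has_vector_derivative_mult)
    also have "?w t * (poly (pderiv ?A) (of_real t) / (of_real t - z) - poly ?A (of_real t) / (of_real t - z) ^ 2)
        + of_real (poly (polyB W) t / poly (polyA W) t * weight W t) * (poly ?A (of_real t) / (of_real t - z)) =
      poly (pderiv ?A + ?B) (of_real t) * ?w t / (of_real t - z) ^ 1
      - poly ?A (of_real t) * ?w t / (of_real t - z) ^ 2"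
    proof -
      have "w * (a' / u - a / u ^ 2) + b / a * w * (a / u) = (a' + b) * w / u - a * w / u ^ 2"
        if "a \<noteq> 0" for w a a' b u :: complex
        using that by (cases "u = 0") (simp_all add: field_simps power2_eq_square)
      from this[OF t(2)[OF ab']] show ?thesis
        by (simp add: poly_cpolyA_of_real poly_cpolyB_of_real)
    qed
    finally show "(F has_vector_derivative poly (pderiv ?A + ?B) (of_real t) * ?w t / (of_real t - z) ^ 1
      - poly ?A (of_real t) * ?w t / (of_real t - z) ^ 2) (at t)"
      unfolding F_def by (simp add: mult.commute mult.left_commute)
    have "isCont ?w t" using DERIV_isCont[OF t(3)[OF ab']] by (intro continuous_intros)
    then show "isCont (\<lambda>t. poly (pderiv ?A + ?B) (of_real t) * ?w t / (of_real t - z) ^ 1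
      - poly ?A (of_real t) * ?w t / (of_real t - z) ^ 2) t"
      using t(1)[OF ab'] DERIV_isCont[OF t(3)[OF ab']] by (intro continuous_intros) auto
  next
    show "set_integrable lborel (einterval a b) (\<lambda>t. poly (pderiv ?A + ?B) (of_real t) * ?w t / (of_real t - z) ^ 1
      - poly ?A (of_real t) * ?w t / (of_real t - z) ^ 2)"
      by (intro set_integral_diff int)
    have F: "set_integrable lborel (einterval a b) F" using int[of ?A 1] by (simp add: F_def[abs_def])
    show "vanishing_left a b F"
      using semiclassical_interval(2)[OF W ab] F van unfolding vanishing_left_def by blast
    show "vanishing_right a b F"
      using semiclassical_interval(3)[OF W ab] F van unfolding vanishing_right_def by blast
  qed
qed

lemma pearson_integral:
  assumes W: "semiclassical W" and z: "z \<notin> of_real ` supp W"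
  shows "(LINT t:supp W|lborel.
      poly (pderiv (cpolyA W) + cpolyB W) (of_real t) * of_real (weight W t) / (of_real t - z) ^ 1
      - poly (cpolyA W) (of_real t) * of_real (weight W t) / (of_real t - z) ^ 2) = 0"
    (is "(LINT t:supp W|lborel. ?f t) = 0")
proof -
  have int: "set_integrable lborel (supp W) ?f"
    by (intro set_integral_diff set_integrable_cauchy W z)
  have "(LINT t:supp W|lborel. ?f t) = (LINT t:inner_supp W|lborel. ?f t)"
  proof (rule set_integral_discrete_difference[where X = "endpoints W"])
    show "countable (endpoints W)" using finite_endpoints[OF W] by (rule countable_finite)
    show "sym_diff (supp W) (inner_supp W) \<subseteq> endpoints W"
      using inner_supp_subset[of W] supp_subset_inner[of W] by blast
  qed auto
  also have "\<dots> = (\<Sum>p\<in>intervals W. LINT t:einterval (fst p) (snd p)|lborel. ?f t)"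
    unfolding inner_supp_def
  proof (rule set_integral_finite_UN_AE[OF finite_intervals[OF W]])
    fix p q assume pq: "p \<in> intervals W" "q \<in> intervals W"
    have "p = q" if x: "x \<in> einterval (fst p) (snd p)" "x \<in> einterval (fst q) (snd q)" for x
    proof (rule ccontr)
      assume "p \<noteq> q"
      have "\<forall>(a, b) \<in> intervals W. \<forall>(c, d) \<in> intervals W.
        (a, b) \<noteq> (c, d) \<longrightarrow> {a<..<b} \<inter> {c<..<d} = {}"
        using W[unfolded semiclassical_def] by (elim conjE)
      from bspec[OF this pq(1)] have "\<forall>(c, d) \<in> intervals W.
        p \<noteq> (c, d) \<longrightarrow> {fst p<..<snd p} \<inter> {c<..<d} = {}" by (simp only: case_prod_unfold prod.collapse)
      from bspec[OF this pq(2)] \<open>p \<noteq> q\<close> have "{fst p<..<snd p} \<inter> {fst q<..<snd q} = {}"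
        by (simp only: case_prod_unfold prod.collapse simp_thms)
      moreover have "ereal x \<in> {fst p<..<snd p} \<inter> {fst q<..<snd q}"
        using x by (simp add: einterval_iff)
      ultimately show False by blast
    qed
    then show "AE x in lborel. x \<in> einterval (fst p) (snd p) \<and> x \<in> einterval (fst q) (snd q) \<longrightarrow> p = q"
      by blast
  next
    fix p assume p: "p \<in> intervals W"
    show "set_integrable lborel (einterval (fst p) (snd p)) ?f"
      by (rule set_integrable_subset[OF int]) (use p inner_supp_subset[of W] in \<open>auto simp: inner_supp_def\<close>)
  qed simp
  also have "\<dots> = 0"
    by (intro sum.neutral ballI pearson_interval[OF W _ z]) simp
  finally show ?thesis .
qed

section \<open>Cauchy transforms and their differential equation\<close>

text \<open>
  Polynomials in two variables \<open>t\<close> and \<open>z\<close> are polynomials in \<open>t\<close> with coefficients that are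
  polynomials in \<open>z\<close>. A polynomial in \<open>t\<close> alone is lifted with constant coefficients; a polynomial
  \<open>p\<close> in \<open>z\<close> alone is \<open>[:p:]\<close>, and \<open>[:- [:0, 1:], 1:]\<close> is \<open>t - z\<close>.
\<close>

definition lift_poly :: "complex poly \<Rightarrow> complex poly poly" where
  "lift_poly p = map_poly (\<lambda>c. [:c:]) p"

definition eval2 :: "complex poly poly \<Rightarrow> complex \<Rightarrow> complex \<Rightarrow> complex" where
  "eval2 G t z = poly (poly G [:t:]) z"

lemma eval2_simps [simp]:
  "eval2 (G + G') t z = eval2 G t z + eval2 G' t z"
  "eval2 (G - G') t z = eval2 G t z - eval2 G' t z"
  "eval2 (G * G') t z = eval2 G t z * eval2 G' t z"
  "eval2 [:p:] t z = poly p z"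
  "eval2 [:- [:0, 1:], 1:] t z = t - z"
  by (simp_all add: eval2_def)

lemma coeff_lift_poly [simp]: "coeff (lift_poly p) n = [:coeff p n:]"
  by (simp add: lift_poly_def coeff_map_poly)

lemma lift_poly_pCons: "lift_poly (pCons a p) = pCons [:a:] (lift_poly p)"
  by (rule poly_eqI) (simp add: coeff_pCons split: nat.splits)

lemma lift_poly_0 [simp]: "lift_poly 0 = 0"
  by (simp add: lift_poly_def)

lemma eval2_lift_poly [simp]: "eval2 (lift_poly p) t z = poly p t"
proof -
  have "poly (lift_poly p) [:t:] = [:poly p t:]"
    by (induction p) (simp_all add: lift_poly_pCons)
  then show ?thesis by (simp add: eval2_def)
qed

lemma poly_lift_poly_diagonal [simp]: "poly (lift_poly p) [:0, 1:] = p"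
  by (induction p) (simp_all add: lift_poly_pCons)

lemma pderiv_lift_poly: "pderiv (lift_poly p) = lift_poly (pderiv p)"
  by (rule poly_eqI) (simp add: coeff_pderiv of_nat_poly)

text \<open>
  The left-hand side vanishes at \<open>t = z\<close>, and the coefficient ring is an integral domain.
\<close>

lemma divided_difference:
  "\<exists>G. lift_poly p - [:p:] = [:- [:0, 1:], 1:] * G"
proof -
  have "poly (lift_poly p - [:p:]) [:0, 1:] = 0" by simp
  then show ?thesis unfolding poly_eq_0_iff_dvd dvd_def .
qed

text \<open>
  The numerator left over in the integration by parts has a double zero at \<open>t = z\<close>: the quotient
  of \<open>A(t) - A(z)\<close> by \<open>t - z\<close> takes the value \<open>A'(z)\<close> on the diagonal.
\<close>

lemma divided_difference_pearson:
  "\<exists>G. \<forall>t z. poly A z - poly A t + (t - z) * poly (pderiv A) t + (t - z) * (poly B t - poly B z)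
     = (t - z) ^ 2 * eval2 G t z"
proof -
  let ?L = "[:- [:0, 1:], 1:] :: complex poly poly"
  obtain GA where GA: "lift_poly A - [:A:] = ?L * GA" using divided_difference by blast
  obtain GB where GB: "lift_poly B - [:B:] = ?L * GB" using divided_difference by blast
  have "pderiv (lift_poly A - [:A:]) = GA + ?L * pderiv GA"
    unfolding GA pderiv_mult by (simp add: pderiv_pCons)
  then have "lift_poly (pderiv A) = GA + ?L * pderiv GA"
    by (simp add: pderiv_diff pderiv_lift_poly pderiv_pCons)
  then have "eval2 (lift_poly (pderiv A)) t z = eval2 (GA + ?L * pderiv GA) t z" for t z by simp
  then have 1: "poly (pderiv A) t = eval2 GA t z + (t - z) * eval2 (pderiv GA) t z" for t z
    by (simp only: eval2_simps eval2_lift_poly)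
  have "eval2 (lift_poly A - [:A:]) t z = eval2 (?L * GA) t z" for t z using GA by simp
  then have 2: "poly A t - poly A z = (t - z) * eval2 GA t z" for t z
    by (simp only: eval2_simps eval2_lift_poly)
  have "eval2 (lift_poly B - [:B:]) t z = eval2 (?L * GB) t z" for t z using GB by simp
  then have 3: "poly B t - poly B z = (t - z) * eval2 GB t z" for t z
    by (simp only: eval2_simps eval2_lift_poly)
  show ?thesis
  proof (intro exI allI)
    fix t z
    have "poly A z - poly A t + (t - z) * poly (pderiv A) t + (t - z) * (poly B t - poly B z) =
      - (poly A t - poly A z) + (t - z) * poly (pderiv A) t + (t - z) * (poly B t - poly B z)" by simp
    also have "\<dots> = - ((t - z) * eval2 GA t z) + (t - z) * (eval2 GA t z + (t - z) * eval2 (pderiv GA) t z)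
       + (t - z) * ((t - z) * eval2 GB t z)"
      by (simp only: 1[of t z] 2[of t z] 3[of t z])
    also have "\<dots> = (t - z) ^ 2 * eval2 (pderiv GA + GB) t z"
      by (simp add: algebra_simps power2_eq_square)
    finally show "poly A z - poly A t + (t - z) * poly (pderiv A) t + (t - z) * (poly B t - poly B z)
      = (t - z) ^ 2 * eval2 (pderiv GA + GB) t z" .
  qed
qed

lemma eval2_altdef: "eval2 G t z = (\<Sum>i\<le>degree G. poly (coeff G i) z * t ^ i)"
  by (simp add: eval2_def poly_altdef[of G] poly_sum)

text \<open>
  Integrating out \<open>t\<close> replaces its powers by moments and leaves a polynomial in \<open>z\<close>.
\<close>

lemma eval2_integral:
  assumes W: "semiclassical W"
  shows "set_integrable lborel (supp W) (\<lambda>t. eval2 G (of_real t) z * of_real (weight W t))"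
    and "\<exists>K. \<forall>z. (LINT t:supp W|lborel. eval2 G (of_real t) z * of_real (weight W t)) = poly K z"
proof -
  have eq: "eval2 G (of_real t) z * of_real (weight W t) =
      (\<Sum>i\<le>degree G. poly (coeff G i) z * complex_of_real (t ^ i * weight W t))" for t z
    by (simp add: eval2_altdef sum_distrib_right mult.assoc)
  have int: "set_integrable lborel (supp W) (\<lambda>t. poly (coeff G i) z * complex_of_real (t ^ i * weight W t))" for i z
    by (intro set_integrable_mult_right set_integrable_monom_weight W)
  show "set_integrable lborel (supp W) (\<lambda>t. eval2 G (of_real t) z * of_real (weight W t))"
    unfolding eq using int unfolding set_integrable_def scaleR_sum_right
    by (intro Bochner_Integration.integrable_sum) blast
  define m where "m i = (LINT t:supp W|lborel. complex_of_real (t ^ i * weight W t))" for i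
  have "(LINT t:supp W|lborel. eval2 G (of_real t) z * of_real (weight W t)) =
      poly (\<Sum>i\<le>degree G. Polynomial.smult (m i) (coeff G i)) z" for z
  proof -
    have "(LINT t:supp W|lborel. eval2 G (of_real t) z * of_real (weight W t)) =
        (\<Sum>i\<le>degree G. LINT t:supp W|lborel. poly (coeff G i) z * complex_of_real (t ^ i * weight W t))"
      unfolding eq using int unfolding set_integrable_def set_lebesgue_integral_def scaleR_sum_right
      by (intro Bochner_Integration.integral_sum) blast
    also have "\<dots> = (\<Sum>i\<le>degree G. poly (coeff G i) z * m i)"
      unfolding m_def by (simp only: set_integral_mult_right)
    finally show ?thesis by (simp add: poly_sum mult.commute)
  qed
  then show "\<exists>K. \<forall>z. (LINT t:supp W|lborel. eval2 G (of_real t) z * of_real (weight W t)) = poly K z"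
    by blast
qed

lemma open_off_supp:
  assumes "semiclassical W"
  shows "open (- complex_of_real ` supp W)"
proof (rule openI)
  fix z :: complex assume "z \<in> - of_real ` supp W"
  then obtain d where d: "d > 0" "\<And>t. t \<in> supp W \<Longrightarrow> d \<le> cmod (of_real t - z)"
    using supp_distance[OF assms, of z] by blast
  then have "ball z d \<subseteq> - of_real ` supp W"
    by (fastforce simp: dist_norm norm_minus_commute)
  with d(1) show "\<exists>e>0. ball z e \<subseteq> - of_real ` supp W" by blast
qed

text \<open>
  \<open>P(t)\<close> is split into \<open>P(z)\<close> and a multiple of \<open>t - z\<close>, which cancels the denominator.
\<close>

lemma cauchy_transform_decomposition:
  assumes W: "semiclassical W"
  shows "\<exists>Q. \<forall>z. z \<notin> of_real ` supp W \<longrightarrow>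
     cauchy_transform W (poly P) z = poly P z * cauchy_transform W (\<lambda>_. 1) z + poly Q z"
proof -
  obtain G where "lift_poly P - [:P:] = [:- [:0, 1:], 1:] * G" using divided_difference by blast
  then have "eval2 (lift_poly P - [:P:]) t z = eval2 ([:- [:0, 1:], 1:] * G) t z" for t z by simp
  then have "poly P t - poly P z = (t - z) * eval2 G t z" for t z
    by (simp only: eval2_simps eval2_lift_poly)
  then have G: "poly P t = poly P z + (t - z) * eval2 G t z" for t z
    by (simp add: diff_eq_eq add.commute)
  obtain Q where Q: "\<And>z. (LINT t:supp W|lborel. eval2 G (of_real t) z * of_real (weight W t)) = poly Q z"
    using eval2_integral(2)[OF W] by blast
  have "cauchy_transform W (poly P) z = poly P z * cauchy_transform W (\<lambda>_. 1) z + poly Q z"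
    if z: "z \<notin> of_real ` supp W" for z
  proof -
    have int: "set_integrable lborel (supp W) (\<lambda>t. 1 * of_real (weight W t) / (of_real t - z))"
      using set_integrable_cauchy[OF W z, of 1 1] by simp
    have "cauchy_transform W (poly P) z =
      (LINT t:supp W|lborel. poly P z * (1 * of_real (weight W t) / (of_real t - z))
         + eval2 G (of_real t) z * of_real (weight W t))"
      unfolding cauchy_transform_def
    proof (rule set_lebesgue_integral_cong)
      show "\<forall>t. t \<in> supp W \<longrightarrow> poly P (of_real t) * of_real (weight W t) / (of_real t - z) =
        poly P z * (1 * of_real (weight W t) / (of_real t - z)) + eval2 G (of_real t) z * of_real (weight W t)"
      proof (intro allI impI)
        fix t assume "t \<in> supp W"
        then have ne: "of_real t - z \<noteq> 0" using z by auto
        have "(p + u * g) * w / u = p * (1 * w / u) + g * w" if "u \<noteq> 0" for p u g w :: complex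
          using that by (simp add: field_simps)
        from this[OF ne]
        show "poly P (of_real t) * of_real (weight W t) / (of_real t - z) =
          poly P z * (1 * of_real (weight W t) / (of_real t - z)) + eval2 G (of_real t) z * of_real (weight W t)"
          unfolding G[of "of_real t" z] .
      qed
    qed (simp add: closed_supp[OF W] borel_closed)
    also have "\<dots> = poly P z * cauchy_transform W (\<lambda>_. 1) z + poly Q z"
      unfolding Q[symmetric] cauchy_transform_def
      by (subst set_integral_add(2)) (simp_all only: set_integral_mult_right set_integrable_mult_right int eval2_integral(1)[OF W])
    finally show ?thesis .
  qed
  then show ?thesis by blast
qed

text \<open>
  Differentiation under the integral sign, by a direct estimate of the difference quotient:
  the integrand of the error is of order \<open>z' - z\<close> since \<open>t\<close> stays at distance at least \<open>d\<close> from \<open>z\<close>.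
\<close>

lemma cauchy_transform_one_deriv:
  assumes W: "semiclassical W" and z: "z \<notin> of_real ` supp W"
  shows "(cauchy_transform W (\<lambda>_. 1) has_field_derivative
     (LINT t:supp W|lborel. of_real (weight W t) / (of_real t - z) ^ 2)) (at z)"
proof -
  let ?w = "\<lambda>t. complex_of_real (weight W t)" and ?H = "cauchy_transform W (\<lambda>_. 1)"
  let ?T = "LINT t:supp W|lborel. ?w t / (of_real t - z) ^ 2"
  obtain d where d: "d > 0" "\<And>t. t \<in> supp W \<Longrightarrow> d \<le> cmod (of_real t - z)"
    using supp_distance[OF W z] by blast
  define K where "K = (LINT t:supp W|lborel. norm (?w t) * (1 / (d ^ 2 * (d / 2))))"
  have bound: "norm ((?H z' - ?H z) / (z' - z) - ?T) \<le> K * norm (z' - z)"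
    if z': "z' \<noteq> z" "dist z' z < d / 2" for z'
  proof -
    have far: "d / 2 \<le> cmod (of_real t - z')" if "t \<in> supp W" for t
    proof -
      have "cmod (of_real t - z) \<le> cmod (of_real t - z') + cmod (z' - z)"
        using norm_triangle_ineq[of "of_real t - z'" "z' - z"] by simp
      then show ?thesis using d(2)[OF that] z'(2) by (simp add: dist_norm)
    qed
    have z'off: "z' \<notin> of_real ` supp W" using far d(1) by fastforce
    define r where "r t = 1 / ((complex_of_real t - z) ^ 2 * (of_real t - z'))" for t
    have rb: "norm (r t) \<le> 1 / (d ^ 2 * (d / 2))" if "t \<in> supp W" for t
    proof -
      have "d ^ 2 * (d / 2) \<le> cmod (of_real t - z) ^ 2 * cmod (of_real t - z')"
        using d(1) d(2)[OF that] far[OF that] by (intro mult_mono power_mono) auto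
      moreover have "0 < d ^ 2 * (d / 2)" using d(1) by simp
      ultimately show ?thesis unfolding r_def norm_divide norm_mult norm_power norm_one
        by (intro divide_left_mono) auto
    qed
    have rint: "set_integrable lborel (supp W) (\<lambda>t. ?w t * r t)"
      using set_integrable_poly_weight_bounded[OF W _ rb, where p = 1] unfolding r_def by simp
    have int1: "set_integrable lborel (supp W) (\<lambda>t. ?w t / (of_real t - u))"
      if "u \<notin> of_real ` supp W" for u
      using set_integrable_cauchy[OF W that, of 1 1] by simp
    have int2: "set_integrable lborel (supp W) (\<lambda>t. ?w t / (of_real t - z) ^ 2)"
      using set_integrable_cauchy[OF W z, of 1 2] by simp
    have "?H z' - ?H z - (z' - z) * ?T =
        (LINT t:supp W|lborel. ?w t / (of_real t - z') - ?w t / (of_real t - z) - (z' - z) * (?w t / (of_real t - z) ^ 2))"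
      unfolding cauchy_transform_def
      by (simp only: set_integral_diff set_integral_mult_right set_integrable_mult_right
          int1[OF z'off] int1[OF z] int2 mult_1)
    also have "\<dots> = (LINT t:supp W|lborel. (z' - z) ^ 2 * (?w t * r t))"
    proof (rule set_lebesgue_integral_cong)
      show "\<forall>t. t \<in> supp W \<longrightarrow> ?w t / (of_real t - z') - ?w t / (of_real t - z) - (z' - z) * (?w t / (of_real t - z) ^ 2)
          = (z' - z) ^ 2 * (?w t * r t)"
      proof (intro allI impI)
        fix t assume "t \<in> supp W"
        then have ne: "of_real t - z' \<noteq> 0" "of_real t - z \<noteq> 0" using z z'off by auto
        have "a / x - a / y - (y - x) * (a / y ^ 2) = (y - x) ^ 2 * (a * (1 / (y ^ 2 * x)))"
          if "x \<noteq> 0" "y \<noteq> 0" for a x y :: complex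
          using that by (simp add: field_simps power2_eq_square)
        from this[OF ne, of "?w t"]
        show "?w t / (of_real t - z') - ?w t / (of_real t - z) - (z' - z) * (?w t / (of_real t - z) ^ 2)
          = (z' - z) ^ 2 * (?w t * r t)" unfolding r_def by simp
      qed
    qed (simp add: closed_supp[OF W] borel_closed)
    also have "\<dots> = (z' - z) ^ 2 * (LINT t:supp W|lborel. ?w t * r t)"
      by (rule set_integral_mult_right)
    finally have "(?H z' - ?H z) / (z' - z) - ?T = (z' - z) * (LINT t:supp W|lborel. ?w t * r t)"
      using z'(1) by (simp add: field_simps power2_eq_square)
    moreover have "norm (LINT t:supp W|lborel. ?w t * r t) \<le> K"
      unfolding K_def set_lebesgue_integral_def
    proof (rule Bochner_Integration.integral_norm_bound_integral)
      show "integrable lborel (\<lambda>t. indicator (supp W) t *\<^sub>R (?w t * r t))"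
        using rint unfolding set_integrable_def .
      have "integrable lborel (\<lambda>t. norm (indicator (supp W) t *\<^sub>R ?w t))"
        using set_integrable_poly_weight[OF W, of 1] unfolding set_integrable_def by (intro integrable_norm) simp
      then have "integrable lborel (\<lambda>t. norm (indicator (supp W) t *\<^sub>R ?w t) * (1 / (d ^ 2 * (d / 2))))"
        by (rule integrable_mult_left)
      moreover have "norm (indicator (supp W) t *\<^sub>R ?w t) * (1 / (d ^ 2 * (d / 2))) =
          indicator (supp W) t *\<^sub>R (norm (?w t) * (1 / (d ^ 2 * (d / 2))))" for t by simp
      ultimately show "integrable lborel (\<lambda>t. indicator (supp W) t *\<^sub>R (norm (?w t) * (1 / (d ^ 2 * (d / 2)))))"
        by (simp only:)
      show "norm (indicator (supp W) t *\<^sub>R (?w t * r t)) \<le> indicator (supp W) t *\<^sub>R (norm (?w t) * (1 / (d ^ 2 * (d / 2))))" for t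
      proof (cases "t \<in> supp W")
        case True
        then show ?thesis using mult_left_mono[OF rb[OF True], of "norm (?w t)"] by (simp add: norm_mult)
      qed simp
    qed
    ultimately show ?thesis
      by (simp only: norm_mult mult.commute[of K] mult_left_mono norm_ge_zero)
  qed
  have "((\<lambda>z'. (?H z' - ?H z) / (z' - z) - ?T) \<longlongrightarrow> 0) (at z)"
  proof (rule Lim_null_comparison)
    show "\<forall>\<^sub>F z' in at z. norm ((?H z' - ?H z) / (z' - z) - ?T) \<le> K * norm (z' - z)"
      unfolding eventually_at using bound d(1) by (intro exI[of _ "d / 2"]) auto
    show "((\<lambda>z'. K * norm (z' - z)) \<longlongrightarrow> 0) (at z)"
      by (auto intro!: tendsto_eq_intros)
  qed
  then show ?thesis
    unfolding has_field_derivative_iff by (rule LIM_zero_cancel)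
qed

text \<open>
  In \<open>A(z) H'(z) - B(z) H(z)\<close> the vanishing integral of \<open>pearson_integral\<close> can be added, after which
  the denominator \<open>(t - z)\<^sup>2\<close> divides the numerator.
\<close>

lemma cauchy_transform_one_ode:
  assumes W: "semiclassical W"
  shows "\<exists>K. \<forall>z. z \<notin> of_real ` supp W \<longrightarrow>
     poly (cpolyA W) z * (LINT t:supp W|lborel. of_real (weight W t) / (of_real t - z) ^ 2) =
     poly (cpolyB W) z * cauchy_transform W (\<lambda>_. 1) z + poly K z"
proof -
  let ?w = "\<lambda>t. complex_of_real (weight W t)" and ?A = "cpolyA W" and ?B = "cpolyB W"
  obtain G where G: "\<And>t z. poly ?A z - poly ?A t + (t - z) * poly (pderiv ?A) t + (t - z) * (poly ?B t - poly ?B z)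
     = (t - z) ^ 2 * eval2 G t z"
    using divided_difference_pearson by blast
  obtain K where K: "\<And>z. (LINT t:supp W|lborel. eval2 G (of_real t) z * ?w t) = poly K z"
    using eval2_integral(2)[OF W] by blast
  have "poly ?A z * (LINT t:supp W|lborel. ?w t / (of_real t - z) ^ 2) =
     poly ?B z * cauchy_transform W (\<lambda>_. 1) z + poly K z" if z: "z \<notin> of_real ` supp W" for z
  proof -
    let ?f = "\<lambda>t. poly (pderiv ?A + ?B) (of_real t) * ?w t / (of_real t - z) ^ 1
      - poly ?A (of_real t) * ?w t / (of_real t - z) ^ 2"
    have int1: "set_integrable lborel (supp W) (\<lambda>t. ?w t / (of_real t - z))"
      using set_integrable_cauchy[OF W z, of 1 1] by simp
    have int2: "set_integrable lborel (supp W) (\<lambda>t. ?w t / (of_real t - z) ^ 2)"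
      using set_integrable_cauchy[OF W z, of 1 2] by simp
    have int3: "set_integrable lborel (supp W) ?f"
      by (intro set_integral_diff set_integrable_cauchy W z)
    have "poly K z = (LINT t:supp W|lborel. poly ?A z * (?w t / (of_real t - z) ^ 2)
        - poly ?B z * (?w t / (of_real t - z)) + ?f t)"
      unfolding K[symmetric]
    proof (rule set_lebesgue_integral_cong)
      show "\<forall>t. t \<in> supp W \<longrightarrow> eval2 G (of_real t) z * ?w t = poly ?A z * (?w t / (of_real t - z) ^ 2)
        - poly ?B z * (?w t / (of_real t - z)) + ?f t"
      proof (intro allI impI)
        fix t assume "t \<in> supp W"
        then have ne: "of_real t - z \<noteq> 0" using z by auto
        have "g * w = az * (w / u ^ 2) - bz * (w / u) + ((a' + b) * w / u ^ 1 - a * w / u ^ 2)"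
          if "u \<noteq> 0" "az - a + u * a' + u * (b - bz) = u ^ 2 * g" for g w az u bz a' b a :: complex
        proof -
          have "az * (w / u ^ 2) - bz * (w / u) + ((a' + b) * w / u ^ 1 - a * w / u ^ 2) =
              (az - a + u * a' + u * (b - bz)) * w / u ^ 2"
            using that(1) by (simp add: field_simps power2_eq_square)
          also have "\<dots> = g * w" unfolding that(2) using that(1) by simp
          finally show ?thesis by simp
        qed
        from this[OF ne G]
        show "eval2 G (of_real t) z * ?w t = poly ?A z * (?w t / (of_real t - z) ^ 2)
          - poly ?B z * (?w t / (of_real t - z)) + ?f t" by simp
      qed
    qed (simp add: closed_supp[OF W] borel_closed)
    also have "\<dots> = (LINT t:supp W|lborel. poly ?A z * (?w t / (of_real t - z) ^ 2)
        - poly ?B z * (?w t / (of_real t - z))) + (LINT t:supp W|lborel. ?f t)"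
      by (intro set_integral_add set_integral_diff set_integrable_mult_right int1 int2 int3)
    also have "(LINT t:supp W|lborel. ?f t) = 0" by (rule pearson_integral[OF W z])
    also have "(LINT t:supp W|lborel. poly ?A z * (?w t / (of_real t - z) ^ 2)
        - poly ?B z * (?w t / (of_real t - z))) =
       poly ?A z * (LINT t:supp W|lborel. ?w t / (of_real t - z) ^ 2)
       - poly ?B z * (LINT t:supp W|lborel. ?w t / (of_real t - z))"
      by (subst set_integral_diff(2)) (simp_all only: set_integrable_mult_right int1 int2 set_integral_mult_right)
    finally show ?thesis by (simp add: cauchy_transform_def algebra_simps)
  qed
  then show ?thesis by blast
qed

section \<open>Determinants and the polynomials behind the Wronskians\<close>

text \<open>
  If \<open>A H' = B H + K\<close> and \<open>q = (P H + Q)/w\<close>, then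
  \<open>A w q' = A P' H + reduced1\<close> and \<open>A\<^sup>2 w q'' = A\<^sup>2 P'' H + reduced2\<close>. So the two polynomials are what
  remains of the scaled derivatives of \<open>q\<close> modulo \<open>H\<close> times the derivatives of \<open>P\<close>.
\<close>

definition reduced1 :: "complex poly \<Rightarrow> complex poly \<Rightarrow> complex poly \<Rightarrow> complex poly \<Rightarrow> complex poly \<Rightarrow> complex poly" where
  "reduced1 A B K P Q = P * K + A * pderiv Q - B * Q"

definition reduced2 :: "complex poly \<Rightarrow> complex poly \<Rightarrow> complex poly \<Rightarrow> complex poly \<Rightarrow> complex poly \<Rightarrow> complex poly" where
  "reduced2 A B K P Q = A * pderiv P * K + A * pderiv (reduced1 A B K P Q)
     - (pderiv A + B) * reduced1 A B K P Q"

definition partner_poly :: "complex poly \<Rightarrow> complex poly \<Rightarrow> complex poly \<Rightarrow> complex poly \<Rightarrow> complex poly \<Rightarrow> complex poly" where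
  "partner_poly A B K P Q = P * reduced1 A B K P Q - A * pderiv P * Q"

text \<open>
  The determinant with the columns \<open>(p0, p1, p2)\<close>, \<open>(a0, a1, a2)\<close>, \<open>(b0, b1, b2)\<close>, expanded along the
  first column, over any commutative ring: both the polynomials and their values are needed.
\<close>

definition det3 :: "'a::comm_ring_1 \<Rightarrow> 'a \<Rightarrow> 'a \<Rightarrow> 'a \<Rightarrow> 'a \<Rightarrow> 'a \<Rightarrow> 'a \<Rightarrow> 'a \<Rightarrow> 'a \<Rightarrow> 'a" where
  "det3 p0 p1 p2 a0 a1 a2 b0 b1 b2 =
     p0 * (a1 * b2 - b1 * a2) - p1 * (a0 * b2 - b0 * a2) + p2 * (a0 * b1 - b0 * a1)"

lemma det3_column_ops:
  "det3 p0 p1 p2 (p0 * h + a0) (p1 * h + a1) (p2 * h + a2) (p0 * k + b0) (p1 * k + b1) (p2 * k + b2) =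
   det3 p0 p1 p2 a0 a1 a2 b0 b1 b2"
  unfolding det3_def by (simp add: algebra_simps)

lemma det3_scale:
  "det3 p0 p1 p2 (c * a0) (c * a1) (c * a2) (d * b0) (d * b1) (d * b2) =
   c * d * det3 p0 p1 p2 a0 a1 a2 b0 b1 b2"
  unfolding det3_def by (simp add: algebra_simps)

text \<open>
  Condensation with pivot \<open>p0\<close>. For a Wronskian this is the classical identity
  \<open>f W[f, g, h] = W[W[f, g], W[f, h]]\<close>.
\<close>

lemma det3_condensation:
  "p0 * det3 p0 p1 p2 a0 a1 a2 b0 b1 b2 =
   (p0 * a1 - p1 * a0) * (p0 * b2 - p2 * b0) - (p0 * b1 - p1 * b0) * (p0 * a2 - p2 * a0)"
  unfolding det3_def by (simp add: algebra_simps)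

lemma poly_det3:
  "poly (det3 p0 p1 p2 a0 a1 a2 b0 b1 b2) z =
   det3 (poly p0 z) (poly p1 z) (poly p2 z) (poly a0 z) (poly a1 z) (poly a2 z) (poly b0 z) (poly b1 z) (poly b2 z)"
  unfolding det3_def by simp

text \<open>
  Each of the last two columns is the column of \<open>q\<close>, \<open>q'\<close>, \<open>q''\<close>, scaled by \<open>A\<^sup>2 w\<close>, with
  the multiple \<open>A\<^sup>2 H\<close> of the first column removed.
\<close>

definition R_poly :: "complex poly \<Rightarrow> complex poly \<Rightarrow> complex poly \<Rightarrow> complex poly \<Rightarrow> complex poly \<Rightarrow>
    complex poly \<Rightarrow> complex poly \<Rightarrow> complex poly \<Rightarrow> complex poly \<Rightarrow> complex poly" where
  "R_poly P A1 B1 K1 Q1 A2 B2 K2 Q2 =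
     det3 P (pderiv P) (pderiv (pderiv P))
       (A1 ^ 2 * Q1) (A1 * reduced1 A1 B1 K1 P Q1) (reduced2 A1 B1 K1 P Q1)
       (A2 ^ 2 * Q2) (A2 * reduced1 A2 B2 K2 P Q2) (reduced2 A2 B2 K2 P Q2)"

lemma R_poly_swap: "R_poly P A2 B2 K2 Q2 A1 B1 K1 Q1 = - R_poly P A1 B1 K1 Q1 A2 B2 K2 Q2"
  unfolding R_poly_def det3_def by (simp add: algebra_simps)

text \<open>
  For \<open>S = v W[P, q]\<close> the left-hand side is \<open>A v\<close> times the derivative of \<open>W[P, q] = S/v\<close>, which is
  \<open>P q'' - P'' q\<close>.
\<close>

lemma partner_poly_ode:
  "A * pderiv (partner_poly A B K P Q) - (pderiv A + B) * partner_poly A B K P Q =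
   P * reduced2 A B K P Q - A ^ 2 * pderiv (pderiv P) * Q"
proof -
  define g where "g = reduced1 A B K P Q"
  have g: "P * K = g - A * pderiv Q + B * Q" by (simp add: g_def reduced1_def)
  have "A * pderiv (partner_poly A B K P Q) - (pderiv A + B) * partner_poly A B K P Q
      - (P * (A * pderiv P * K + A * pderiv g - (pderiv A + B) * g) - A ^ 2 * pderiv (pderiv P) * Q) =
      A * pderiv P * (g - A * pderiv Q + B * Q - P * K)"
    unfolding partner_poly_def g_def[symmetric]
    by (simp add: pderiv_mult pderiv_diff algebra_simps power2_eq_square)
  also have "\<dots> = 0" unfolding g by simp
  finally show ?thesis unfolding reduced2_def g_def[symmetric] by simp
qed

lemma R_poly_partner:
  assumes S1: "S1 = partner_poly A1 B1 K1 P Q1" and S2: "S2 = partner_poly A2 B2 K2 P Q2"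
  shows "P * R_poly P A1 B1 K1 Q1 A2 B2 K2 Q2 =
    A1 * A2 * (S1 * pderiv S2 - S2 * pderiv S1)
    + S1 * S2 * ((pderiv A1 + B1) * A2 - (pderiv A2 + B2) * A1)"
proof -
  have "A1 * A2 * (S1 * pderiv S2 - S2 * pderiv S1)
    + S1 * S2 * ((pderiv A1 + B1) * A2 - (pderiv A2 + B2) * A1) =
    (A1 * S1) * (A2 * pderiv S2 - (pderiv A2 + B2) * S2) - (A2 * S2) * (A1 * pderiv S1 - (pderiv A1 + B1) * S1)"
    by (simp add: algebra_simps)
  also have "\<dots> = P * R_poly P A1 B1 K1 Q1 A2 B2 K2 Q2"
    unfolding R_poly_def det3_condensation S1 S2 partner_poly_ode
    by (simp add: partner_poly_def algebra_simps power2_eq_square)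
  finally show ?thesis by simp
qed

text \<open>
  The second equation is the equilibrium condition at a zero of \<open>P\<close>. By the first one, \<open>A\<close> cannot
  vanish at a zero of \<open>P\<close> that is not shared with \<open>S\<close>.
\<close>

lemma partner_poly_at_zero:
  assumes "poly P z = 0" and S: "S = partner_poly A B K P Q"
  shows "poly S z = - poly A z * poly (pderiv P) z * poly Q z"
    and "poly (pderiv P) z * (poly A z * poly (pderiv S) z - poly (pderiv A + B) z * poly S z) =
         poly A z * poly (pderiv (pderiv P)) z * poly S z"
proof -
  show 1: "poly S z = - poly A z * poly (pderiv P) z * poly Q z"
    using assms by (simp add: partner_poly_def)
  have "poly (A * pderiv S - (pderiv A + B) * S) z = poly (P * reduced2 A B K P Q - A ^ 2 * pderiv (pderiv P) * Q) z"
    unfolding S partner_poly_ode ..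
  then have "poly A z * poly (pderiv S) z - poly (pderiv A + B) z * poly S z =
     - (poly A z ^ 2 * poly (pderiv (pderiv P)) z * poly Q z)"
    using assms(1) by simp
  then show "poly (pderiv P) z * (poly A z * poly (pderiv S) z - poly (pderiv A + B) z * poly S z) =
         poly A z * poly (pderiv (pderiv P)) z * poly S z"
    unfolding 1 by (simp add: power2_eq_square)
qed

lemma det_mat_2: "Determinant.det (Matrix.mat 2 2 f) = f (0, 0) * f (1, 1) - f (0, 1) * f (1, 0)"
  for f :: "nat \<times> nat \<Rightarrow> complex"
proof -
  have "Determinant.det (Matrix.mat 2 2 f) =
     (\<Sum>j<2. Matrix.mat 2 2 f $$ (0, j) * cofactor (Matrix.mat 2 2 f) 0 j)"
    by (rule laplace_expansion_row) auto
  then show ?thesis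
    by (simp add: numeral_2_eq_2 cofactor_def mat_delete_def det_single)
qed

lemma det_mat_3: "Determinant.det (Matrix.mat 3 3 f) =
    det3 (f (0, 0)) (f (1, 0)) (f (2, 0)) (f (0, 1)) (f (1, 1)) (f (2, 1)) (f (0, 2)) (f (1, 2)) (f (2, 2))"
  for f :: "nat \<times> nat \<Rightarrow> complex"
proof -
  have "Determinant.det (Matrix.mat 3 3 f) =
     (\<Sum>j<3. Matrix.mat 3 3 f $$ (0, j) * cofactor (Matrix.mat 3 3 f) 0 j)"
    by (rule laplace_expansion_row) auto
  also have "\<dots> = f (0, 0) * (f (1, 1) * f (2, 2) - f (1, 2) * f (2, 1))
     - f (0, 1) * (f (1, 0) * f (2, 2) - f (1, 2) * f (2, 0))
     + f (0, 2) * (f (1, 0) * f (2, 1) - f (1, 1) * f (2, 0))"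
    by (simp add: eval_nat_numeral cofactor_def mat_delete_def det_mat_2[unfolded eval_nat_numeral, simplified] algebra_simps)
  finally show ?thesis by (simp add: det3_def algebra_simps)
qed

lemma deriv_poly: "deriv (poly p) = poly (pderiv p)" for p :: "complex poly"
  by (rule ext) (rule DERIV_imp_deriv, rule poly_DERIV)

lemma wronskian_2:
  "wronskian [poly P, q] z = poly P z * deriv q z - poly (pderiv P) z * q z"
proof -
  have 2: "length [poly P, q] = 2" by simp
  show ?thesis
    unfolding wronskian_def 2 det_mat_2 by (simp add: deriv_poly)
qed

lemma wronskian_3:
  "wronskian [poly P, q1, q2] z =
     det3 (poly P z) (poly (pderiv P) z) (poly (pderiv (pderiv P)) z)
       (q1 z) (deriv q1 z) (deriv (deriv q1) z) (q2 z) (deriv q2 z) (deriv (deriv q2) z)"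
proof -
  have 3: "length [poly P, q1, q2] = 3" by simp
  show ?thesis
    unfolding wronskian_def 3 det_mat_3 by (simp add: eval_nat_numeral deriv_poly)
qed

section \<open>Functions of the second kind and their Wronskians\<close>

lemma weight_branchE:
  assumes "weight_branch W U f" "open U"
  shows "\<And>z. z \<in> U \<Longrightarrow> poly (cpolyA W) z \<noteq> 0" "\<And>z. z \<in> U \<Longrightarrow> f z \<noteq> 0"
    "\<And>z. z \<in> U \<Longrightarrow> (f has_field_derivative poly (cpolyB W) z / poly (cpolyA W) z * f z) (at z)"
proof -
  obtain F where F: "\<And>z. z \<in> U \<Longrightarrow> poly (cpolyA W) z \<noteq> 0 \<and>
        (F has_field_derivative (poly (cpolyB W) z / poly (cpolyA W) z)) (at z) \<and> f z = exp (F z)"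
    using assms(1) unfolding weight_branch_def by blast
  show "poly (cpolyA W) z \<noteq> 0" "f z \<noteq> 0" if "z \<in> U" for z using F[OF that] by auto
  show "(f has_field_derivative poly (cpolyB W) z / poly (cpolyA W) z * f z) (at z)" if z: "z \<in> U" for z
  proof (rule has_field_derivative_transform_within_open[OF _ assms(2) z])
    show "((\<lambda>z. exp (F z)) has_field_derivative poly (cpolyB W) z / poly (cpolyA W) z * f z) (at z)"
      using F[OF z] by (auto intro!: derivative_eq_intros)
  qed (use F in auto)
qed

lemma has_field_derivative_log_quotient:
  fixes N f :: "complex \<Rightarrow> complex"
  assumes "(N has_field_derivative N') (at z)" "(f has_field_derivative b / a * f z) (at z)"
    "f z \<noteq> 0" "a \<noteq> 0"
  shows "((\<lambda>z. N z / f z) has_field_derivative (a * N' - b * N z) / (a * f z)) (at z)"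
proof -
  have "((\<lambda>z. N z / f z) has_field_derivative (N' * f z - N z * (b / a * f z)) / (f z * f z)) (at z)"
    using assms by (intro DERIV_divide)
  also have "(N' * f z - N z * (b / a * f z)) / (f z * f z) = (a * N' - b * N z) / (a * f z)"
    using assms(3,4) by (simp add: field_simps)
  finally show ?thesis .
qed

text \<open>
  All that the algebra uses about the weight: \<open>H\<close> satisfies a first order linear equation with
  polynomial coefficients off the support, and the Cauchy transform of \<open>P\<close> is \<open>P H\<close> plus a
  polynomial. The equation is not divided by \<open>A\<close>, which may vanish off the support.
\<close>

definition cauchy_structure :: "weight_data \<Rightarrow> complex poly \<Rightarrow> (complex \<Rightarrow> complex) \<Rightarrow> complex poly \<Rightarrow> complex poly \<Rightarrow> bool" where
  "cauchy_structure W P H K Q \<longleftrightarrow> (\<forall>z. z \<notin> of_real ` supp W \<longrightarrow>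
     cauchy_transform W (poly P) z = poly P z * H z + poly Q z \<and>
     (\<exists>H'. (H has_field_derivative H') (at z) \<and>
        poly (cpolyA W) z * H' = poly (cpolyB W) z * H z + poly K z))"

lemma cauchy_structure_exists:
  assumes "semiclassical W"
  shows "\<exists>K Q. cauchy_structure W P (cauchy_transform W (\<lambda>_. 1)) K Q"
  using cauchy_transform_decomposition[OF assms, of P] cauchy_transform_one_ode[OF assms]
    cauchy_transform_one_deriv[OF assms]
  unfolding cauchy_structure_def by meson

text \<open>
  \<open>A (P H + Q)' - B (P H + Q)\<close> is \<open>A w\<close> times the derivative of \<open>q\<close>. The second part is the same
  step for the weight \<open>v = A w\<close>, whose logarithmic derivative is \<open>(A' + B)/A\<close>.
\<close>

lemma structure_derivs:
  assumes cs: "cauchy_structure W P H K Q" and z: "z \<notin> of_real ` supp W"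
  defines "A \<equiv> cpolyA W" and "B \<equiv> cpolyB W"
  defines "g \<equiv> reduced1 A B K P Q" and "l \<equiv> reduced2 A B K P Q"
  shows "\<exists>D. ((\<lambda>z. poly P z * H z + poly Q z) has_field_derivative D) (at z) \<and>
       poly A z * D - poly B z * (poly P z * H z + poly Q z) =
       poly A z * poly (pderiv P) z * H z + poly g z"
    and "\<exists>D. ((\<lambda>z. poly A z * poly (pderiv P) z * H z + poly g z) has_field_derivative D) (at z) \<and>
       poly A z * D - poly (pderiv A + B) z * (poly A z * poly (pderiv P) z * H z + poly g z) =
       poly A z ^ 2 * poly (pderiv (pderiv P)) z * H z + poly l z"
proof -
  obtain H' where H': "(H has_field_derivative H') (at z)" "poly A z * H' = poly B z * H z + poly K z"
    using cs z unfolding cauchy_structure_def A_def B_def by blast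
  let ?P = "poly P z" and ?P' = "poly (pderiv P) z" and ?P'' = "poly (pderiv (pderiv P)) z"
  let ?A = "poly A z" and ?A' = "poly (pderiv A) z" and ?B = "poly B z"
  show "\<exists>D. ((\<lambda>z. poly P z * H z + poly Q z) has_field_derivative D) (at z) \<and>
       ?A * D - ?B * (?P * H z + poly Q z) = ?A * ?P' * H z + poly g z"
  proof (intro exI conjI)
    show "((\<lambda>z. poly P z * H z + poly Q z) has_field_derivative
        (?P' * H z + H' * ?P) + poly (pderiv Q) z) (at z)"
      by (intro DERIV_add DERIV_mult poly_DERIV H'(1))
    have "?A * ((?P' * H z + H' * ?P) + poly (pderiv Q) z) - ?B * (?P * H z + poly Q z) =
       ?A * ?P' * H z + (?A * H') * ?P + ?A * poly (pderiv Q) z - ?B * (?P * H z + poly Q z)"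
      by (simp add: algebra_simps)
    also have "\<dots> = ?A * ?P' * H z + poly g z"
      unfolding H'(2) by (simp add: g_def reduced1_def algebra_simps)
    finally show "?A * ((?P' * H z + H' * ?P) + poly (pderiv Q) z) - ?B * (?P * H z + poly Q z) =
       ?A * ?P' * H z + poly g z" .
  qed
  show "\<exists>D. ((\<lambda>z. poly A z * poly (pderiv P) z * H z + poly g z) has_field_derivative D) (at z) \<and>
       ?A * D - poly (pderiv A + B) z * (?A * ?P' * H z + poly g z) = ?A ^ 2 * ?P'' * H z + poly l z"
  proof (intro exI conjI)
    show "((\<lambda>z. poly A z * poly (pderiv P) z * H z + poly g z) has_field_derivative
        ((?A' * ?P' + ?P'' * ?A) * H z + H' * (?A * ?P')) + poly (pderiv g) z) (at z)"
      by (intro DERIV_add DERIV_mult poly_DERIV H'(1))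
    have "?A * (((?A' * ?P' + ?P'' * ?A) * H z + H' * (?A * ?P')) + poly (pderiv g) z)
        - poly (pderiv A + B) z * (?A * ?P' * H z + poly g z) =
       ?A ^ 2 * ?P'' * H z + (?A * H') * (?A * ?P') - ?B * (?A * ?P' * H z) + ?A * poly (pderiv g) z
        - poly (pderiv A + B) z * poly g z"
      by (simp add: algebra_simps power2_eq_square)
    also have "\<dots> = ?A ^ 2 * ?P'' * H z + poly l z"
      unfolding H'(2) by (simp add: l_def g_def[symmetric] reduced2_def algebra_simps)
    finally show "?A * (((?A' * ?P' + ?P'' * ?A) * H z + H' * (?A * ?P')) + poly (pderiv g) z)
        - poly (pderiv A + B) z * (?A * ?P' * H z + poly g z) = ?A ^ 2 * ?P'' * H z + poly l z" .
  qed
qed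

text \<open>
  The quotient rule, used twice: with the denominator \<open>w\<close>, and then with \<open>v = A w\<close>, each of which has
  a rational logarithmic derivative.
\<close>

lemma second_kind_derivs:
  assumes cs: "cauchy_structure W P H K Q"
    and U: "open U" "U \<inter> of_real ` supp W = {}" "weight_branch W U f" and z: "z \<in> U"
  defines "A \<equiv> cpolyA W" and "B \<equiv> cpolyB W"
  defines "g \<equiv> reduced1 A B K P Q" and "l \<equiv> reduced2 A B K P Q"
  shows "second_kind W f P z = (poly P z * H z + poly Q z) / f z"
    and "deriv (second_kind W f P) z = (poly A z * poly (pderiv P) z * H z + poly g z) / (poly A z * f z)"
    and "deriv (deriv (second_kind W f P)) z =
       (poly A z ^ 2 * poly (pderiv (pderiv P)) z * H z + poly l z) / (poly A z ^ 2 * f z)"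
proof -
  note br = weight_branchE[OF U(3,1), folded A_def B_def]
  have off: "z \<notin> of_real ` supp W" if "z \<in> U" for z using U(2) that by blast
  have 0: "second_kind W f P z = (poly P z * H z + poly Q z) / f z" if "z \<in> U" for z
    using cs off[OF that] by (simp add: second_kind_def cauchy_structure_def)
  have 1: "deriv (second_kind W f P) z = (poly A z * poly (pderiv P) z * H z + poly g z) / (poly A z * f z)"
    if z: "z \<in> U" for z
  proof -
    obtain D where D: "((\<lambda>z. poly P z * H z + poly Q z) has_field_derivative D) (at z)"
       "poly A z * D - poly B z * (poly P z * H z + poly Q z) = poly A z * poly (pderiv P) z * H z + poly g z"
      using structure_derivs(1)[OF cs off[OF z], folded A_def B_def] unfolding g_def by blast
    have "((\<lambda>z. (poly P z * H z + poly Q z) / f z) has_field_derivative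
       (poly A z * poly (pderiv P) z * H z + poly g z) / (poly A z * f z)) (at z)"
      using has_field_derivative_log_quotient[OF D(1) br(3)[OF z] br(2)[OF z] br(1)[OF z]]
      unfolding D(2) .
    then have "(second_kind W f P has_field_derivative
       (poly A z * poly (pderiv P) z * H z + poly g z) / (poly A z * f z)) (at z)"
      by (rule has_field_derivative_transform_within_open[OF _ U(1) z]) (simp add: 0)
    then show ?thesis by (rule DERIV_imp_deriv)
  qed
  show "second_kind W f P z = (poly P z * H z + poly Q z) / f z"
    and "deriv (second_kind W f P) z = (poly A z * poly (pderiv P) z * H z + poly g z) / (poly A z * f z)"
    using 0 1 z by auto
  obtain D where D: "((\<lambda>z. poly A z * poly (pderiv P) z * H z + poly g z) has_field_derivative D) (at z)"
       "poly A z * D - poly (pderiv A + B) z * (poly A z * poly (pderiv P) z * H z + poly g z) =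
        poly A z ^ 2 * poly (pderiv (pderiv P)) z * H z + poly l z"
    using structure_derivs(2)[OF cs off[OF z], folded A_def B_def] unfolding g_def l_def by blast
  have v: "((\<lambda>z. poly A z * f z) has_field_derivative poly (pderiv A + B) z / poly A z * (poly A z * f z)) (at z)"
  proof -
    have "poly (pderiv A) z * f z + poly B z / poly A z * f z * poly A z =
        poly (pderiv A + B) z / poly A z * (poly A z * f z)"
      using br(1)[OF z] by (simp add: field_simps)
    then show ?thesis
      using DERIV_mult[OF poly_DERIV[of A z] br(3)[OF z]] by (simp only:)
  qed
  have "((\<lambda>z. (poly A z * poly (pderiv P) z * H z + poly g z) / (poly A z * f z)) has_field_derivative
     (poly A z ^ 2 * poly (pderiv (pderiv P)) z * H z + poly l z) / (poly A z * (poly A z * f z))) (at z)"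
    using has_field_derivative_log_quotient[OF D(1) v _ br(1)[OF z]] br(1,2)[OF z]
    unfolding D(2) by simp
  then have "(deriv (second_kind W f P) has_field_derivative
     (poly A z ^ 2 * poly (pderiv (pderiv P)) z * H z + poly l z) / (poly A z ^ 2 * f z)) (at z)"
    unfolding power2_eq_square mult.assoc
    by (rule has_field_derivative_transform_within_open[OF _ U(1) z]) (simp add: 1 mult.assoc)
  then show "deriv (deriv (second_kind W f P)) z =
     (poly A z ^ 2 * poly (pderiv (pderiv P)) z * H z + poly l z) / (poly A z ^ 2 * f z)"
    by (rule DERIV_imp_deriv)
qed

lemma is_electrostatic_partner_partner_poly:
  assumes cs: "cauchy_structure W P H K Q"
  shows "is_electrostatic_partner W P (partner_poly (cpolyA W) (cpolyB W) K P Q)"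
  unfolding is_electrostatic_partner_def
proof (intro allI impI ballI, elim conjE)
  fix U f z assume U: "open U" "U \<inter> of_real ` supp W = {}" "weight_branch W U f" and z: "z \<in> U"
  note br = weight_branchE(1,2)[OF U(3,1) z]
  have "v_fun W f z * wronskian [poly P, second_kind W f P] z =
     poly P z * (poly (cpolyA W) z * poly (pderiv P) z * H z + poly (reduced1 (cpolyA W) (cpolyB W) K P Q) z)
     - poly (cpolyA W) z * poly (pderiv P) z * (poly P z * H z + poly Q z)"
    unfolding wronskian_2 second_kind_derivs[OF cs U z] v_fun_def using br by (simp add: field_simps)
  then show "poly (partner_poly (cpolyA W) (cpolyB W) K P Q) z = v_fun W f z * wronskian [poly P, second_kind W f P] z"
    by (simp add: partner_poly_def algebra_simps)
qed

lemma is_R_polynomial_R_poly: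
  assumes cs1: "cauchy_structure W1 P H1 K1 Q1" and cs2: "cauchy_structure W2 P H2 K2 Q2"
  shows "is_R_polynomial W1 W2 P (R_poly P (cpolyA W1) (cpolyB W1) K1 Q1 (cpolyA W2) (cpolyB W2) K2 Q2)"
  unfolding is_R_polynomial_def
proof (intro allI impI ballI, elim conjE)
  fix U f1 f2 z assume U: "open U" "U \<inter> of_real ` (supp W1 \<union> supp W2) = {}"
    "weight_branch W1 U f1" "weight_branch W2 U f2" and z: "z \<in> U"
  have U1: "U \<inter> of_real ` supp W1 = {}" and U2: "U \<inter> of_real ` supp W2 = {}" using U(2) by blast+
  note br = weight_branchE(1,2)[OF U(3,1) z] weight_branchE(1,2)[OF U(4,1) z]
  let ?A1 = "poly (cpolyA W1) z" and ?A2 = "poly (cpolyA W2) z"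
  let ?p0 = "poly P z" and ?p1 = "poly (pderiv P) z" and ?p2 = "poly (pderiv (pderiv P)) z"
  let ?q1 = "second_kind W1 f1 P" and ?q2 = "second_kind W2 f2 P"
  let ?c1 = "?A1 ^ 2 * f1 z" and ?c2 = "?A2 ^ 2 * f2 z"
  let ?h1 = "?A1 ^ 2 * H1 z" and ?h2 = "?A2 ^ 2 * H2 z"
  have s1: "?c1 * ?q1 z = ?p0 * ?h1 + ?A1 ^ 2 * poly Q1 z"
    "?c1 * deriv ?q1 z = ?p1 * ?h1 + ?A1 * poly (reduced1 (cpolyA W1) (cpolyB W1) K1 P Q1) z"
    "?c1 * deriv (deriv ?q1) z = ?p2 * ?h1 + poly (reduced2 (cpolyA W1) (cpolyB W1) K1 P Q1) z"
    unfolding second_kind_derivs[OF cs1 U(1) U1 U(3) z] using br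
    by (simp_all add: field_simps power2_eq_square)
  have s2: "?c2 * ?q2 z = ?p0 * ?h2 + ?A2 ^ 2 * poly Q2 z"
    "?c2 * deriv ?q2 z = ?p1 * ?h2 + ?A2 * poly (reduced1 (cpolyA W2) (cpolyB W2) K2 P Q2) z"
    "?c2 * deriv (deriv ?q2) z = ?p2 * ?h2 + poly (reduced2 (cpolyA W2) (cpolyB W2) K2 P Q2) z"
    unfolding second_kind_derivs[OF cs2 U(1) U2 U(4) z] using br
    by (simp_all add: field_simps power2_eq_square)
  have "?A1 * ?A2 * v_fun W1 f1 z * v_fun W2 f2 z * wronskian [poly P, ?q1, ?q2] z =
     ?c1 * ?c2 * det3 ?p0 ?p1 ?p2 (?q1 z) (deriv ?q1 z) (deriv (deriv ?q1) z) (?q2 z) (deriv ?q2 z) (deriv (deriv ?q2) z)"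
    unfolding wronskian_3 v_fun_def by (simp add: power2_eq_square)
  also have "\<dots> = poly (R_poly P (cpolyA W1) (cpolyB W1) K1 Q1 (cpolyA W2) (cpolyB W2) K2 Q2) z"
    unfolding det3_scale[symmetric] s1 s2 det3_column_ops R_poly_def poly_det3 by simp
  finally show "poly (R_poly P (cpolyA W1) (cpolyB W1) K1 Q1 (cpolyA W2) (cpolyB W2) K2 Q2) z =
     ?A1 * ?A2 * v_fun W1 f1 z * v_fun W2 f2 z * wronskian [poly P, ?q1, ?q2] z" by simp
qed

lemma R_polynomial_nonzero:
  assumes "is_R_polynomial W1 W2 P R" "wronskian_not_identically_zero W1 W2 P"
  shows "R \<noteq> 0"
proof
  assume "R = 0"
  obtain U f1 f2 z where U: "open U" "U \<inter> of_real ` (supp W1 \<union> supp W2) = {}"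
    "weight_branch W1 U f1" "weight_branch W2 U f2" "z \<in> U"
    "wronskian [poly P, second_kind W1 f1 P, second_kind W2 f2 P] z \<noteq> 0"
    using assms(2) unfolding wronskian_not_identically_zero_def by blast
  have "poly R z = (poly (cpolyA W1) z * poly (cpolyA W2) z * v_fun W1 f1 z * v_fun W2 f2 z) *
           wronskian [poly P, second_kind W1 f1 P, second_kind W2 f2 P] z"
    using assms(1) U unfolding is_R_polynomial_def by blast
  then show False
    using U(6) \<open>R = 0\<close> weight_branchE(1,2)[OF U(3,1,5)] weight_branchE(1,2)[OF U(4,1,5)]
    by (simp add: v_fun_def)
qed

section \<open>The degree of R\<close>

text \<open>
  Growth at most \<open>y\<^sup>e\<close> on the positive imaginary axis, for an integer exponent of any sign. This ray avoids the
  supports, and along it the distance to the real line is the modulus.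
\<close>

definition growth_le :: "(real \<Rightarrow> complex) \<Rightarrow> int \<Rightarrow> bool" where
  "growth_le f e \<longleftrightarrow> (\<exists>M. \<forall>y\<ge>1. norm (f y) \<le> M * y powi e)"

lemma growth_leI:
  assumes "\<And>y. y \<ge> 1 \<Longrightarrow> norm (f y) \<le> M * y powi e"
  shows "growth_le f e"
  using assms unfolding growth_le_def by blast

lemma growth_leE:
  assumes "growth_le f e"
  obtains M where "M \<ge> 0" "\<And>y. y \<ge> 1 \<Longrightarrow> norm (f y) \<le> M * y powi e"
proof -
  obtain M where M: "\<And>y. y \<ge> 1 \<Longrightarrow> norm (f y) \<le> M * y powi e"
    using assms unfolding growth_le_def by blast
  have "norm (f y) \<le> \<bar>M\<bar> * y powi e" if "y \<ge> 1" for y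
    using M[OF that] mult_right_mono[of M "\<bar>M\<bar>" "y powi e"] that
    by (meson abs_ge_self order_trans zero_le_power_int zero_le_one)
  then show ?thesis by (intro that[of "\<bar>M\<bar>"]) auto
qed

lemma growth_le_mono:
  assumes "growth_le f e" "e \<le> e'"
  shows "growth_le f e'"
proof -
  obtain M where M: "M \<ge> 0" "\<And>y. y \<ge> 1 \<Longrightarrow> norm (f y) \<le> M * y powi e"
    using growth_leE[OF assms(1)] by blast
  show ?thesis
  proof (rule growth_leI)
    fix y :: real assume y: "y \<ge> 1"
    then have "M * y powi e \<le> M * y powi e'"
      using M(1) assms(2) by (intro mult_left_mono power_int_increasing) auto
    with M(2)[OF y] show "norm (f y) \<le> M * y powi e'" by linarith
  qed
qed

lemma growth_le_add:
  assumes "growth_le f e" "growth_le g e"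
  shows "growth_le (\<lambda>y. f y + g y) e"
proof -
  obtain M N where M: "\<And>y. y \<ge> 1 \<Longrightarrow> norm (f y) \<le> M * y powi e" and
    N: "\<And>y. y \<ge> 1 \<Longrightarrow> norm (g y) \<le> N * y powi e"
    using growth_leE[OF assms(1)] growth_leE[OF assms(2)] by metis
  show ?thesis
  proof (rule growth_leI)
    fix y :: real assume y: "y \<ge> 1"
    show "norm (f y + g y) \<le> (M + N) * y powi e"
      using norm_triangle_ineq[of "f y" "g y"] M[OF y] N[OF y] by (simp add: ring_distribs)
  qed
qed

lemma growth_le_uminus: "growth_le f e \<Longrightarrow> growth_le (\<lambda>y. - f y) e"
  unfolding growth_le_def by simp

lemma growth_le_diff:
  assumes "growth_le f e" "growth_le g e"
  shows "growth_le (\<lambda>y. f y - g y) e"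
  using growth_le_add[OF assms(1) growth_le_uminus[OF assms(2)]] by simp

lemma growth_le_mult:
  assumes "growth_le f e" "growth_le g e'" "e + e' \<le> e''"
  shows "growth_le (\<lambda>y. f y * g y) e''"
proof -
  obtain M where M: "M \<ge> 0" "\<And>y. y \<ge> 1 \<Longrightarrow> norm (f y) \<le> M * y powi e"
    using growth_leE[OF assms(1)] by blast
  obtain N where N: "N \<ge> 0" "\<And>y. y \<ge> 1 \<Longrightarrow> norm (g y) \<le> N * y powi e'"
    using growth_leE[OF assms(2)] by blast
  have "growth_le (\<lambda>y. f y * g y) (e + e')"
  proof (rule growth_leI)
    fix y :: real assume y: "y \<ge> 1"
    have "norm (f y * g y) \<le> (M * y powi e) * (N * y powi e')"
      unfolding norm_mult using M(1) N(1) y by (intro mult_mono M(2) N(2)) auto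
    also have "\<dots> = (M * N) * y powi (e + e')" using y by (simp add: power_int_add)
    finally show "norm (f y * g y) \<le> (M * N) * y powi (e + e')" .
  qed
  then show ?thesis using assms(3) by (rule growth_le_mono)
qed

lemma growth_le_poly:
  assumes "int (degree p) \<le> d"
  shows "growth_le (\<lambda>y. poly p (\<i> * of_real y)) d"
proof -
  have "growth_le (\<lambda>y. poly p (\<i> * of_real y)) (int (degree p))"
  proof (rule growth_leI)
    fix y :: real assume y: "y \<ge> 1"
    have "norm (poly p (\<i> * of_real y)) \<le> (\<Sum>i\<le>degree p. norm (coeff p i * (\<i> * of_real y) ^ i))"
      unfolding poly_altdef by (rule norm_sum)
    also have "\<dots> \<le> (\<Sum>i\<le>degree p. norm (coeff p i) * y ^ degree p)"
      using y by (intro sum_mono) (auto simp: norm_mult norm_power intro!: mult_left_mono power_increasing)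
    also have "\<dots> = (\<Sum>i\<le>degree p. norm (coeff p i)) * y powi int (degree p)"
      by (simp add: sum_distrib_right)
    finally show "norm (poly p (\<i> * of_real y)) \<le> (\<Sum>i\<le>degree p. norm (coeff p i)) * y powi int (degree p)" .
  qed
  then show ?thesis using assms by (rule growth_le_mono)
qed

lemma growth_le_0: "growth_le (\<lambda>_. 0) e"
  by (rule growth_leI[of _ 0]) simp

lemma growth_le_poly_pderiv:
  assumes "int (degree p) \<le> d" "d - 1 \<le> e"
  shows "growth_le (\<lambda>y. poly (pderiv p) (\<i> * of_real y)) e"
proof (cases "degree p = 0")
  case True
  then have "pderiv p = 0" by (simp add: pderiv_eq_0_iff)
  then show ?thesis using growth_le_0 by simp
next
  case False
  then show ?thesis using assms by (intro growth_le_poly) (simp add: degree_pderiv)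
qed

lemma growth_le_poly_pderiv2:
  assumes "int (degree p) \<le> d"
  shows "growth_le (\<lambda>y. poly (pderiv (pderiv p)) (\<i> * of_real y)) (d - 2)"
proof (cases "degree p = 0")
  case True
  then have "pderiv p = 0" by (simp add: pderiv_eq_0_iff)
  then show ?thesis using growth_le_0 by simp
next
  case False
  then have "int (degree (pderiv p)) \<le> d - 1" using assms by (simp add: degree_pderiv)
  then show ?thesis by (rule growth_le_poly_pderiv) simp
qed

lemma degree_le_growth:
  assumes "growth_le (\<lambda>y. poly R (\<i> * of_real y)) d" "R \<noteq> 0"
  shows "int (degree R) \<le> d"
proof (rule ccontr)
  assume "\<not> int (degree R) \<le> d"
  then have d: "d - int (degree R) \<le> -1" by simp
  obtain M where M: "M \<ge> 0" "\<And>y. y \<ge> 1 \<Longrightarrow> norm (poly R (\<i> * of_real y)) \<le> M * y powi d"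
    using growth_leE[OF assms(1)] by blast
  have inf: "filterlim (\<lambda>y. \<i> * complex_of_real y) at_infinity at_top"
    by (simp add: filterlim_at_infinity_conv_norm_at_top norm_mult filterlim_abs_real)
  have "((\<lambda>y. poly R (\<i> * of_real y) / (\<i> * of_real y) ^ degree R) \<longlongrightarrow> lead_coeff R) at_top"
    by (rule filterlim_compose[OF poly_divide_tendsto_aux inf])
  moreover have "((\<lambda>y. poly R (\<i> * of_real y) / (\<i> * of_real y) ^ degree R) \<longlongrightarrow> 0) at_top"
  proof (rule Lim_null_comparison)
    show "\<forall>\<^sub>F y in at_top. norm (poly R (\<i> * of_real y) / (\<i> * of_real y) ^ degree R) \<le> M / y"
      using eventually_ge_at_top[of "1::real"]
    proof eventually_elim
      case (elim y)
      have "norm (poly R (\<i> * of_real y) / (\<i> * of_real y) ^ degree R) \<le> M * y powi d / y ^ degree R"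
        using elim M(2)[OF elim] by (simp add: norm_divide norm_mult norm_power divide_right_mono)
      also have "\<dots> = M * y powi (d - int (degree R))" using elim by (simp add: power_int_diff)
      also have "\<dots> \<le> M * y powi (-1)" using elim d M(1) by (intro mult_left_mono power_int_increasing) auto
      finally show ?case by (simp add: divide_inverse)
    qed
    show "((\<lambda>y. M / y) \<longlongrightarrow> 0) at_top"
      by (rule real_tendsto_divide_at_top[OF tendsto_const filterlim_ident])
  qed
  ultimately have "lead_coeff R = 0" using tendsto_unique[OF trivial_limit_at_top_linorder] by blast
  then show False using assms(2) by simp
qed

text \<open>
  The difference of the two sides has the integrand \<open>P(t) w(t) (t\<^sup>n - z\<^sup>n)/(t - z)\<close>, a combination of the
  vanishing moments of order less than \<open>n\<close>.
\<close>

lemma cauchy_transform_orthogonal: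
  assumes W: "semiclassical W" and orth: "orthogonal_to_order W P n" and z: "z \<notin> of_real ` supp W"
  shows "z ^ n * cauchy_transform W (poly P) z =
     (LINT t:supp W|lborel. poly (monom 1 n * P) (of_real t) * of_real (weight W t) / (of_real t - z))"
proof -
  let ?w = "\<lambda>t. complex_of_real (weight W t)"
  have int: "set_integrable lborel (supp W) (\<lambda>t. poly p (of_real t) * ?w t / (of_real t - z))" for p
    using set_integrable_cauchy[OF W z, of p 1] by simp
  have mom: "(LINT t:supp W|lborel. poly (monom 1 j * P) (of_real t) * ?w t) = 0" if "j < n" for j
    using orth that unfolding orthogonal_to_order_def moment_def by (simp add: poly_monom)
  have intm: "set_integrable lborel (supp W) (\<lambda>t. z ^ (n - Suc j) * (poly (monom 1 j * P) (of_real t) * ?w t))" for j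
    by (intro set_integrable_mult_right set_integrable_poly_weight W)
  have "(LINT t:supp W|lborel. poly (monom 1 n * P) (of_real t) * ?w t / (of_real t - z))
      - z ^ n * cauchy_transform W (poly P) z =
     (LINT t:supp W|lborel. poly (monom 1 n * P) (of_real t) * ?w t / (of_real t - z)
       - z ^ n * (poly P (of_real t) * ?w t / (of_real t - z)))"
    unfolding cauchy_transform_def
    by (simp only: set_integral_diff set_integral_mult_right set_integrable_mult_right int)
  also have "\<dots> = (LINT t:supp W|lborel. (\<Sum>j<n. z ^ (n - Suc j) * (poly (monom 1 j * P) (of_real t) * ?w t)))"
  proof (rule set_lebesgue_integral_cong)
    show "\<forall>t. t \<in> supp W \<longrightarrow> poly (monom 1 n * P) (of_real t) * ?w t / (of_real t - z)
       - z ^ n * (poly P (of_real t) * ?w t / (of_real t - z)) =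
       (\<Sum>j<n. z ^ (n - Suc j) * (poly (monom 1 j * P) (of_real t) * ?w t))"
    proof (intro allI impI)
      fix t assume "t \<in> supp W"
      then have ne: "of_real t - z \<noteq> 0" using z by auto
      have "poly (monom 1 n * P) (of_real t) * ?w t / (of_real t - z)
       - z ^ n * (poly P (of_real t) * ?w t / (of_real t - z)) =
       (of_real t ^ n - z ^ n) / (of_real t - z) * (poly P (of_real t) * ?w t)"
        by (simp add: poly_monom diff_divide_distrib left_diff_distrib mult.assoc)
      also have "(of_real t ^ n - z ^ n) / (of_real t - z) = (\<Sum>j<n. z ^ (n - Suc j) * of_real t ^ j)"
        unfolding power_diff_sumr2 using ne by simp
      finally show "poly (monom 1 n * P) (of_real t) * ?w t / (of_real t - z)
       - z ^ n * (poly P (of_real t) * ?w t / (of_real t - z)) =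
       (\<Sum>j<n. z ^ (n - Suc j) * (poly (monom 1 j * P) (of_real t) * ?w t))"
        by (simp add: poly_monom sum_distrib_right mult.assoc)
    qed
  qed (simp add: closed_supp[OF W] borel_closed)
  also have "\<dots> = (\<Sum>j<n. LINT t:supp W|lborel. z ^ (n - Suc j) * (poly (monom 1 j * P) (of_real t) * ?w t))"
    using intm unfolding set_integrable_def set_lebesgue_integral_def scaleR_sum_right
    by (intro Bochner_Integration.integral_sum) blast
  also have "\<dots> = 0"
    by (intro sum.neutral ballI) (simp only: set_integral_mult_right mom lessThan_iff mult_zero_right)
  finally show ?thesis by simp
qed

lemma cauchy_transform_bound:
  assumes W: "semiclassical W" and orth: "orthogonal_to_order W P n"
  shows "\<exists>M>0. \<forall>z. Im z > 0 \<longrightarrow> norm (cauchy_transform W (poly P) z) \<le> M / (Im z * norm z ^ n)"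
proof -
  let ?g = "\<lambda>t. poly (monom 1 n * P) (of_real t) * complex_of_real (weight W t)"
  define M where "M = (LINT t:supp W|lborel. norm (?g t))"
  have bound: "norm (cauchy_transform W (poly P) z) \<le> (\<bar>M\<bar> + 1) / (Im z * norm z ^ n)" if z: "Im z > 0" for z
  proof -
    have off: "z \<notin> of_real ` supp W" using z by auto
    have z0: "z \<noteq> 0" using z by auto
    have "norm (LINT t:supp W|lborel. ?g t / (of_real t - z)) \<le> (LINT t:supp W|lborel. norm (?g t) * (1 / Im z))"
      unfolding set_lebesgue_integral_def
    proof (rule Bochner_Integration.integral_norm_bound_integral)
      show "integrable lborel (\<lambda>t. indicator (supp W) t *\<^sub>R (?g t / (of_real t - z)))"
        using set_integrable_cauchy[OF W off, of "monom 1 n * P" 1] unfolding set_integrable_def by simp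
      have "integrable lborel (\<lambda>t. norm (indicator (supp W) t *\<^sub>R ?g t))"
        using set_integrable_poly_weight[OF W, of "monom 1 n * P"] unfolding set_integrable_def by (rule integrable_norm)
      then have "integrable lborel (\<lambda>t. norm (indicator (supp W) t *\<^sub>R ?g t) * (1 / Im z))"
        by (rule integrable_mult_left)
      moreover have "norm (indicator (supp W) t *\<^sub>R ?g t) * (1 / Im z) =
          indicator (supp W) t *\<^sub>R (norm (?g t) * (1 / Im z))" for t by simp
      ultimately show "integrable lborel (\<lambda>t. indicator (supp W) t *\<^sub>R (norm (?g t) * (1 / Im z)))"
        by (simp only:)
      show "norm (indicator (supp W) t *\<^sub>R (?g t / (of_real t - z))) \<le> indicator (supp W) t *\<^sub>R (norm (?g t) * (1 / Im z))" for t
      proof -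
        have le: "Im z \<le> cmod (of_real t - z)" using abs_Im_le_cmod[of "of_real t - z"] by simp
        then have "1 / cmod (of_real t - z) \<le> 1 / Im z" using z by (intro divide_left_mono mult_pos_pos) auto
        from mult_left_mono[OF this norm_ge_zero[of "?g t"]] show ?thesis
          by (auto simp: indicator_def norm_divide)
      qed
    qed
    also have "\<dots> = M * (1 / Im z)" unfolding M_def by (rule set_integral_mult_left)
    also have "\<dots> \<le> (\<bar>M\<bar> + 1) * (1 / Im z)" using z by (intro mult_right_mono) auto
    finally have "norm (z ^ n * cauchy_transform W (poly P) z) \<le> (\<bar>M\<bar> + 1) / Im z"
      unfolding cauchy_transform_orthogonal[OF W orth off] by simp
    then show ?thesis using z z0 by (simp add: norm_mult norm_power field_simps)
  qed
  show ?thesis by (rule exI[of _ "\<bar>M\<bar> + 1"]) (use bound in auto)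
qed

lemma cauchy_transform_holomorphic:
  assumes cs: "cauchy_structure W P H K Q" and W: "semiclassical W"
  shows "cauchy_transform W (poly P) holomorphic_on - of_real ` supp W"
proof (rule holomorphic_transform)
  have "H field_differentiable at z" if "z \<in> - of_real ` supp W" for z
    using cs that unfolding cauchy_structure_def field_differentiable_def by blast
  then have "H holomorphic_on - of_real ` supp W"
    by (simp add: holomorphic_on_def field_differentiable_at_within)
  then show "(\<lambda>z. poly P z * H z + poly Q z) holomorphic_on - of_real ` supp W"
    by (intro holomorphic_intros)
qed (use cs in \<open>auto simp: cauchy_structure_def\<close>)

text \<open>
  The disc of radius \<open>y/2\<close> about \<open>\<i> y\<close> stays in the half-plane \<open>Im z \<ge> y/2\<close>, so Cauchy's estimate for
  the \<open>k\<close>-th derivative gains a factor of order \<open>y\<^bsup>-k\<^esup>\<close>.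
\<close>

lemma cauchy_transform_growth:
  assumes W: "semiclassical W" and orth: "orthogonal_to_order W P n"
    and cs: "cauchy_structure W P H K Q"
  shows "growth_le (\<lambda>y. (deriv ^^ k) (cauchy_transform W (poly P)) (\<i> * of_real y)) (- int n - 1 - int k)"
proof -
  let ?C = "cauchy_transform W (poly P)"
  obtain M where M: "M > 0" "\<And>z. Im z > 0 \<Longrightarrow> norm (?C z) \<le> M / (Im z * norm z ^ n)"
    using cauchy_transform_bound[OF W orth] by blast
  show ?thesis
  proof (rule growth_leI)
    fix y :: real assume y: "y \<ge> 1"
    \<comment> \<open>The factor 2 in front makes the bound strict.\<close>
    define B where "B = 2 * M * 2 ^ Suc n / y ^ Suc n"
    have B: "norm (?C z) < B" "Im z > 0" if z: "z \<in> cball (\<i> * of_real y) (y / 2)" for z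
    proof -
      have "\<bar>Im (\<i> * of_real y - z)\<bar> \<le> y / 2"
        using abs_Im_le_cmod[of "\<i> * of_real y - z"] z by (simp add: dist_norm)
      then have "\<bar>y - Im z\<bar> \<le> y / 2" by simp
      then have Im: "y / 2 \<le> Im z" by linarith
      then have nz: "y / 2 \<le> norm z" using abs_Im_le_cmod[of z] by linarith
      have pos: "cmod z > 0" using nz y by linarith
      show Im0: "Im z > 0" using Im y by linarith
      then have "norm (?C z) \<le> M / (Im z * norm z ^ n)" by (rule M(2))
      also have "\<dots> \<le> M / (y / 2 * (y / 2) ^ n)"
        using M(1) Im nz y pos Im0 by (intro divide_left_mono mult_mono power_mono mult_pos_pos zero_less_power) auto
      also have "\<dots> = B / 2" by (simp add: B_def power_divide)
      also have "\<dots> < B"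
      proof -
        have "B > 0" using M(1) y by (simp add: B_def)
        then show ?thesis by simp
      qed
      finally show "norm (?C z) < B" .
    qed
    have sub: "cball (\<i> * of_real y) (y / 2) \<subseteq> - of_real ` supp W"
      using B(2) by fastforce
    have hol: "?C holomorphic_on cball (\<i> * of_real y) (y / 2)"
      using cauchy_transform_holomorphic[OF cs W] sub by (rule holomorphic_on_subset)
    have "norm ((deriv ^^ k) ?C (\<i> * of_real y)) \<le> fact k * B / (y / 2) ^ k"
    proof (cases "k = 0")
      case True
      then show ?thesis using B(1)[of "\<i> * of_real y"] y by simp
    next
      case False
      show ?thesis
      proof (rule Cauchy_higher_deriv_bound[of _ _ _ 0])
        show "?C holomorphic_on ball (\<i> * of_real y) (y / 2)"
          using hol ball_subset_cball by (rule holomorphic_on_subset)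
        show "continuous_on (cball (\<i> * of_real y) (y / 2)) ?C"
          using hol by (rule holomorphic_on_imp_continuous_on)
      qed (use B(1) y False in \<open>auto simp: less_imp_le\<close>)
    qed
    also have "\<dots> = (fact k * (2 * M * 2 ^ Suc n) * 2 ^ k) * (1 / (y ^ Suc n * y ^ k))"
      using y by (simp add: B_def power_divide)
    also have "1 / (y ^ Suc n * y ^ k) = y powi (- int n - 1 - int k)"
    proof -
      have "- int n - 1 - int k = - int (Suc n + k)" by simp
      then show ?thesis
        by (simp only: power_int_minus power_int_of_nat power_add divide_inverse mult_1)
    qed
    finally show "norm ((deriv ^^ k) ?C (\<i> * of_real y)) \<le>
      (fact k * (2 * M * 2 ^ Suc n) * 2 ^ k) * y powi (- int n - 1 - int k)" .
  qed
qed

text \<open>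
  The columns of \<open>R_poly\<close>, with the multiple of the first column put back. They are now
  expressed by the small function \<open>C\<close> and its derivatives, not by \<open>H\<close> and \<open>Q\<close> separately, which need
  not be small.
\<close>

lemma structure_columns:
  assumes cs: "cauchy_structure W P H K Q" and W: "semiclassical W" and z: "z \<notin> of_real ` supp W"
  defines "A \<equiv> cpolyA W" and "B \<equiv> cpolyB W" and "C \<equiv> cauchy_transform W (poly P)"
  shows "poly A z ^ 2 * C z = poly P z * (poly A z ^ 2 * H z) + poly (A ^ 2 * Q) z"
    and "poly A z * (poly A z * deriv C z - poly B z * C z) =
       poly (pderiv P) z * (poly A z ^ 2 * H z) + poly (A * reduced1 A B K P Q) z"
    and "poly A z ^ 2 * deriv (deriv C) z - 2 * (poly A z * poly B z * deriv C z)
       + (poly (pderiv A + B) z * poly B z - poly A z * poly (pderiv B) z) * C z =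
       poly (pderiv (pderiv P)) z * (poly A z ^ 2 * H z) + poly (reduced2 A B K P Q) z"
proof -
  let ?U = "- complex_of_real ` supp W"
  have U: "open ?U" by (rule open_off_supp[OF W])
  have C: "C z = poly P z * H z + poly Q z" if "z \<in> ?U" for z
    using cs that by (simp add: C_def cauchy_structure_def)
  have hol: "C holomorphic_on ?U" unfolding C_def by (rule cauchy_transform_holomorphic[OF cs W])
  have zU: "z \<in> ?U" using z by simp
  have X: "poly A z * deriv C z - poly B z * C z = poly A z * poly (pderiv P) z * H z + poly (reduced1 A B K P Q) z"
    if zU: "z \<in> ?U" for z
  proof -
    obtain D where D: "((\<lambda>z. poly P z * H z + poly Q z) has_field_derivative D) (at z)"
       "poly A z * D - poly B z * (poly P z * H z + poly Q z) =
        poly A z * poly (pderiv P) z * H z + poly (reduced1 A B K P Q) z"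
      using structure_derivs(1)[OF cs, of z, folded A_def B_def] zU by auto
    have "(C has_field_derivative D) (at z)"
      by (rule has_field_derivative_transform_within_open[OF D(1) U zU]) (simp add: C)
    then have "deriv C z = D" by (rule DERIV_imp_deriv)
    then show ?thesis using D(2) by (simp add: C[OF zU])
  qed
  show "poly A z ^ 2 * C z = poly P z * (poly A z ^ 2 * H z) + poly (A ^ 2 * Q) z"
    using C[OF zU] by (simp add: algebra_simps)
  show "poly A z * (poly A z * deriv C z - poly B z * C z) =
       poly (pderiv P) z * (poly A z ^ 2 * H z) + poly (A * reduced1 A B K P Q) z"
    using X[OF zU] by (simp add: algebra_simps power2_eq_square)
  obtain D where D: "((\<lambda>z. poly A z * poly (pderiv P) z * H z + poly (reduced1 A B K P Q) z) has_field_derivative D) (at z)"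
       "poly A z * D - poly (pderiv A + B) z * (poly A z * poly (pderiv P) z * H z + poly (reduced1 A B K P Q) z) =
       poly A z ^ 2 * poly (pderiv (pderiv P)) z * H z + poly (reduced2 A B K P Q) z"
    using structure_derivs(2)[OF cs z, folded A_def B_def] by blast
  have "((\<lambda>z. poly A z * deriv C z - poly B z * C z) has_field_derivative D) (at z)"
    by (rule has_field_derivative_transform_within_open[OF D(1) U zU]) (simp only: X)
  moreover have "((\<lambda>z. poly A z * deriv C z - poly B z * C z) has_field_derivative
      (poly (pderiv A) z * deriv C z + deriv (deriv C) z * poly A z)
      - (poly (pderiv B) z * C z + deriv C z * poly B z)) (at z)"
    using holomorphic_derivI[OF hol U zU] holomorphic_derivI[OF holomorphic_deriv[OF hol U] U zU]
    by (intro DERIV_diff DERIV_mult poly_DERIV)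
  ultimately have D': "D = (poly (pderiv A) z * deriv C z + deriv (deriv C) z * poly A z)
      - (poly (pderiv B) z * C z + deriv C z * poly B z)"
    by (rule DERIV_unique)
  show "poly A z ^ 2 * deriv (deriv C) z - 2 * (poly A z * poly B z * deriv C z)
       + (poly (pderiv A + B) z * poly B z - poly A z * poly (pderiv B) z) * C z =
       poly (pderiv (pderiv P)) z * (poly A z ^ 2 * H z) + poly (reduced2 A B K P Q) z"
    using D(2) unfolding X[OF zU, symmetric] D' by (simp add: algebra_simps power2_eq_square)
qed

text \<open>
  Since \<open>deg A \<le> \<sigma> + 2\<close> and \<open>deg B \<le> \<sigma> + 1\<close>, each further entry of a column loses one power of
  \<open>y\<close>, as does each derivative of \<open>P\<close>. All the terms of the determinant thus obey the same bound.
\<close>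

lemma columns_growth:
  assumes cs: "cauchy_structure W P H K Q" and W: "semiclassical W" and orth: "orthogonal_to_order W P n"
  defines "A \<equiv> cpolyA W" and "B \<equiv> cpolyB W" and "C \<equiv> cauchy_transform W (poly P)"
  defines "e \<equiv> 2 * weight_class W - int n"
  shows "growth_le (\<lambda>y. poly A (\<i> * of_real y) ^ 2 * C (\<i> * of_real y)) (e + 3)"
    and "growth_le (\<lambda>y. poly A (\<i> * of_real y) * (poly A (\<i> * of_real y) * deriv C (\<i> * of_real y)
         - poly B (\<i> * of_real y) * C (\<i> * of_real y))) (e + 2)"
    and "growth_le (\<lambda>y. poly A (\<i> * of_real y) ^ 2 * deriv (deriv C) (\<i> * of_real y)
       - 2 * (poly A (\<i> * of_real y) * poly B (\<i> * of_real y) * deriv C (\<i> * of_real y))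
       + (poly (pderiv A + B) (\<i> * of_real y) * poly B (\<i> * of_real y)
          - poly A (\<i> * of_real y) * poly (pderiv B) (\<i> * of_real y)) * C (\<i> * of_real y)) (e + 1)"
proof -
  define s where "s = weight_class W"
  have degA: "int (degree A) \<le> s + 2" and degB: "int (degree B) \<le> s + 1"
    by (simp_all add: s_def weight_class_def A_def B_def cpolyA_def cpolyB_def degree_map_poly)
  note C = cauchy_transform_growth[OF W orth cs, folded C_def]
  have C0: "growth_le (\<lambda>y. C (\<i> * of_real y)) (- int n - 1)" using C[of 0] by simp
  have C1: "growth_le (\<lambda>y. deriv C (\<i> * of_real y)) (- int n - 2)" using growth_le_mono[OF C[of 1], of "- int n - 2"] by simp
  have C2: "growth_le (\<lambda>y. deriv (deriv C) (\<i> * of_real y)) (- int n - 3)" using growth_le_mono[OF C[of 2], of "- int n - 3"] by (simp add: numeral_2_eq_2)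
  note A = growth_le_poly[OF degA] and B = growth_le_poly[OF degB]
  have A2: "growth_le (\<lambda>y. poly A (\<i> * of_real y) ^ 2) (2 * s + 4)"
    unfolding power2_eq_square by (rule growth_le_mult[OF A A]) simp
  have AB: "growth_le (\<lambda>y. poly A (\<i> * of_real y) * poly B (\<i> * of_real y)) (2 * s + 3)"
    by (rule growth_le_mult[OF A B]) simp
  have A': "growth_le (\<lambda>y. poly (pderiv A) (\<i> * of_real y)) (s + 1)"
    by (rule growth_le_poly_pderiv[OF degA]) simp
  have B': "growth_le (\<lambda>y. poly (pderiv B) (\<i> * of_real y)) s"
    by (rule growth_le_poly_pderiv[OF degB]) simp
  have E: "growth_le (\<lambda>y. poly (pderiv A + B) (\<i> * of_real y)) (s + 1)"
    unfolding poly_add by (rule growth_le_add[OF A' B])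
  have EB: "growth_le (\<lambda>y. poly (pderiv A + B) (\<i> * of_real y) * poly B (\<i> * of_real y)
          - poly A (\<i> * of_real y) * poly (pderiv B) (\<i> * of_real y)) (2 * s + 2)"
    by (intro growth_le_diff growth_le_mult[OF E B] growth_le_mult[OF A B']) simp_all
  have two: "growth_le (\<lambda>_. 2) 0" by (rule growth_leI[of _ 2]) simp
  have e: "e = 2 * s - int n" by (simp add: e_def s_def)
  show "growth_le (\<lambda>y. poly A (\<i> * of_real y) ^ 2 * C (\<i> * of_real y)) (e + 3)"
    by (rule growth_le_mult[OF A2 C0]) (simp add: e)
  have X: "growth_le (\<lambda>y. poly A (\<i> * of_real y) * deriv C (\<i> * of_real y)
         - poly B (\<i> * of_real y) * C (\<i> * of_real y)) (s - int n)"
    by (intro growth_le_diff growth_le_mult[OF A C1] growth_le_mult[OF B C0]) simp_all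
  show "growth_le (\<lambda>y. poly A (\<i> * of_real y) * (poly A (\<i> * of_real y) * deriv C (\<i> * of_real y)
         - poly B (\<i> * of_real y) * C (\<i> * of_real y))) (e + 2)"
    by (rule growth_le_mult[OF A X]) (simp add: e)
  have ABC: "growth_le (\<lambda>y. poly A (\<i> * of_real y) * poly B (\<i> * of_real y) * deriv C (\<i> * of_real y)) (e + 1)"
    by (rule growth_le_mult[OF AB C1]) (simp add: e)
  show "growth_le (\<lambda>y. poly A (\<i> * of_real y) ^ 2 * deriv (deriv C) (\<i> * of_real y)
       - 2 * (poly A (\<i> * of_real y) * poly B (\<i> * of_real y) * deriv C (\<i> * of_real y))
       + (poly (pderiv A + B) (\<i> * of_real y) * poly B (\<i> * of_real y)
          - poly A (\<i> * of_real y) * poly (pderiv B) (\<i> * of_real y)) * C (\<i> * of_real y)) (e + 1)"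
    by (intro growth_le_add growth_le_diff growth_le_mult[OF A2 C2] growth_le_mult[OF two ABC]
        growth_le_mult[OF EB C0]) (simp_all add: e)
qed

lemma degree_R_poly:
  assumes W: "semiclassical W1" "semiclassical W2" and P: "degree P = n1 + n2"
    and orth: "orthogonal_to_order W1 P n1" "orthogonal_to_order W2 P n2"
    and cs1: "cauchy_structure W1 P H1 K1 Q1" and cs2: "cauchy_structure W2 P H2 K2 Q2"
  defines "R \<equiv> R_poly P (cpolyA W1) (cpolyB W1) K1 Q1 (cpolyA W2) (cpolyB W2) K2 Q2"
  assumes R0: "R \<noteq> 0"
  shows "int (degree R) \<le> 2 * weight_class W1 + 2 * weight_class W2 + 3"
proof (rule degree_le_growth[OF _ R0])
  define N where "N = int n1 + int n2"
  have P: "int (degree P) \<le> N" using P by (simp add: N_def)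
  note G1 = columns_growth[OF cs1 W(1) orth(1)] and G2 = columns_growth[OF cs2 W(2) orth(2)]
  define a0 a1 a2 b0 b1 b2 where
    "a0 = (\<lambda>y. poly (cpolyA W1) (\<i> * of_real y) ^ 2 * cauchy_transform W1 (poly P) (\<i> * of_real y))" and
    "a1 = (\<lambda>y. poly (cpolyA W1) (\<i> * of_real y) * (poly (cpolyA W1) (\<i> * of_real y) * deriv (cauchy_transform W1 (poly P)) (\<i> * of_real y)
         - poly (cpolyB W1) (\<i> * of_real y) * cauchy_transform W1 (poly P) (\<i> * of_real y)))" and
    "a2 = (\<lambda>y. poly (cpolyA W1) (\<i> * of_real y) ^ 2 * deriv (deriv (cauchy_transform W1 (poly P))) (\<i> * of_real y)
       - 2 * (poly (cpolyA W1) (\<i> * of_real y) * poly (cpolyB W1) (\<i> * of_real y) * deriv (cauchy_transform W1 (poly P)) (\<i> * of_real y))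
       + (poly (pderiv (cpolyA W1) + cpolyB W1) (\<i> * of_real y) * poly (cpolyB W1) (\<i> * of_real y)
          - poly (cpolyA W1) (\<i> * of_real y) * poly (pderiv (cpolyB W1)) (\<i> * of_real y)) * cauchy_transform W1 (poly P) (\<i> * of_real y))" and
    "b0 = (\<lambda>y. poly (cpolyA W2) (\<i> * of_real y) ^ 2 * cauchy_transform W2 (poly P) (\<i> * of_real y))" and
    "b1 = (\<lambda>y. poly (cpolyA W2) (\<i> * of_real y) * (poly (cpolyA W2) (\<i> * of_real y) * deriv (cauchy_transform W2 (poly P)) (\<i> * of_real y)
         - poly (cpolyB W2) (\<i> * of_real y) * cauchy_transform W2 (poly P) (\<i> * of_real y)))" and
    "b2 = (\<lambda>y. poly (cpolyA W2) (\<i> * of_real y) ^ 2 * deriv (deriv (cauchy_transform W2 (poly P))) (\<i> * of_real y)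
       - 2 * (poly (cpolyA W2) (\<i> * of_real y) * poly (cpolyB W2) (\<i> * of_real y) * deriv (cauchy_transform W2 (poly P)) (\<i> * of_real y))
       + (poly (pderiv (cpolyA W2) + cpolyB W2) (\<i> * of_real y) * poly (cpolyB W2) (\<i> * of_real y)
          - poly (cpolyA W2) (\<i> * of_real y) * poly (pderiv (cpolyB W2)) (\<i> * of_real y)) * cauchy_transform W2 (poly P) (\<i> * of_real y))"
  note G = G1[folded a0_def a1_def a2_def] G2[folded b0_def b1_def b2_def]
  have p: "growth_le (\<lambda>y. poly P (\<i> * of_real y)) N" "growth_le (\<lambda>y. poly (pderiv P) (\<i> * of_real y)) (N - 1)"
    "growth_le (\<lambda>y. poly (pderiv (pderiv P)) (\<i> * of_real y)) (N - 2)"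
    by (rule growth_le_poly[OF P] growth_le_poly_pderiv[OF P order_refl] growth_le_poly_pderiv2[OF P])+
  let ?e1 = "2 * weight_class W1 - int n1" and ?e2 = "2 * weight_class W2 - int n2"
  have minors: "growth_le (\<lambda>y. a1 y * b2 y - b1 y * a2 y) (?e1 + ?e2 + 3)"
    "growth_le (\<lambda>y. a0 y * b2 y - b0 y * a2 y) (?e1 + ?e2 + 4)"
    "growth_le (\<lambda>y. a0 y * b1 y - b0 y * a1 y) (?e1 + ?e2 + 5)"
    by (intro growth_le_diff growth_le_mult[OF G(1) G(5)] growth_le_mult[OF G(1) G(6)]
        growth_le_mult[OF G(2) G(6)] growth_le_mult[OF G(4) G(2)] growth_le_mult[OF G(4) G(3)]
        growth_le_mult[OF G(5) G(3)]; simp)+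
  have "growth_le (\<lambda>y. det3 (poly P (\<i> * of_real y)) (poly (pderiv P) (\<i> * of_real y)) (poly (pderiv (pderiv P)) (\<i> * of_real y))
      (a0 y) (a1 y) (a2 y) (b0 y) (b1 y) (b2 y)) (2 * weight_class W1 + 2 * weight_class W2 + 3)"
    unfolding det3_def
    by (intro growth_le_add growth_le_diff growth_le_mult[OF p(1) minors(1)]
        growth_le_mult[OF p(2) minors(2)] growth_le_mult[OF p(3) minors(3)]) (simp_all add: N_def)
  then obtain M where M: "\<And>y. y \<ge> 1 \<Longrightarrow> norm (det3 (poly P (\<i> * of_real y)) (poly (pderiv P) (\<i> * of_real y)) (poly (pderiv (pderiv P)) (\<i> * of_real y))
      (a0 y) (a1 y) (a2 y) (b0 y) (b1 y) (b2 y)) \<le> M * y powi (2 * weight_class W1 + 2 * weight_class W2 + 3)"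
    unfolding growth_le_def by blast
  show "growth_le (\<lambda>y. poly R (\<i> * of_real y)) (2 * weight_class W1 + 2 * weight_class W2 + 3)"
  proof (rule growth_leI)
    fix y :: real assume y: "y \<ge> 1"
    have off: "\<i> * of_real y \<notin> of_real ` supp W" for W
    proof
      assume "\<i> * of_real y \<in> of_real ` supp W"
      then obtain t where "\<i> * of_real y = complex_of_real t" by blast
      then have "Im (\<i> * of_real y) = 0" by simp
      then show False using y by simp
    qed
    have "poly R (\<i> * of_real y) = det3 (poly P (\<i> * of_real y)) (poly (pderiv P) (\<i> * of_real y)) (poly (pderiv (pderiv P)) (\<i> * of_real y))
      (a0 y) (a1 y) (a2 y) (b0 y) (b1 y) (b2 y)"
      unfolding a0_def a1_def a2_def b0_def b1_def b2_def R_def R_poly_def poly_det3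
        structure_columns[OF cs1 W(1) off] structure_columns[OF cs2 W(2) off] det3_column_ops ..
    then show "norm (poly R (\<i> * of_real y)) \<le> M * y powi (2 * weight_class W1 + 2 * weight_class W2 + 3)"
      using M[OF y] by (simp only:)
  qed
qed

section \<open>Derivatives of logarithmic potentials\<close>

text \<open>
  Dividing by the value \<open>g z\<close> moves the argument to 1, where the principal logarithm is holomorphic.
\<close>

lemma ln_cmod_has_derivative:
  assumes g: "(g has_field_derivative g') (at z)" and nz: "g z \<noteq> 0"
  shows "((\<lambda>x. ln (cmod (g x))) has_derivative (\<lambda>h. Re (g' / g z * h))) (at z)"
proof -
  have "((\<lambda>x. Ln (g x / g z)) has_field_derivative g' / g z) (at z)"
    using nz by (auto intro!: derivative_eq_intros g)
  then have "((\<lambda>x. Re (Ln (g x / g z)) + ln (cmod (g z))) has_derivative (\<lambda>h. Re (g' / g z * h))) (at z)"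
    unfolding has_field_derivative_def
    by (intro has_derivative_add[where g' = "\<lambda>_. 0", simplified] bounded_linear.has_derivative[OF bounded_linear_Re] has_derivative_const)
  moreover have "\<forall>\<^sub>F x in at z. Re (Ln (g x / g z)) + ln (cmod (g z)) = ln (cmod (g x))"
  proof -
    have "(g \<longlongrightarrow> g z) (at z)" using DERIV_isCont[OF g] by (simp add: isCont_def)
    then have "\<forall>\<^sub>F x in at z. g x \<noteq> 0" using nz by (rule tendsto_imp_eventually_ne)
    then show ?thesis by eventually_elim (use nz in \<open>simp add: norm_divide ln_div\<close>)
  qed
  ultimately show ?thesis
    by (rule has_derivative_transform_eventually) (use nz in auto)
qed

lemma Re_linear_eqD:
  assumes "(\<lambda>h. Re (c * h)) = (\<lambda>h. Re (d * h))"
  shows "c = d"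
  using fun_cong[OF assms, of 1] fun_cong[OF assms, of \<i>] by (simp add: complex_eq_iff)

lemma eq_at_from_punctured:
  fixes f g :: "complex \<Rightarrow> complex"
  assumes "isCont f p" "isCont g p" "r > 0" "\<And>z. z \<in> ball p r - {p} \<Longrightarrow> f z = g z"
  shows "f p = g p"
proof (rule tendsto_unique[OF at_neq_bot])
  show "(g \<longlongrightarrow> g p) (at p)" using assms(2) by (simp add: isCont_def)
  have ev: "\<forall>\<^sub>F z in at p. g z = f z"
    unfolding eventually_at using assms(3,4) by (intro exI[of _ r]) (auto simp: dist_commute)
  show "(g \<longlongrightarrow> f p) (at p)"
    unfolding tendsto_cong[OF ev] using assms(1) by (simp add: isCont_def)
qed


section \<open>Logarithmic derivatives of polynomials at points and roots\<close>

lemma linear_factors_log_deriv: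
  fixes w :: "nat \<Rightarrow> complex"
  assumes "finite I" "\<And>i. i \<in> I \<Longrightarrow> x \<noteq> w i"
  shows "poly (\<Prod>i\<in>I. [:- w i, 1:]) x \<noteq> 0 \<and>
    poly (pderiv (\<Prod>i\<in>I. [:- w i, 1:])) x = poly (\<Prod>i\<in>I. [:- w i, 1:]) x * (\<Sum>i\<in>I. 1 / (x - w i))"
  using assms
proof (induction I rule: finite_induct)
  case empty
  then show ?case by simp
next
  case (insert i I)
  let ?G = "\<Prod>i\<in>I. [:- w i, 1:]"
  have IH: "poly ?G x \<noteq> 0" "poly (pderiv ?G) x = poly ?G x * (\<Sum>i\<in>I. 1 / (x - w i))"
    using insert by auto
  have ne: "x - w i \<noteq> 0" using insert.prems by auto
  have pl: "poly ([:- w i, 1:] * q) x = (x - w i) * poly q x" for q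
    by (simp add: algebra_simps)
  have "poly (pderiv ([:- w i, 1:] * ?G)) x = poly ([:- w i, 1:] * pderiv ?G) x + poly ?G x"
    unfolding pderiv_mult by (simp add: pderiv_pCons)
  also have "\<dots> = (x - w i) * poly ?G x * (1 / (x - w i) + (\<Sum>i\<in>I. 1 / (x - w i)))"
    unfolding pl IH(2) using ne by (simp add: field_simps)
  finally show ?case
    using IH(1) ne unfolding prod.insert[OF insert.hyps] sum.insert[OF insert.hyps] pl by simp
qed

lemma proots_factorization:
  fixes p :: "complex poly"
  assumes "p \<noteq> 0" "mset zs = proots p"
  shows "p = Polynomial.smult (lead_coeff p) (\<Prod>i<length zs. [:- (zs ! i), 1:])"
proof -
  have "p = Polynomial.smult (lead_coeff p) (\<Prod>x\<in>#proots p. [:- x, 1:])"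
    by (rule complex_poly_decompose_multiset[symmetric])
  also have "(\<Prod>x\<in>#proots p. [:- x, 1:]) = prod_list (map (\<lambda>x. [:- x, 1:]) zs)"
    unfolding assms(2)[symmetric] by (metis mset_map prod_mset_prod_list)
  also have "\<dots> = (\<Prod>i<length zs. [:- (zs ! i), 1:])"
    unfolding prod.list_conv_set_nth by (intro prod.cong) auto
  finally show ?thesis .
qed

lemma log_deriv_roots:
  fixes p :: "complex poly"
  assumes "p \<noteq> 0" "mset zs = proots p" "poly p x \<noteq> 0"
  shows "(\<Sum>i<length zs. 1 / (x - zs ! i)) = poly (pderiv p) x / poly p x"
proof -
  have "x \<noteq> zs ! i" if "i < length zs" for i
  proof
    assume "x = zs ! i"
    then have "x \<in># proots p" using that by (simp flip: assms(2))
    then show False using assms by simp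
  qed
  then have G: "poly (\<Prod>i<length zs. [:- (zs ! i), 1:]) x \<noteq> 0 \<and>
    poly (pderiv (\<Prod>i<length zs. [:- (zs ! i), 1:])) x =
    poly (\<Prod>i<length zs. [:- (zs ! i), 1:]) x * (\<Sum>i<length zs. 1 / (x - zs ! i))"
    by (intro linear_factors_log_deriv) auto
  show ?thesis
    using G assms(1) by (subst (1 2) proots_factorization[OF assms(1,2)]) (simp add: pderiv_smult)
qed

text \<open>
  Split off the factor of the root in question: if \<open>p = (x - z) G\<close>, then \<open>p' = G\<close> and \<open>p'' = 2 G'\<close> at \<open>z\<close>.
\<close>

lemma second_deriv_roots:
  fixes p :: "complex poly"
  assumes p: "p \<noteq> 0" "mset zs = proots p" and k: "k < length zs"
    and simple: "\<And>x. count (proots p) x \<le> 1"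
  shows "poly (pderiv p) (zs ! k) \<noteq> 0"
    and "(\<Sum>i\<in>{..<length zs} - {k}. 1 / (zs ! k - zs ! i)) =
      poly (pderiv (pderiv p)) (zs ! k) / (2 * poly (pderiv p) (zs ! k))"
    and "\<And>i. i < length zs \<Longrightarrow> i \<noteq> k \<Longrightarrow> zs ! i \<noteq> zs ! k"
proof -
  let ?x = "zs ! k" and ?I = "{..<length zs} - {k}"
  have "distinct zs"
    unfolding distinct_count_atmost_1 p(2)
  proof
    fix a show "count (proots p) a = (if a \<in> set zs then 1 else 0)"
    proof (cases "a \<in> set zs")
      case True
      then have "a \<in># proots p" by (simp flip: p(2))
      then have "count (proots p) a > 0" by (simp only: count_greater_zero_iff)
      then have "count (proots p) a = 1" using simple[of a] by linarith
      then show ?thesis using True by (simp only: if_True)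
    next
      case False
      then have "a \<notin># proots p" by (simp flip: p(2))
      then show ?thesis using False by (simp only: not_in_iff if_False)
    qed
  qed
  then show ne: "\<And>i. i < length zs \<Longrightarrow> i \<noteq> k \<Longrightarrow> zs ! i \<noteq> zs ! k"
    using k by (simp add: nth_eq_iff_index_eq)
  define G where "G = Polynomial.smult (lead_coeff p) (\<Prod>i\<in>?I. [:- (zs ! i), 1:])"
  have "(\<Prod>i<length zs. [:- (zs ! i), 1:]) = [:- ?x, 1:] * (\<Prod>i\<in>?I. [:- (zs ! i), 1:])"
    by (rule prod.remove) (use k in auto)
  then have pG: "p = [:- ?x, 1:] * G"
    using proots_factorization[OF p] unfolding G_def by (metis mult_smult_right)
  have lin: "poly (\<Prod>i\<in>?I. [:- (zs ! i), 1:]) ?x \<noteq> 0 \<and>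
    poly (pderiv (\<Prod>i\<in>?I. [:- (zs ! i), 1:])) ?x =
    poly (\<Prod>i\<in>?I. [:- (zs ! i), 1:]) ?x * (\<Sum>i\<in>?I. 1 / (?x - zs ! i))"
    by (rule linear_factors_log_deriv) (use ne in \<open>auto simp: eq_commute\<close>)
  have G: "poly G ?x \<noteq> 0" "poly (pderiv G) ?x = poly G ?x * (\<Sum>i\<in>?I. 1 / (?x - zs ! i))"
    using lin p(1) by (simp_all add: G_def pderiv_smult)
  have p1: "pderiv p = [:- ?x, 1:] * pderiv G + G"
    unfolding pG pderiv_mult by (simp add: pderiv_pCons)
  have p2: "pderiv (pderiv p) = [:- ?x, 1:] * pderiv (pderiv G) + 2 * pderiv G"
    unfolding p1 pderiv_mult pderiv_add by (simp add: pderiv_pCons)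
  have d1: "poly (pderiv p) ?x = poly G ?x" unfolding p1 by simp
  have d2: "poly (pderiv (pderiv p)) ?x = 2 * poly (pderiv G) ?x" unfolding p2 by simp
  show "poly (pderiv p) ?x \<noteq> 0" using d1 G(1) by simp
  show "(\<Sum>i\<in>?I. 1 / (?x - zs ! i)) = poly (pderiv (pderiv p)) ?x / (2 * poly (pderiv p) ?x)"
    unfolding d1 d2 G(2) using G(1) by simp
qed


section \<open>Stationary points of the energy\<close>

lemma vector_energy_commute: "vector_energy a \<phi>1 \<phi>2 zs xs = vector_energy a \<phi>2 \<phi>1 xs zs"
  unfolding vector_energy_def
  by (subst (2) sum.swap) (simp add: norm_minus_commute)

text \<open>
  The sum runs over ordered pairs, so each pair that contains the moving point is counted twice.
\<close>

lemma energy_pair_sum_update: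
  fixes zs :: "complex list"
  assumes k: "k < length zs"
  shows "\<exists>c. \<forall>z. (\<Sum>m<length zs. \<Sum>i\<in>{..<length zs} - {m}. ln (1 / cmod (zs[k := z] ! i - zs[k := z] ! m))) =
    c + 2 * (\<Sum>i\<in>{..<length zs} - {k}. ln (1 / cmod (z - zs ! i)))"
proof -
  let ?I = "{..<length zs}"
  define L where "L x y = ln (1 / cmod (x - y))" for x y :: complex
  have Lc: "L x y = L y x" for x y by (simp add: L_def norm_minus_commute)
  have "(\<Sum>m\<in>?I. \<Sum>i\<in>?I - {m}. L (zs[k := z] ! i) (zs[k := z] ! m)) =
    (\<Sum>m\<in>?I - {k}. \<Sum>i\<in>?I - {m} - {k}. L (zs ! i) (zs ! m)) + 2 * (\<Sum>i\<in>?I - {k}. L z (zs ! i))" for z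
  proof -
    have "(\<Sum>m\<in>?I. \<Sum>i\<in>?I - {m}. L (zs[k := z] ! i) (zs[k := z] ! m)) =
      (\<Sum>i\<in>?I - {k}. L (zs[k := z] ! i) (zs[k := z] ! k)) +
      (\<Sum>m\<in>?I - {k}. \<Sum>i\<in>?I - {m}. L (zs[k := z] ! i) (zs[k := z] ! m))"
      using k by (intro sum.remove) auto
    also have "(\<Sum>i\<in>?I - {k}. L (zs[k := z] ! i) (zs[k := z] ! k)) = (\<Sum>i\<in>?I - {k}. L z (zs ! i))"
      using k by (intro sum.cong) (auto simp: Lc)
    also have "(\<Sum>m\<in>?I - {k}. \<Sum>i\<in>?I - {m}. L (zs[k := z] ! i) (zs[k := z] ! m)) =
      (\<Sum>m\<in>?I - {k}. L z (zs ! m) + (\<Sum>i\<in>?I - {m} - {k}. L (zs ! i) (zs ! m)))"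
    proof (rule sum.cong[OF refl])
      fix m assume m: "m \<in> ?I - {k}"
      have "(\<Sum>i\<in>?I - {m}. L (zs[k := z] ! i) (zs[k := z] ! m)) =
         L (zs[k := z] ! k) (zs[k := z] ! m) + (\<Sum>i\<in>?I - {m} - {k}. L (zs[k := z] ! i) (zs[k := z] ! m))"
        using k m by (intro sum.remove) auto
      also have "(\<Sum>i\<in>?I - {m} - {k}. L (zs[k := z] ! i) (zs[k := z] ! m)) = (\<Sum>i\<in>?I - {m} - {k}. L (zs ! i) (zs ! m))"
        using m by (intro sum.cong) auto
      finally show "(\<Sum>i\<in>?I - {m}. L (zs[k := z] ! i) (zs[k := z] ! m)) =
         L z (zs ! m) + (\<Sum>i\<in>?I - {m} - {k}. L (zs ! i) (zs ! m))" using k m by simp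
    qed
    finally show ?thesis by (simp add: sum.distrib)
  qed
  then show ?thesis unfolding L_def by blast
qed

lemma vector_energy_update:
  assumes k: "k < length zs"
  shows "\<exists>c. \<forall>z. vector_energy a \<phi>1 \<phi>2 (zs[k := z]) xs =
    c + 2 * (\<Sum>i\<in>{..<length zs} - {k}. ln (1 / cmod (z - zs ! i)))
      + 2 * a * (\<Sum>j<length xs. ln (1 / cmod (z - xs ! j))) + 2 * \<phi>1 z"
proof -
  let ?I = "{..<length zs}"
  obtain c where c: "\<And>z. (\<Sum>m<length zs. \<Sum>i\<in>{..<length zs} - {m}. ln (1 / cmod (zs[k := z] ! i - zs[k := z] ! m))) =
    c + 2 * (\<Sum>i\<in>{..<length zs} - {k}. ln (1 / cmod (z - zs ! i)))"
    using energy_pair_sum_update[OF k] by blast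
  have upd: "(\<Sum>m<length zs. F (zs[k := z] ! m)) = F z + (\<Sum>m\<in>?I - {k}. F (zs ! m))" for F :: "complex \<Rightarrow> real" and z
  proof -
    have "(\<Sum>m<length zs. F (zs[k := z] ! m)) = F (zs[k := z] ! k) + (\<Sum>m\<in>?I - {k}. F (zs[k := z] ! m))"
      using k by (intro sum.remove) auto
    also have "(\<Sum>m\<in>?I - {k}. F (zs[k := z] ! m)) = (\<Sum>m\<in>?I - {k}. F (zs ! m))"
      by (intro sum.cong) auto
    finally show ?thesis using k by simp
  qed
  define d where "d = c + 2 * a * (\<Sum>m\<in>?I - {k}. \<Sum>j<length xs. ln (1 / cmod (zs ! m - xs ! j)))
      + (\<Sum>j<length xs. \<Sum>i\<in>{..<length xs} - {j}. ln (1 / cmod (xs ! i - xs ! j)))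
      + 2 * (\<Sum>m\<in>?I - {k}. \<phi>1 (zs ! m)) + 2 * (\<Sum>j<length xs. \<phi>2 (xs ! j))"
  have "vector_energy a \<phi>1 \<phi>2 (zs[k := z]) xs =
    d + 2 * (\<Sum>i\<in>?I - {k}. ln (1 / cmod (z - zs ! i)))
      + 2 * a * (\<Sum>j<length xs. ln (1 / cmod (z - xs ! j))) + 2 * \<phi>1 z" for z
    unfolding vector_energy_def length_list_update c
      upd[of "\<lambda>u. \<Sum>j<length xs. ln (1 / cmod (u - xs ! j))"] upd[of \<phi>1] d_def
    by (simp add: algebra_simps)
  then show ?thesis by blast
qed

lemma log_distance_has_derivative:
  assumes "z \<noteq> w"
  shows "((\<lambda>z. ln (1 / cmod (z - w))) has_derivative (\<lambda>h. Re (- (1 / (z - w)) * h))) (at z)"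
proof -
  have "((\<lambda>z. 1 / (z - w)) has_field_derivative - (1 / (z - w) ^ 2)) (at z)"
    using assms by (auto intro!: derivative_eq_intros simp: power2_eq_square divide_simps)
  from ln_cmod_has_derivative[OF this] assms
  have "((\<lambda>z. ln (cmod (1 / (z - w)))) has_derivative (\<lambda>h. Re (- (1 / (z - w) ^ 2) / (1 / (z - w)) * h))) (at z)"
    by simp
  moreover have "- (1 / (z - w) ^ 2) / (1 / (z - w)) = - (1 / (z - w))"
    using assms by (simp add: power2_eq_square)
  ultimately show ?thesis by (simp only: norm_divide norm_one)
qed

text \<open>
  The energy as a function of one point is, up to a constant, a sum of logarithmic potentials, and
  its real differential is the real part of a complex linear form.
\<close>

lemma vector_energy_stationary:
  assumes k: "k < length zs"
    and \<phi>: "(\<phi>1 has_derivative (\<lambda>h. Re (M * h))) (at (zs ! k))"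
    and zs: "\<And>i. i < length zs \<Longrightarrow> i \<noteq> k \<Longrightarrow> zs ! i \<noteq> zs ! k"
    and xs: "\<And>j. j < length xs \<Longrightarrow> xs ! j \<noteq> zs ! k"
    and M: "(\<Sum>i\<in>{..<length zs} - {k}. 1 / (zs ! k - zs ! i))
      + of_real a * (\<Sum>j<length xs. 1 / (zs ! k - xs ! j)) = M"
  shows "((\<lambda>z. vector_energy a \<phi>1 \<phi>2 (zs[k := z]) xs) has_derivative (\<lambda>_. 0)) (at (zs ! k))"
proof -
  let ?z = "zs ! k" and ?I = "{..<length zs} - {k}"
  obtain c where c: "\<And>z. vector_energy a \<phi>1 \<phi>2 (zs[k := z]) xs =
    c + 2 * (\<Sum>i\<in>?I. ln (1 / cmod (z - zs ! i)))
      + 2 * a * (\<Sum>j<length xs. ln (1 / cmod (z - xs ! j))) + 2 * \<phi>1 z"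
    using vector_energy_update[OF k] by blast
  have d1: "((\<lambda>z. ln (1 / cmod (z - zs ! i))) has_derivative (\<lambda>h. Re (- (1 / (?z - zs ! i)) * h))) (at ?z)"
    if "i \<in> ?I" for i using zs[of i] that by (intro log_distance_has_derivative) auto
  have d2: "((\<lambda>z. ln (1 / cmod (z - xs ! j))) has_derivative (\<lambda>h. Re (- (1 / (?z - xs ! j)) * h))) (at ?z)"
    if "j \<in> {..<length xs}" for j using xs[of j] that by (intro log_distance_has_derivative) auto
  have "((\<lambda>z. c + 2 * (\<Sum>i\<in>?I. ln (1 / cmod (z - zs ! i)))
      + 2 * a * (\<Sum>j<length xs. ln (1 / cmod (z - xs ! j))) + 2 * \<phi>1 z) has_derivative
     (\<lambda>h. 0 + 2 * (\<Sum>i\<in>?I. Re (- (1 / (?z - zs ! i)) * h))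
      + 2 * a * (\<Sum>j<length xs. Re (- (1 / (?z - xs ! j)) * h)) + 2 * Re (M * h))) (at ?z)"
    by (intro has_derivative_add has_derivative_const has_derivative_mult_right has_derivative_sum d1 d2 \<phi>)
  also have "(\<lambda>h. 0 + 2 * (\<Sum>i\<in>?I. Re (- (1 / (?z - zs ! i)) * h))
      + 2 * a * (\<Sum>j<length xs. Re (- (1 / (?z - xs ! j)) * h)) + 2 * Re (M * h)) = (\<lambda>_. 0)"
  proof
    fix h
    have 1: "(\<Sum>i\<in>?I. Re (- (1 / (?z - zs ! i)) * h)) = - Re ((\<Sum>i\<in>?I. 1 / (?z - zs ! i)) * h)"
      unfolding sum_distrib_right Re_sum sum_negf[symmetric] by simp
    have 2: "(\<Sum>j<length xs. Re (- (1 / (?z - xs ! j)) * h)) = - Re ((\<Sum>j<length xs. 1 / (?z - xs ! j)) * h)"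
      unfolding sum_distrib_right Re_sum sum_negf[symmetric] by simp
    have 3: "Re (M * h) = Re ((\<Sum>i\<in>?I. 1 / (?z - zs ! i)) * h) + a * Re ((\<Sum>j<length xs. 1 / (?z - xs ! j)) * h)"
    proof -
      have "Re ((x + of_real a * y) * h) = Re (x * h) + a * Re (y * h)" for x y :: complex
        by (simp add: algebra_simps)
      then show ?thesis unfolding M[symmetric] .
    qed
    show "0 + 2 * (\<Sum>i\<in>?I. Re (- (1 / (?z - zs ! i)) * h))
      + 2 * a * (\<Sum>j<length xs. Re (- (1 / (?z - xs ! j)) * h)) + 2 * Re (M * h) = 0"
      unfolding 1 2 3 by (simp add: algebra_simps)
  qed
  finally show ?thesis unfolding c .
qed

section \<open>Derivatives of the external fields\<close>

text \<open>
  The determinations fix the derivative of \<open>\<Phi>\<close> at every point of the punctured disc, since a real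
  linear form \<open>h \<mapsto> Re (c h)\<close> determines \<open>c\<close>. At \<open>p\<close> itself nothing is prescribed, but \<open>M\<close>, which is
  \<open>\<Phi>'\<close>, is holomorphic there. The predicate \<open>good\<close> excludes points where the formula for the
  field is degenerate.
\<close>

lemma finite_field_determination:
  assumes "finite_field_at D p \<phi>"
    and D: "\<And>U z. open U \<Longrightarrow> z \<in> U \<Longrightarrow> D U \<phi> \<Longrightarrow> good z \<Longrightarrow> (\<phi> has_derivative (\<lambda>h. Re (L z * h))) (at z)"
  obtains r M where "r > 0" "M holomorphic_on ball p r"
    "(\<phi> has_derivative (\<lambda>h. Re (M p * h))) (at p)"
    "\<And>z. z \<in> ball p r - {p} \<Longrightarrow> \<exists>U. open U \<and> z \<in> U \<and> D U \<phi>"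
    "\<And>z. z \<in> ball p r - {p} \<Longrightarrow> good z \<Longrightarrow> M z = L z"
proof -
  obtain r \<Phi> where r: "r > 0" and hol: "\<Phi> holomorphic_on ball p r"
    and \<phi>: "\<And>z. z \<in> ball p r \<Longrightarrow> \<phi> z = Re (\<Phi> z)"
    and U: "\<And>z. z \<in> ball p r - {p} \<Longrightarrow> \<exists>U. open U \<and> z \<in> U \<and> D U \<phi>"
    using assms(1) unfolding finite_field_at_def by blast
  have der: "(\<phi> has_derivative (\<lambda>h. Re (deriv \<Phi> z * h))) (at z)" if z: "z \<in> ball p r" for z
  proof -
    have "(\<Phi> has_derivative (*) (deriv \<Phi> z)) (at z)"
      using holomorphic_derivI[OF hol open_ball z] unfolding has_field_derivative_def .
    then have "((\<lambda>z. Re (\<Phi> z)) has_derivative (\<lambda>h. Re (deriv \<Phi> z * h))) (at z)"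
      by (rule bounded_linear.has_derivative[OF bounded_linear_Re])
    then show ?thesis
      by (rule has_derivative_transform_within_open[OF _ open_ball z]) (simp add: \<phi>)
  qed
  show thesis
  proof (rule that[OF r, of "deriv \<Phi>"])
    show "deriv \<Phi> holomorphic_on ball p r" by (rule holomorphic_deriv[OF hol open_ball])
    show "(\<phi> has_derivative (\<lambda>h. Re (deriv \<Phi> p * h))) (at p)" using der r by simp
    show "\<exists>U. open U \<and> z \<in> U \<and> D U \<phi>" if "z \<in> ball p r - {p}" for z using U that .
    show "deriv \<Phi> z = L z" if z: "z \<in> ball p r - {p}" "good z" for z
    proof -
      obtain U' where "open U'" "z \<in> U'" "D U' \<phi>" using U z(1) by blast
      then have "(\<phi> has_derivative (\<lambda>h. Re (L z * h))) (at z)" using D z(2) by blast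
      with der[of z] z(1) have "(\<lambda>h. Re (deriv \<Phi> z * h)) = (\<lambda>h. Re (L z * h))"
        by (intro has_derivative_unique) auto
      then show ?thesis by (rule Re_linear_eqD)
    qed
  qed
qed

lemma v_fun_has_derivative:
  assumes "open U" "z \<in> U" "weight_branch W U f"
  shows "v_fun W f z \<noteq> 0"
    "(v_fun W f has_field_derivative
       poly (pderiv (cpolyA W) + cpolyB W) z / poly (cpolyA W) z * v_fun W f z) (at z)"
proof -
  note br = weight_branchE[OF assms(3,1,2)]
  show "v_fun W f z \<noteq> 0" using br by (simp add: v_fun_def)
  have eq: "poly (pderiv (cpolyA W)) z * f z + poly (cpolyB W) z / poly (cpolyA W) z * f z * poly (cpolyA W) z =
      poly (pderiv (cpolyA W) + cpolyB W) z / poly (cpolyA W) z * (poly (cpolyA W) z * f z)"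
    using br(1) by (simp add: field_simps)
  show "(v_fun W f has_field_derivative
       poly (pderiv (cpolyA W) + cpolyB W) z / poly (cpolyA W) z * v_fun W f z) (at z)"
    using DERIV_mult[OF poly_DERIV[of "cpolyA W" z] br(3)] unfolding eq v_fun_def[abs_def] .
qed

lemma field_P_has_derivative:
  assumes "open U" "z \<in> U" "field_P W U \<phi>"
  shows "(\<phi> has_derivative (\<lambda>h. Re (- (1/2) * (poly (pderiv (cpolyA W) + cpolyB W) z / poly (cpolyA W) z) * h))) (at z)"
proof -
  obtain f where f: "weight_branch W U f" "\<And>z. z \<in> U \<Longrightarrow> \<phi> z = 1/2 * ln (cmod (1 / v_fun W f z))"
    using assms(3) unfolding field_P_def by blast
  note v = v_fun_has_derivative[OF assms(1,2) f(1)]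
  let ?E = "poly (pderiv (cpolyA W) + cpolyB W) z / poly (cpolyA W) z"
  have "((\<lambda>z. 1 / v_fun W f z) has_field_derivative
      (0 * v_fun W f z - 1 * (?E * v_fun W f z)) / (v_fun W f z * v_fun W f z)) (at z)"
    by (intro DERIV_divide DERIV_const v)
  from ln_cmod_has_derivative[OF this] v(1)
  have "((\<lambda>z. ln (cmod (1 / v_fun W f z))) has_derivative (\<lambda>h. Re (- ?E * h))) (at z)"
    by simp
  then have "((\<lambda>z. 1/2 * ln (cmod (1 / v_fun W f z))) has_derivative (\<lambda>h. 1/2 * Re (- ?E * h))) (at z)"
    by (rule has_derivative_mult_right)
  then have "(\<phi> has_derivative (\<lambda>h. 1/2 * Re (- ?E * h))) (at z)"
    by (rule has_derivative_transform_within_open[OF _ assms(1,2)]) (simp add: f(2))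
  moreover have "1/2 * Re (- E * h) = Re (- (1/2) * E * h)" for E h :: complex by (simp add: field_simps)
  ultimately show ?thesis by (simp only:)
qed

lemma field_S_has_derivative:
  assumes "open U" "z \<in> U" "field_S W W' R U \<phi>" "poly R z \<noteq> 0"
  defines "A \<equiv> cpolyA W" and "B \<equiv> cpolyB W" and "A' \<equiv> cpolyA W'" and "B' \<equiv> cpolyB W'"
  shows "(\<phi> has_derivative (\<lambda>h. Re (1/2 * (poly (pderiv R) z / poly R z - poly (pderiv (A * A')) z / poly (A * A') z
     + (poly (pderiv A + B) z / poly A z - poly (pderiv A' + B') z / poly A' z)) * h))) (at z)"
    and "poly A z \<noteq> 0" "poly A' z \<noteq> 0"
proof -
  obtain f f' where f: "weight_branch W U f" "weight_branch W' U f'"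
    "\<And>z. z \<in> U \<Longrightarrow> \<phi> z = 1/2 * ln (cmod (poly R z / (poly A z * poly A' z))) +
           1/2 * ln (cmod (v_fun W f z / v_fun W' f' z))"
    using assms(3) unfolding field_S_def A_def A'_def by blast
  note v = v_fun_has_derivative[OF assms(1,2) f(1), folded A_def B_def]
  note v' = v_fun_has_derivative[OF assms(1,2) f(2), folded A'_def B'_def]
  show A: "poly A z \<noteq> 0" "poly A' z \<noteq> 0"
    using weight_branchE(1)[OF f(1) assms(1,2)] weight_branchE(1)[OF f(2) assms(1,2)] by (simp_all add: A_def A'_def)
  have quot: "((\<lambda>z. ln (cmod (g z / k z))) has_derivative (\<lambda>h. Re ((g' / g z - k' / k z) * h))) (at z)"
    if "(g has_field_derivative g') (at z)" "(k has_field_derivative k') (at z)" "g z \<noteq> 0" "k z \<noteq> 0"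
    for g k :: "complex \<Rightarrow> complex" and g' k'
  proof -
    have "((\<lambda>z. g z / k z) has_field_derivative (g' * k z - g z * k') / (k z * k z)) (at z)"
      using that by (intro DERIV_divide)
    from ln_cmod_has_derivative[OF this] that(3,4)
    have "((\<lambda>z. ln (cmod (g z / k z))) has_derivative
        (\<lambda>h. Re ((g' * k z - g z * k') / (k z * k z) / (g z / k z) * h))) (at z)" by simp
    moreover have "(g' * k z - g z * k') / (k z * k z) / (g z / k z) = g' / g z - k' / k z"
      using that(3,4) by (simp add: field_simps)
    ultimately show ?thesis by (simp only:)
  qed
  have 1: "((\<lambda>z. ln (cmod (poly R z / poly (A * A') z))) has_derivative
     (\<lambda>h. Re ((poly (pderiv R) z / poly R z - poly (pderiv (A * A')) z / poly (A * A') z) * h))) (at z)"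
    by (rule quot[OF poly_DERIV poly_DERIV assms(4)]) (use A in simp)
  have 2: "((\<lambda>z. ln (cmod (v_fun W f z / v_fun W' f' z))) has_derivative
     (\<lambda>h. Re ((poly (pderiv A + B) z / poly A z - poly (pderiv A' + B') z / poly A' z) * h))) (at z)"
    using quot[OF v(2) v'(2) v(1) v'(1)] v(1) v'(1) by simp
  have "((\<lambda>z. 1/2 * ln (cmod (poly R z / poly (A * A') z)) + 1/2 * ln (cmod (v_fun W f z / v_fun W' f' z))) has_derivative
    (\<lambda>h. 1/2 * Re ((poly (pderiv R) z / poly R z - poly (pderiv (A * A')) z / poly (A * A') z) * h) +
      1/2 * Re ((poly (pderiv A + B) z / poly A z - poly (pderiv A' + B') z / poly A' z) * h))) (at z)"
    by (intro has_derivative_add has_derivative_mult_right 1 2)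
  then have "(\<phi> has_derivative
    (\<lambda>h. 1/2 * Re ((poly (pderiv R) z / poly R z - poly (pderiv (A * A')) z / poly (A * A') z) * h) +
      1/2 * Re ((poly (pderiv A + B) z / poly A z - poly (pderiv A' + B') z / poly A' z) * h))) (at z)"
    by (rule has_derivative_transform_within_open[OF _ assms(1,2)]) (simp add: f(3))
  moreover have "1/2 * Re (x * h) + 1/2 * Re (y * h) = Re (1/2 * (x + y) * h)" for x y h :: complex
    by (simp add: algebra_simps)
  ultimately show "(\<phi> has_derivative (\<lambda>h. Re (1/2 * (poly (pderiv R) z / poly R z - poly (pderiv (A * A')) z / poly (A * A') z
     + (poly (pderiv A + B) z / poly A z - poly (pderiv A' + B') z / poly A' z)) * h))) (at z)"
    by (simp only:)
qed

lemma field_S_uminus: "field_S W W' (- R) = field_S W W' R"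
  unfolding field_S_def fun_eq_iff by (simp add: norm_divide)

lemma field_P_deriv_at:
  assumes "finite_field_at (field_P W) p \<phi>" and A: "poly (cpolyA W) p \<noteq> 0"
  shows "(\<phi> has_derivative (\<lambda>h. Re (- (1/2) * (poly (pderiv (cpolyA W) + cpolyB W) p / poly (cpolyA W) p) * h))) (at p)"
proof -
  let ?L = "\<lambda>z. - (1/2) * (poly (pderiv (cpolyA W) + cpolyB W) z / poly (cpolyA W) z)"
  obtain r M where M: "r > 0" "M holomorphic_on ball p r"
    "(\<phi> has_derivative (\<lambda>h. Re (M p * h))) (at p)"
    "\<And>z. z \<in> ball p r - {p} \<Longrightarrow> M z = ?L z"
    using finite_field_determination[OF assms(1), of "\<lambda>_. True" ?L] field_P_has_derivative by metis
  have "M p = ?L p"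
  proof (rule eq_at_from_punctured[OF _ _ M(1,4)])
    show "isCont M p" using M(1,2)
      by (meson centre_in_ball continuous_on_eq_continuous_at holomorphic_on_imp_continuous_on open_ball)
    show "isCont ?L p" using A by (intro continuous_intros) auto
  qed
  then show ?thesis using M(3) by (simp only:)
qed

lemma finite_roots_avoid:
  fixes R :: "complex poly"
  assumes "R \<noteq> 0"
  obtains \<rho> where "\<rho> > 0" "\<And>z. z \<in> ball p \<rho> - {p} \<Longrightarrow> poly R z \<noteq> 0"
proof -
  have "finite {z. poly R z = 0}" using assms by (rule poly_roots_finite)
  then obtain d where d: "d > 0" "\<forall>x\<in>{z. poly R z = 0}. x \<noteq> p \<longrightarrow> d \<le> dist p x"
    using finite_set_avoid by blast
  show thesis by (rule that[OF d(1)]) (use d(2) in fastforce)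
qed

text \<open>
  The equilibrium condition at a simple zero \<open>p\<close> of \<open>S\<close>, for \<open>\<alpha> = A A' S'\<close> (with \<open>A'\<close> and \<open>S'\<close> of the
  other weight). Write \<open>\<alpha> = u\<^sup>k \<alpha>0\<close> and \<open>R = u\<^sup>l R0\<close> with \<open>u = z - p\<close>. Comparison of the leading terms in
  the hypothesis \<open>eq\<close> gives \<open>k = l\<close>: for \<open>k < l\<close> the leading coefficient \<open>k - l - 1\<close> would have
  to vanish, and for \<open>k > l\<close> the value of \<open>P\<close>. After division by \<open>u\<^bsup>2k\<^esup>\<close> the equation has the same
  form with \<open>\<alpha>0\<close> and \<open>R0\<close> in place of \<open>\<alpha>\<close> and \<open>R\<close>, and its value and its derivative at \<open>p\<close>
  give the claim. In analytic terms, with a primitive \<open>\<Phi>\<close> of \<open>M\<close>, the hypothesis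
  says that \<open>P exp(2 \<Phi>)/S\<^sup>2\<close> is the derivative of the single-valued function \<open>\<alpha> exp(2 \<Phi>)/(R S)\<close>; so its
  residue at \<open>p\<close> is 0, which is the claim.
\<close>

lemma simple_zero_condition:
  fixes P S \<alpha> R :: "complex poly" and M :: "complex \<Rightarrow> complex"
  assumes r: "r > 0" and M: "M holomorphic_on ball p r"
    and eq: "\<And>z. z \<in> ball p r - {p} \<Longrightarrow>
       poly S z * (poly (pderiv \<alpha>) z * poly R z - poly \<alpha> z * poly (pderiv R) z)
       - poly (pderiv S) z * poly \<alpha> z * poly R z + 2 * M z * poly S z * poly \<alpha> z * poly R z
       = poly P z * poly R z ^ 2"
    and S: "poly S p = 0" "poly (pderiv S) p \<noteq> 0" and P: "poly P p \<noteq> 0"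
    and nz: "\<alpha> \<noteq> 0" "R \<noteq> 0"
  shows "M p = poly (pderiv (pderiv S)) p / (2 * poly (pderiv S) p) - poly (pderiv P) p / (2 * poly P p)"
proof -
  define k l where "k = order p \<alpha>" and "l = order p R"
  obtain \<alpha>0 where \<alpha>0: "\<alpha> = [:- p, 1:] ^ k * \<alpha>0" "poly \<alpha>0 p \<noteq> 0"
    using order_decomp[OF nz(1), of p] by (auto simp: k_def poly_eq_0_iff_dvd)
  obtain R0 where R0: "R = [:- p, 1:] ^ l * R0" "poly R0 p \<noteq> 0"
    using order_decomp[OF nz(2), of p] by (auto simp: l_def poly_eq_0_iff_dvd)
  obtain s where s: "S = [:- p, 1:] * s" using S(1) by (auto simp: poly_eq_0_iff_dvd dvd_def)
  define u where "u z = z - p" for z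
  have S': "pderiv S = [:- p, 1:] * pderiv s + s" unfolding s pderiv_mult by (simp add: pderiv_pCons)
  have sp: "poly s p = poly (pderiv S) p" unfolding S' by simp
  have lin: "poly ([:- p, 1:] * q) z = u z * poly q z" "poly ([:- p, 1:] ^ m) z = u z ^ m" for q z m
    by (simp_all add: u_def algebra_simps poly_power)
  have dpow: "u z * poly (pderiv ([:- p, 1:] ^ m * q)) z = u z ^ m * (of_nat m * poly q z + u z * poly (pderiv q) z)" for m q z
  proof (cases m)
    case (Suc j)
    have "poly (pderiv ([:- p, 1:] ^ Suc j * q)) z =
        u z ^ Suc j * poly (pderiv q) z + poly q z * (of_nat (Suc j) * u z ^ j)"
      unfolding pderiv_mult pderiv_power_Suc poly_add poly_mult poly_smult lin
      by (simp add: pderiv_pCons)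
    then show ?thesis unfolding Suc by (simp add: algebra_simps)
  qed (simp add: algebra_simps)
  define W0 where "W0 z = poly (pderiv \<alpha>0) z * poly R0 z - poly \<alpha>0 z * poly (pderiv R0) z" for z
  \<comment> \<open>Up to the factor \<open>u ^ (k + l - 1)\<close>, the left-hand side of \<open>eq\<close>.\<close>
  define X where "X z = poly s z * ((of_nat k - of_nat l) * poly \<alpha>0 z * poly R0 z + u z * W0 z)
     - poly (pderiv S) z * poly \<alpha>0 z * poly R0 z + 2 * M z * (u z * poly s z) * poly \<alpha>0 z * poly R0 z" for z
  have Xeq: "u z ^ (k + l) * X z = u z ^ (2 * l) * (poly P z * poly R0 z ^ 2)" if z: "z \<in> ball p r - {p}" for z
  proof -
    have u0: "u z \<noteq> 0" using z by (simp add: u_def)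
    have e1: "poly \<alpha> z = u z ^ k * poly \<alpha>0 z" "poly R z = u z ^ l * poly R0 z"
      unfolding \<alpha>0(1) R0(1) by (simp_all only: poly_mult lin)
    have e2: "u z * poly (pderiv \<alpha>) z = u z ^ k * (of_nat k * poly \<alpha>0 z + u z * poly (pderiv \<alpha>0) z)"
      "u z * poly (pderiv R) z = u z ^ l * (of_nat l * poly R0 z + u z * poly (pderiv R0) z)"
      unfolding \<alpha>0(1) R0(1) by (rule dpow)+
    have e3: "poly S z = u z * poly s z" unfolding s by (rule lin)
    have "u z ^ (k + l) * X z =
       poly s z * ((u z * poly (pderiv \<alpha>) z) * poly R z - poly \<alpha> z * (u z * poly (pderiv R) z))
       - poly (pderiv S) z * poly \<alpha> z * poly R z + 2 * M z * (u z * poly s z) * poly \<alpha> z * poly R z"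
      unfolding e2 e1 X_def W0_def by (simp add: power_add algebra_simps)
    also have "\<dots> = poly S z * (poly (pderiv \<alpha>) z * poly R z - poly \<alpha> z * poly (pderiv R) z)
       - poly (pderiv S) z * poly \<alpha> z * poly R z + 2 * M z * poly S z * poly \<alpha> z * poly R z"
      unfolding e3 by (simp add: algebra_simps)
    also have "\<dots> = poly P z * poly R z ^ 2" by (rule eq[OF z])
    also have "\<dots> = u z ^ (2 * l) * (poly P z * poly R0 z ^ 2)"
      unfolding e1 by (simp add: power_mult_distrib power_even_eq)
    finally show ?thesis .
  qed
  have Mp: "isCont M p" using M r
    by (meson centre_in_ball continuous_on_eq_continuous_at holomorphic_on_imp_continuous_on open_ball)
  have contX: "isCont X p" unfolding X_def W0_def u_def by (intro continuous_intros Mp)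
  have contY: "isCont (\<lambda>z. poly P z * poly R0 z ^ 2) p" by (intro continuous_intros)
  have contu: "isCont (\<lambda>z. u z ^ m) p" for m unfolding u_def by (intro continuous_intros)
  have Xp: "X p = poly s p * poly \<alpha>0 p * poly R0 p * (of_nat k - of_nat l - 1)"
    unfolding X_def sp[symmetric] by (simp add: u_def algebra_simps)
  have "k = l"
  proof (rule ccontr)
    assume "k \<noteq> l"
    then consider "k < l" | "l < k" by linarith
    then show False
    proof cases
      case 1
      have "X z = u z ^ (l - k) * (poly P z * poly R0 z ^ 2)" if z: "z \<in> ball p r - {p}" for z
      proof -
        have "u z \<noteq> 0" using z by (simp add: u_def)
        moreover have "2 * l = (k + l) + (l - k)" using 1 by simp
        then have "u z ^ (k + l) * X z = u z ^ (k + l) * (u z ^ (l - k) * (poly P z * poly R0 z ^ 2))"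
          using Xeq[OF z] by (simp only: power_add mult.assoc)
        ultimately show ?thesis by simp
      qed
      then have "X p = u p ^ (l - k) * (poly P p * poly R0 p ^ 2)"
        using eq_at_from_punctured[OF contX isCont_mult[OF contu contY] r] by blast
      then have "X p = 0" using 1 by (simp add: u_def)
      then have "(of_nat k - of_nat l - 1 :: complex) = 0"
        using Xp \<alpha>0(2) R0(2) sp S(2) by simp
      then have "(of_nat k :: complex) = of_nat (Suc l)" by (simp add: algebra_simps)
      then have "k = Suc l" by (simp only: of_nat_eq_iff)
      then show False using 1 by simp
    next
      case 2
      have "u z ^ (k - l) * X z = poly P z * poly R0 z ^ 2" if z: "z \<in> ball p r - {p}" for z
      proof -
        have "u z \<noteq> 0" using z by (simp add: u_def)
        moreover have "k + l = 2 * l + (k - l)" using 2 by simp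
        then have "u z ^ (2 * l) * (u z ^ (k - l) * X z) = u z ^ (2 * l) * (poly P z * poly R0 z ^ 2)"
          using Xeq[OF z] by (simp only: power_add mult.assoc)
        ultimately show ?thesis by simp
      qed
      then have "u p ^ (k - l) * X p = poly P p * poly R0 p ^ 2"
        using eq_at_from_punctured[OF isCont_mult[OF contu contX] contY r] by blast
      then show False using 2 P R0(2) by (simp add: u_def zero_power)
    qed
  qed
  have XY: "X z = poly P z * poly R0 z ^ 2" if z: "z \<in> ball p r" for z
  proof -
    have punct: "X z = poly P z * poly R0 z ^ 2" if z: "z \<in> ball p r - {p}" for z
    proof -
      have "u z \<noteq> 0" using z by (simp add: u_def)
      then show ?thesis using Xeq[OF z] \<open>k = l\<close> by (simp add: mult_2)
    qed
    then have "X p = poly P p * poly R0 p ^ 2"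
      using eq_at_from_punctured[OF contX contY r] by blast
    then show ?thesis using punct[of z] z by (cases "z = p") auto
  qed
  have XS: "X = (\<lambda>z. poly S z * (W0 z + 2 * M z * poly \<alpha>0 z * poly R0 z) - poly (pderiv S) z * (poly \<alpha>0 z * poly R0 z))"
    unfolding X_def s lin \<open>k = l\<close> by (simp add: algebra_simps fun_eq_iff)
  have W0': "(W0 has_field_derivative deriv W0 p) (at p)"
    unfolding W0_def[abs_def]
    by (intro DERIV_deriv_iff_field_differentiable[THEN iffD2] field_differentiable_diff field_differentiable_mult)
      (auto simp: field_differentiable_def intro: poly_DERIV)
  have M': "(M has_field_derivative deriv M p) (at p)"
    using holomorphic_derivI[OF M open_ball] r by simp
  let ?V = "\<lambda>z. W0 z + 2 * M z * poly \<alpha>0 z * poly R0 z"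
  have "?V field_differentiable (at p)"
    using W0' M' by (intro derivative_intros field_differentiable_add field_differentiable_mult)
      (auto simp: field_differentiable_def intro: poly_DERIV)
  then obtain V' where V': "(?V has_field_derivative V') (at p)" by (auto simp: field_differentiable_def)
  have d1: "(X has_field_derivative
      (poly (pderiv S) p * ?V p + V' * poly S p) -
      (poly (pderiv (pderiv S)) p * (poly \<alpha>0 p * poly R0 p) +
        (poly (pderiv \<alpha>0) p * poly R0 p + poly (pderiv R0) p * poly \<alpha>0 p) * poly (pderiv S) p)) (at p)"
    unfolding XS by (intro DERIV_diff DERIV_mult poly_DERIV V')
  have "((\<lambda>z. poly (P * R0 ^ 2) z) has_field_derivative poly (pderiv (P * R0 ^ 2)) p) (at p)"
    by (rule poly_DERIV)
  then have "(X has_field_derivative poly (pderiv (P * R0 ^ 2)) p) (at p)"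
    by (rule has_field_derivative_transform_within_open[OF _ open_ball[of p r]]) (use r XY in simp_all)
  from DERIV_unique[OF d1 this]
  have main: "poly (pderiv S) p * ?V p - (poly (pderiv (pderiv S)) p * (poly \<alpha>0 p * poly R0 p) +
        (poly (pderiv \<alpha>0) p * poly R0 p + poly (pderiv R0) p * poly \<alpha>0 p) * poly (pderiv S) p) =
     poly (pderiv P) p * poly R0 p ^ 2 + 2 * poly P p * poly R0 p * poly (pderiv R0) p"
    using S(1) by (simp add: pderiv_mult power2_eq_square algebra_simps)
  have val: "poly P p * poly R0 p = - (poly (pderiv S) p * poly \<alpha>0 p)"
  proof -
    have "- (poly (pderiv S) p * poly \<alpha>0 p) * poly R0 p = poly P p * poly R0 p * poly R0 p"
      using XY[of p] r S(1) unfolding XS by (simp add: power2_eq_square mult.assoc)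
    then have "- (poly (pderiv S) p * poly \<alpha>0 p) = poly P p * poly R0 p"
      by (simp only: mult_right_cancel[OF R0(2)])
    then show ?thesis by (rule sym)
  qed
  have gen: "m = s2 / (2 * s1) - p1 / (2 * p0)"
    if h1: "s1 * ((a1 * r0 - a0 * r1) + 2 * m * a0 * r0) - (s2 * (a0 * r0) + (a1 * r0 + r1 * a0) * s1) =
        p1 * r0 ^ 2 + 2 * p0 * r0 * r1"
      and h2: "p0 * r0 = - (s1 * a0)" and h3: "s1 \<noteq> 0" "p0 \<noteq> 0" "r0 \<noteq> 0" "a0 \<noteq> 0"
    for m s1 s2 p0 p1 a0 a1 r0 r1 :: complex
  proof -
    have "(2 * m * s1 - s2) * (a0 * r0) = p1 * r0 ^ 2 + 2 * (p0 * r0 + s1 * a0) * r1"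
      using h1 by (simp add: algebra_simps)
    then have "(2 * m * s1 - s2) * a0 * r0 = p1 * r0 * r0" unfolding h2 by (simp add: power2_eq_square)
    then have "(2 * m * s1 - s2) * a0 = p1 * r0" using h3 by simp
    then have "(2 * m * s1 - s2) * a0 * p0 = p1 * (p0 * r0)" by simp
    then have "(2 * m * s1 - s2) * p0 * a0 = - (p1 * s1) * a0" unfolding h2 by (simp add: algebra_simps)
    then have "(2 * m * s1 - s2) * p0 = - (p1 * s1)"
      by (simp only: mult_right_cancel[OF h3(4)])
    then have "m * (2 * s1 * p0) = s2 * p0 - p1 * s1" by (simp add: algebra_simps)
    then have "m = (s2 * p0 - p1 * s1) / (2 * s1 * p0)" using h3 by (simp add: eq_divide_eq)
    also have "\<dots> = s2 / (2 * s1) - p1 / (2 * p0)"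
      using h3 by (simp add: diff_divide_distrib)
    finally show ?thesis .
  qed
  show ?thesis
    by (rule gen[OF main[unfolded W0_def] val S(2) P R0(2) \<alpha>0(2)])
qed

text \<open>
  The formula for the derivative of the field, multiplied by \<open>R A A'\<close>, and the identity for \<open>P R\<close> combine to the
  hypothesis of \<open>simple_zero_condition\<close>. The zeros of \<open>R\<close> are isolated, so a punctured disc without
  them can be chosen.
\<close>

lemma field_S_deriv_at:
  fixes W W' :: weight_data and P S S' R :: "complex poly"
  defines "A \<equiv> cpolyA W" and "B \<equiv> cpolyB W" and "A' \<equiv> cpolyA W'" and "B' \<equiv> cpolyB W'"
  assumes fin: "finite_field_at (field_S W W' R) p \<phi>"
    and id: "P * R = A * A' * (S * pderiv S' - S' * pderiv S)
       + S * S' * ((pderiv A + B) * A' - (pderiv A' + B') * A)"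
    and nz: "P \<noteq> 0" "R \<noteq> 0" and S: "poly S p = 0" "poly (pderiv S) p \<noteq> 0" and P: "poly P p \<noteq> 0"
  shows "(\<phi> has_derivative (\<lambda>h. Re ((poly (pderiv (pderiv S)) p / (2 * poly (pderiv S) p)
     - poly (pderiv P) p / (2 * poly P p)) * h))) (at p)"
proof -
  define d where "d = A * A'"
  define e where "e = (pderiv A + B) * A' - (pderiv A' + B') * A"
  define \<alpha> where "\<alpha> = d * S'"
  let ?L = "\<lambda>z. 1/2 * (poly (pderiv R) z / poly R z - poly (pderiv (A * A')) z / poly (A * A') z
     + (poly (pderiv A + B) z / poly A z - poly (pderiv A' + B') z / poly A' z))"
  obtain r0 M where M: "r0 > 0" "M holomorphic_on ball p r0"
    "(\<phi> has_derivative (\<lambda>h. Re (M p * h))) (at p)"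
    "\<And>z. z \<in> ball p r0 - {p} \<Longrightarrow> \<exists>U. open U \<and> z \<in> U \<and> field_S W W' R U \<phi>"
    "\<And>z. z \<in> ball p r0 - {p} \<Longrightarrow> poly R z \<noteq> 0 \<Longrightarrow> M z = ?L z"
    using finite_field_determination[OF fin, of "\<lambda>z. poly R z \<noteq> 0" ?L]
      field_S_has_derivative(1)[of _ _ W W' R \<phi>, folded A_def B_def A'_def B'_def] by metis
  obtain \<rho> where \<rho>: "\<rho> > 0" "\<And>z. z \<in> ball p \<rho> - {p} \<Longrightarrow> poly R z \<noteq> 0"
    using finite_roots_avoid[OF nz(2)] by blast
  define r where "r = min r0 \<rho>"
  have r: "r > 0" using M(1) \<rho>(1) by (simp add: r_def)
  have \<alpha>0: "\<alpha> \<noteq> 0"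
  proof
    assume "\<alpha> = 0"
    then have "d = 0 \<or> S' = 0" by (simp add: \<alpha>_def)
    then have "A = 0 \<or> A' = 0 \<or> S' = 0" by (auto simp: d_def)
    \<comment> \<open>A branch exists near every point of the punctured disc, hence neither polynomial vanishes identically.\<close>
    moreover have "A \<noteq> 0" "A' \<noteq> 0"
    proof -
      have "p + of_real (r / 2) \<in> ball p r0 - {p}" "p + of_real (r / 2) \<in> ball p \<rho> - {p}"
        using r by (auto simp: dist_norm r_def)
      then obtain U where "open U" "p + of_real (r / 2) \<in> U" "field_S W W' R U \<phi>" "poly R (p + of_real (r / 2)) \<noteq> 0"
        using M(4) \<rho>(2) by blast
      from field_S_has_derivative(2,3)[OF this, folded A_def A'_def] show "A \<noteq> 0" "A' \<noteq> 0" by auto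
    qed
    ultimately have "S' = 0" by blast
    then have "P * R = 0" using id by simp
    then show False using nz by simp
  qed
  have "M p = poly (pderiv (pderiv S)) p / (2 * poly (pderiv S) p) - poly (pderiv P) p / (2 * poly P p)"
  proof (rule simple_zero_condition[OF r _ _ S P \<alpha>0 nz(2)])
    show "M holomorphic_on ball p r"
      using M(2) by (rule holomorphic_on_subset) (auto simp: r_def)
    fix z assume z: "z \<in> ball p r - {p}"
    then have z1: "z \<in> ball p r0 - {p}" and Rz: "poly R z \<noteq> 0" using \<rho>(2)[of z] by (auto simp: r_def)
    obtain U where U: "open U" "z \<in> U" "field_S W W' R U \<phi>" using M(4)[OF z1] by blast
    note A = field_S_has_derivative(2,3)[OF U Rz, folded A_def A'_def]
    have "2 * M z * (poly R z * (poly A z * poly A' z)) =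
        poly (pderiv R) z * (poly A z * poly A' z) - poly R z * poly (pderiv d) z + poly R z * poly e z"
    proof -
      have gen: "2 * (1/2 * (R' / R - d' / (a * a') + (x / a - x' / a'))) * (R * (a * a')) =
          R' * (a * a') - R * d' + R * (x * a' - x' * a)"
        if "R \<noteq> 0" "a \<noteq> 0" "a' \<noteq> 0" for R R' d' a a' x x' :: complex
        using that by (simp add: field_simps)
      show ?thesis unfolding M(5)[OF z1 Rz] poly_mult[of A A'] gen[OF Rz A] d_def e_def by simp
    qed
    then have key: "2 * M z * poly R z * poly d z =
        poly (pderiv R) z * poly d z - poly R z * poly (pderiv d) z + poly R z * poly e z"
      by (simp add: d_def mult.assoc)
    have idz: "poly P z * poly R z = poly d z * (poly S z * poly (pderiv S') z - poly S' z * poly (pderiv S) z)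
       + poly S z * poly S' z * poly e z"
    proof -
      have "poly (P * R) z = poly (d * (S * pderiv S' - S' * pderiv S) + S * S' * e) z"
        unfolding id d_def e_def ..
      then show ?thesis by simp
    qed
    have \<alpha>': "poly (pderiv \<alpha>) z = poly (pderiv d) z * poly S' z + poly d z * poly (pderiv S') z"
      by (simp add: \<alpha>_def pderiv_mult algebra_simps)
    have "poly S z * (poly (pderiv \<alpha>) z * poly R z - poly \<alpha> z * poly (pderiv R) z)
       - poly (pderiv S) z * poly \<alpha> z * poly R z + 2 * M z * poly S z * poly \<alpha> z * poly R z =
       poly S z * ((poly (pderiv d) z * poly S' z + poly d z * poly (pderiv S') z) * poly R z - poly d z * poly S' z * poly (pderiv R) z)
       - poly (pderiv S) z * poly d z * poly S' z * poly R z + poly S z * poly S' z * (2 * M z * poly R z * poly d z)"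
      unfolding \<alpha>' by (simp add: \<alpha>_def algebra_simps)
    also have "\<dots> = poly R z * (poly P z * poly R z)"
      unfolding key idz by (simp add: algebra_simps)
    finally show "poly S z * (poly (pderiv \<alpha>) z * poly R z - poly \<alpha> z * poly (pderiv R) z)
       - poly (pderiv S) z * poly \<alpha> z * poly R z + 2 * M z * poly S z * poly \<alpha> z * poly R z = poly P z * poly R z ^ 2"
      by (simp add: power2_eq_square)
  qed
  then show ?thesis using M(3) by (simp only:)
qed

text \<open>
  Both groups of equilibrium equations for one partner. The root sums are turned into logarithmic
  derivatives of \<open>P\<close> and \<open>S\<close>, and the derivatives of the fields are known at the zeros.
\<close>

lemma critical_vector_measure_partner:
  fixes W W' :: weight_data and P S S' R K Q :: "complex poly"
  defines "A \<equiv> cpolyA W" and "B \<equiv> cpolyB W" and "A' \<equiv> cpolyA W'" and "B' \<equiv> cpolyB W'"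
  assumes S: "S = partner_poly A B K P Q"
    and id: "P * R = A * A' * (S * pderiv S' - S' * pderiv S)
       + S * S' * ((pderiv A + B) * A' - (pderiv A' + B') * A)"
    and nz: "P \<noteq> 0" "R \<noteq> 0" "S \<noteq> 0"
    and wd: "energy_well_defined (field_P W) (field_S W W' R) (proots P) (proots S)"
  shows "critical_vector_measure (-1/2) (field_P W) (field_S W W' R) (proots P) (proots S)"
  unfolding critical_vector_measure_def
proof (intro conjI allI impI, rule wd)
  fix zs xs \<phi>1 \<phi>2
  assume h: "mset zs = proots P \<and> mset xs = proots S \<and>
        (\<forall>p\<in>set zs. finite_field_at (field_P W) p \<phi>1) \<and> (\<forall>p\<in>set xs. finite_field_at (field_S W W' R) p \<phi>2)"
  then have zs: "mset zs = proots P" and xs: "mset xs = proots S" by auto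
  have disj: "\<not> (poly P x = 0 \<and> poly S x = 0)" for x
    using wd nz unfolding energy_well_defined_def by auto
  have cP: "count (proots P) x \<le> 1" and cS: "count (proots S) x \<le> 1" for x
    using wd unfolding energy_well_defined_def by auto
  have rz: "poly P (zs ! k) = 0" if "k < length zs" for k
  proof -
    have "zs ! k \<in># proots P" using that by (simp flip: zs)
    then show ?thesis using nz(1) by simp
  qed
  have rx: "poly S (xs ! j) = 0" if "j < length xs" for j
  proof -
    have "xs ! j \<in># proots S" using that by (simp flip: xs)
    then show ?thesis using nz(3) by simp
  qed
  {
    fix k assume k: "k < length zs"
    let ?z = "zs ! k"
    have P0: "poly P ?z = 0" by (rule rz[OF k])
    then have S0: "poly S ?z \<noteq> 0" using disj by blast
    note pz = partner_poly_at_zero[OF P0 S]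
    have A0: "poly A ?z \<noteq> 0" using pz(1) S0 by auto
    have fd: "(\<phi>1 has_derivative (\<lambda>h. Re (- (1/2) * (poly (pderiv A + B) ?z / poly A ?z) * h))) (at ?z)"
      using field_P_deriv_at[of W ?z \<phi>1] A0 h k unfolding A_def B_def by simp
    note sd = second_deriv_roots[OF nz(1) zs k cP]
    have "poly (pderiv (pderiv P)) ?z / (2 * poly (pderiv P) ?z) + of_real (-1/2) * (poly (pderiv S) ?z / poly S ?z) =
        - (1/2) * (poly (pderiv A + B) ?z / poly A ?z)"
    proof -
      have gen: "p2 / (2 * p1) + of_real (-1/2) * (s1 / s0) = - (1/2) * (e / a)"
        if "p1 * (a * s1 - e * s0) = a * p2 * s0" "p1 \<noteq> 0" "s0 \<noteq> 0" "a \<noteq> 0" for p1 p2 s0 s1 e a :: complex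
      proof -
        have "a * p2 * s0 - p1 * (a * s1 - e * s0) = 0" using that(1) by simp
        moreover have "p2 / (2 * p1) + of_real (-1/2) * (s1 / s0) + (1/2) * (e / a) =
           (a * p2 * s0 - p1 * (a * s1 - e * s0)) / (2 * p1 * s0 * a)"
          using that(2-4) by (simp add: field_simps)
        ultimately have "p2 / (2 * p1) + of_real (-1/2) * (s1 / s0) + (1/2) * (e / a) = 0" by simp
        then show ?thesis by (simp add: add_eq_0_iff2)
      qed
      show ?thesis by (rule gen[OF pz(2) sd(1) S0 A0])
    qed
    then have M: "(\<Sum>i\<in>{..<length zs} - {k}. 1 / (?z - zs ! i)) + of_real (-1/2) * (\<Sum>j<length xs. 1 / (?z - xs ! j)) =
        - (1/2) * (poly (pderiv A + B) ?z / poly A ?z)"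
      unfolding sd(2) log_deriv_roots[OF nz(3) xs S0] .
    show "((\<lambda>z. vector_energy (-1/2) \<phi>1 \<phi>2 (zs[k := z]) xs) has_derivative (\<lambda>_. 0)) (at ?z)"
    proof (rule vector_energy_stationary[OF k fd sd(3) _ M])
      show "xs ! j \<noteq> ?z" if "j < length xs" for j using rx[OF that] S0 by metis
    qed
  }
  {
    fix j assume j: "j < length xs"
    let ?x = "xs ! j"
    have S0: "poly S ?x = 0" by (rule rx[OF j])
    then have P0: "poly P ?x \<noteq> 0" using disj by blast
    note sd = second_deriv_roots[OF nz(3) xs j cS]
    have fd: "(\<phi>2 has_derivative (\<lambda>h. Re ((poly (pderiv (pderiv S)) ?x / (2 * poly (pderiv S) ?x)
       - poly (pderiv P) ?x / (2 * poly P ?x)) * h))) (at ?x)"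
      by (rule field_S_deriv_at[OF _ id[unfolded A_def B_def A'_def B'_def] nz(1,2) S0 sd(1) P0]) (use h j in simp)
    have M: "(\<Sum>i\<in>{..<length xs} - {j}. 1 / (?x - xs ! i)) + of_real (-1/2) * (\<Sum>k<length zs. 1 / (?x - zs ! k)) =
        poly (pderiv (pderiv S)) ?x / (2 * poly (pderiv S) ?x) - poly (pderiv P) ?x / (2 * poly P ?x)"
      unfolding sd(2) log_deriv_roots[OF nz(1) zs P0] by simp
    \<comment> \<open>The energy is symmetric in its two groups of points.\<close>
    have "((\<lambda>x. vector_energy (-1/2) \<phi>2 \<phi>1 (xs[j := x]) zs) has_derivative (\<lambda>_. 0)) (at ?x)"
    proof (rule vector_energy_stationary[OF j fd sd(3) _ M])
      show "zs ! k \<noteq> ?x" if "k < length zs" for k using rz[OF that] P0 by metis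
    qed
    then show "((\<lambda>x. vector_energy (-1/2) \<phi>1 \<phi>2 zs (xs[j := x])) has_derivative (\<lambda>_. 0)) (at ?x)"
      by (subst vector_energy_commute)
  }
qed

section \<open>The electrostatic model\<close>

theorem theorem5p10:
  fixes W1 W2 :: weight_data and P :: "complex poly" and n1 n2 :: nat
  assumes "semiclassical W1" and "semiclassical W2"
    and "lead_coeff P = 1" and "degree P = n1 + n2"
    and "orthogonal_to_order W1 P n1" and "orthogonal_to_order W2 P n2"
    and "wronskian_not_identically_zero W1 W2 P"
  shows "\<exists>S1 S2 R.
    is_electrostatic_partner W1 P S1 \<and>
    is_electrostatic_partner W2 P S2 \<and>
    is_R_polynomial W1 W2 P R \<and> R \<noteq> 0 \<and>
    int (degree R) \<le> 2 * weight_class W1 + 2 * weight_class W2 + 3 \<and>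
    (rsquarefree P \<and> rsquarefree S1 \<and>
       energy_well_defined (field_P W1) (field_S W1 W2 R) (proots P) (proots S1) \<longrightarrow>
     critical_vector_measure (-1/2) (field_P W1) (field_S W1 W2 R) (proots P) (proots S1)) \<and>
    (rsquarefree P \<and> rsquarefree S2 \<and>
       energy_well_defined (field_P W2) (field_S W2 W1 R) (proots P) (proots S2) \<longrightarrow>
     critical_vector_measure (-1/2) (field_P W2) (field_S W2 W1 R) (proots P) (proots S2))"
proof -
  obtain K1 Q1 where cs1: "cauchy_structure W1 P (cauchy_transform W1 (\<lambda>_. 1)) K1 Q1"
    using cauchy_structure_exists[OF assms(1)] by blast
  obtain K2 Q2 where cs2: "cauchy_structure W2 P (cauchy_transform W2 (\<lambda>_. 1)) K2 Q2"
    using cauchy_structure_exists[OF assms(2)] by blast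
  define S1 where "S1 = partner_poly (cpolyA W1) (cpolyB W1) K1 P Q1"
  define S2 where "S2 = partner_poly (cpolyA W2) (cpolyB W2) K2 P Q2"
  define R where "R = R_poly P (cpolyA W1) (cpolyB W1) K1 Q1 (cpolyA W2) (cpolyB W2) K2 Q2"
  have S: "is_electrostatic_partner W1 P S1" "is_electrostatic_partner W2 P S2"
    unfolding S1_def S2_def
    by (rule is_electrostatic_partner_partner_poly[OF cs1] is_electrostatic_partner_partner_poly[OF cs2])+
  have isR: "is_R_polynomial W1 W2 P R"
    unfolding R_def by (rule is_R_polynomial_R_poly[OF cs1 cs2])
  have R0: "R \<noteq> 0" by (rule R_polynomial_nonzero[OF isR assms(7)])
  have deg: "int (degree R) \<le> 2 * weight_class W1 + 2 * weight_class W2 + 3"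
    using degree_R_poly[OF assms(1,2,4,5,6) cs1 cs2] R0 unfolding R_def by blast
  have P0: "P \<noteq> 0" using assms(3) by auto
  have crit1: "critical_vector_measure (-1/2) (field_P W1) (field_S W1 W2 R) (proots P) (proots S1)"
    if "rsquarefree S1" "energy_well_defined (field_P W1) (field_S W1 W2 R) (proots P) (proots S1)"
  proof (rule critical_vector_measure_partner[OF S1_def _ P0 R0 _ that(2)])
    show "P * R = cpolyA W1 * cpolyA W2 * (S1 * pderiv S2 - S2 * pderiv S1)
       + S1 * S2 * ((pderiv (cpolyA W1) + cpolyB W1) * cpolyA W2 - (pderiv (cpolyA W2) + cpolyB W2) * cpolyA W1)"
      unfolding R_def by (rule R_poly_partner[OF S1_def S2_def])
    show "S1 \<noteq> 0" using that(1) by (simp add: rsquarefree_def)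
  qed
  have crit2: "critical_vector_measure (-1/2) (field_P W2) (field_S W2 W1 R) (proots P) (proots S2)"
    if "rsquarefree S2" "energy_well_defined (field_P W2) (field_S W2 W1 R) (proots P) (proots S2)"
  proof -
    \<comment> \<open>Exchanging the weights changes the sign of \<open>R\<close>, to which the field is blind.\<close>
    have "critical_vector_measure (-1/2) (field_P W2) (field_S W2 W1 (- R)) (proots P) (proots S2)"
    proof (rule critical_vector_measure_partner[OF S2_def _ P0])
      show "P * - R = cpolyA W2 * cpolyA W1 * (S2 * pderiv S1 - S1 * pderiv S2)
         + S2 * S1 * ((pderiv (cpolyA W2) + cpolyB W2) * cpolyA W1 - (pderiv (cpolyA W1) + cpolyB W1) * cpolyA W2)"
        unfolding R_def R_poly_swap[symmetric] by (rule R_poly_partner[OF S2_def S1_def])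
      show "- R \<noteq> 0" using R0 by simp
      show "S2 \<noteq> 0" using that(1) by (simp add: rsquarefree_def)
      show "energy_well_defined (field_P W2) (field_S W2 W1 (- R)) (proots P) (proots S2)"
        unfolding field_S_uminus by (rule that(2))
    qed
    then show ?thesis unfolding field_S_uminus .
  qed
  show ?thesis
    by (rule exI[of _ S1], rule exI[of _ S2], rule exI[of _ R]) (use S isR R0 deg crit1 crit2 in blast)
qed

end
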